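(* Let $F\subset\mathrm{Sym}^2(\mathbb{R}^n)$ be a convex cone subequation such that $-P_e\notin F$ for every unit vector $e$, let $\Omega\subset\mathbb{R}^n$ be a bounded domain with smooth strictly $F$-convex boundary, and let $x_0\in\Omega$. Let $h\in C(\overline\Omega)$ be $F$-harmonic on $\Omega\setminus\{x_0\}$, with a downward-pointing singularity at $x_0$ (i.e. $h$ is $F$-subharmonic near $x_0$, $h(x)>h(x_0)$ for $x\ne x_0$ near $x_0$, and $h$ has no test functions at $x_0$), and with $h(x_0)<\inf_{\partial\Omega}h$. Assume: (H3) for every function $H$ which is $F$-subharmonic near $x_0$ and $F$-harmonic on a deleted neighborhood of $x_0$, the limit $\Theta_{x_0}(H)=\lim_{x\to x_0}\frac{H(x)-H(x_0)}{h(x)-h(x_0)}$ exists and is $\ge0$; (H4) if $H$ is $F$-harmonic in a neighborhood of $x_0$, then $\Theta_{x_0}(H)=0$. Then for each $\Theta\ge0$ and $\varphi\in C(\partial\Omega)$ there exists a unique $H\in C(\overline\Omega)$ which is $F$-harmonic on $\Omega\setminus\{x_0\}$, satisfies $H|_{\partial\Omega}=\varphi$, and satisfies $\lim_{x\to x_0}\frac{H(x)-H(x_0)}{h(x)-h(x_0)}=\Theta$.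
   Context: A cone subequation is a closed $F\subset\mathrm{Sym}^2(\mathbb{R}^n)$ with $A\in F,P\ge0\Rightarrow A+P\in F$ and $tF=F$ for $t>0$; $\tilde F=\{A:-A\notin\mathrm{Int}F\}$; $P_e$ is orthogonal projection onto $\mathbb{R}e$. An upper semicontinuous $u:X\to[-\infty,\infty)$ is $F$-subharmonic if every $C^2$ test function $\phi$ at any $x_1$ ($u\le\phi$ near $x_1$, equality at $x_1$) has $D^2\phi(x_1)\in F$; $u$ is $F$-harmonic if finite, continuous, $F$-subharmonic and $-u$ is $\tilde F$-subharmonic. Smooth boundary strictly $F$-convex: for each $x\in\partial\Omega$ and local defining function $\rho$ ($\Omega=\{\rho<0\}$, $\nabla\rho\ne0$), $D^2\rho(x)+tP_\nu\in\mathrm{Int}F$ for all large $t$, $\nu$ the unit normal. *)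

theory Defs
  imports "HOL-Analysis.Analysis"
begin

definition sym_mats :: "(real^'n^'n) set" where
  "sym_mats = {A. transpose A = A}"

definition psd :: "real^'n^'n \<Rightarrow> bool" where
  "psd P \<longleftrightarrow> transpose P = P \<and> (\<forall>x. 0 \<le> x \<bullet> (P *v x))"

definition proj_mat :: "real^'n \<Rightarrow> real^'n^'n" where
  "proj_mat e = (\<chi> i j. e$i * e$j)"

definition sym_interior :: "(real^'n^'n) set \<Rightarrow> (real^'n^'n) set" where
  "sym_interior F = {A \<in> F. \<exists>\<epsilon>>0. \<forall>B\<in>sym_mats. dist B A < \<epsilon> \<longrightarrow> B \<in> F}"

definition dual_subeq :: "(real^'n^'n) set \<Rightarrow> (real^'n^'n) set" where
  "dual_subeq F = {A \<in> sym_mats. - A \<notin> sym_interior F}"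

definition cone_subequation :: "(real^'n^'n) set \<Rightarrow> bool" where
  "cone_subequation F \<longleftrightarrow> closed F \<and> F \<subseteq> sym_mats
     \<and> (\<forall>A\<in>F. \<forall>P. psd P \<longrightarrow> A + P \<in> F)
     \<and> (\<forall>t>0. (\<lambda>A. t *\<^sub>R A) ` F = F)"

definition C2_hess :: "(real^'n \<Rightarrow> real) \<Rightarrow> real^'n \<Rightarrow> real^'n^'n \<Rightarrow> bool" where
  "C2_hess \<phi> x A \<longleftrightarrow> (\<exists>U g Hs. open U \<and> x \<in> U
     \<and> (\<forall>y\<in>U. (\<phi> has_derivative (\<lambda>v. g y \<bullet> v)) (at y)
               \<and> (g has_derivative (\<lambda>v. Hs y *v v)) (at y))
     \<and> continuous_on U Hs \<and> Hs x = A)"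

definition F_subharmonic :: "(real^'n^'n) set \<Rightarrow> (real^'n) set \<Rightarrow> (real^'n \<Rightarrow> ereal) \<Rightarrow> bool" where
  "F_subharmonic F X u \<longleftrightarrow>
     (\<forall>x\<in>X. u x \<noteq> \<infinity>)
   \<and> (\<forall>x\<in>X. \<forall>c. u x < c \<longrightarrow> (\<forall>\<^sub>F y in at x within X. u y < c))
   \<and> (\<forall>x\<in>X. \<forall>\<phi> A. C2_hess \<phi> x A \<and> (\<forall>\<^sub>F y in nhds x. u y \<le> ereal (\<phi> y))
          \<and> u x = ereal (\<phi> x) \<longrightarrow> A \<in> F)"

definition F_harmonic :: "(real^'n^'n) set \<Rightarrow> (real^'n) set \<Rightarrow> (real^'n \<Rightarrow> real) \<Rightarrow> bool" where
  "F_harmonic F X u \<longleftrightarrow> continuous_on X u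
     \<and> F_subharmonic F X (\<lambda>x. ereal (u x))
     \<and> F_subharmonic (dual_subeq F) X (\<lambda>x. ereal (- u x))"

fun Ck_on :: "nat \<Rightarrow> 'a::real_normed_vector set \<Rightarrow> ('a \<Rightarrow> real) \<Rightarrow> bool" where
  "Ck_on 0 U f = continuous_on U f"
| "Ck_on (Suc k) U f = (\<exists>f'. (\<forall>y\<in>U. (f has_derivative f' y) (at y))
                              \<and> (\<forall>v. Ck_on k U (\<lambda>y. f' y v)))"

definition smooth_on :: "'a::real_normed_vector set \<Rightarrow> ('a \<Rightarrow> real) \<Rightarrow> bool" where
  "smooth_on U f \<longleftrightarrow> (\<forall>k. Ck_on k U f)"

definition local_defining_fn ::
  "(real^'n) set \<Rightarrow> real^'n \<Rightarrow> (real^'n) set \<Rightarrow> (real^'n \<Rightarrow> real)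
    \<Rightarrow> (real^'n \<Rightarrow> real^'n) \<Rightarrow> (real^'n \<Rightarrow> real^'n^'n) \<Rightarrow> bool" where
  "local_defining_fn \<Omega> x U \<rho> g Hs \<longleftrightarrow> open U \<and> x \<in> U \<and> smooth_on U \<rho>
     \<and> (\<forall>y\<in>U. (\<rho> has_derivative (\<lambda>v. g y \<bullet> v)) (at y)
               \<and> (g has_derivative (\<lambda>v. Hs y *v v)) (at y) \<and> g y \<noteq> 0)
     \<and> \<Omega> \<inter> U = {y\<in>U. \<rho> y < 0}"

definition smooth_boundary :: "(real^'n) set \<Rightarrow> bool" where
  "smooth_boundary \<Omega> \<longleftrightarrow>
     (\<forall>x\<in>frontier \<Omega>. \<exists>U \<rho> g Hs. local_defining_fn \<Omega> x U \<rho> g Hs)"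

definition strictly_F_convex_boundary :: "(real^'n^'n) set \<Rightarrow> (real^'n) set \<Rightarrow> bool" where
  "strictly_F_convex_boundary F \<Omega> \<longleftrightarrow>
     (\<forall>x\<in>frontier \<Omega>. \<forall>U \<rho> g Hs. local_defining_fn \<Omega> x U \<rho> g Hs \<longrightarrow>
        (\<exists>t0. \<forall>t\<ge>t0. Hs x + t *\<^sub>R proj_mat (g x /\<^sub>R norm (g x)) \<in> sym_interior F))"

end

theory Submission
  imports Defs "HOL-Library.Function_Algebras"
begin

text \<open>
  Since \<open>F\<close> is a closed convex cone with \<open>- I \<notin> F\<close>, it is an intersection of half-spaces
  \<open>{A. 0 \<le> B \<bullet> A}\<close> with \<open>B\<close> nonnegative on positive semidefinite matrices and of positive trace,
  so an \<open>F\<close>-subharmonic function is a subsolution of each linear operator \<open>B \<bullet> D\<^sup>2\<close>. For these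
  operators the Dirichlet problem on a ball with polynomial data has a polynomial solution, and
  comparison with such solutions shows that sums of continuous subsolutions are subsolutions. Riemann
  sums then show that mollification preserves \<open>F\<close>-subharmonicity; the smooth approximants serve
  as test functions for dual subsolutions, which gives the comparison principle. Perron's method with
  continuous competitors, Walsh's translation argument and barriers from strict boundary convexity
  solve the Dirichlet problem on \<open>\<Omega>\<close>, giving \<open>H0\<close>, and on \<open>\<Omega> - {x0}\<close> with the additional
  value \<open>c \<le> H0 x0\<close> at \<open>x0\<close>, giving \<open>H\<^sub>c\<close>. The density of \<open>H\<^sub>c\<close> at \<open>x0\<close> is a concave function
  of \<open>c\<close> by comparison, hence continuous for \<open>c < H0 x0\<close>; it is at least a multiple of \<open>H0 x0 - c\<close>
  and tends to \<open>0\<close> as \<open>c\<close> increases to \<open>H0 x0\<close>, so every \<open>\<Theta> > 0\<close> is attained. Uniqueness follows by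
  comparing \<open>H + \<epsilon> (h - h x0)\<close> with \<open>H'\<close>.
\<close>

section \<open>Twice continuously differentiable functions\<close>

text \<open>The obstacle is that a test function for a sum of viscosity subsolutions gives none for
  the summands, so neither sums nor averages are visibly subsolutions. For one half-space the
  operator is linear with constant coefficients, possibly degenerate, and its Dirichlet problem with
  polynomial data is linear algebra in a finite-dimensional space, where the maximum principle
  supplies injectivity. Convexity of \<open>F\<close> enters twice more through sums. A competitor
  for \<phi> plus a competitor for -\<phi> obeys the maximum principle, which turns lower barriers
  into upper ones. A convex combination of the solutions with values \<open>c\<close> and
  \<open>d\<close> at \<open>x0\<close> lies below the solution with the combined value, which makes
  the density concave. Concavity gives continuity only below the endpoint \<open>H0 x0\<close>,
  where a concave function may jump; excluding that jump takes a separate estimate. The point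
  \<open>x0\<close> is treated as an additional isolated boundary point of \<Omega>. Multiples of
  \<open>h - h x0\<close> are the barriers there: subsolutions on all of \<Omega>, and solutions off
  \<open>x0\<close>.\<close>

definition C2on :: "(real^'n) set \<Rightarrow> (real^'n \<Rightarrow> real) \<Rightarrow> (real^'n \<Rightarrow> real^'n)
    \<Rightarrow> (real^'n \<Rightarrow> real^'n^'n) \<Rightarrow> bool" where
  "C2on U f g Hs \<longleftrightarrow> open U
     \<and> (\<forall>y\<in>U. (f has_derivative (\<lambda>v. g y \<bullet> v)) (at y)
             \<and> (g has_derivative (\<lambda>v. Hs y *v v)) (at y))
     \<and> continuous_on U Hs"

lemma C2_hess_iff: "C2_hess f x A \<longleftrightarrow> (\<exists>U g Hs. C2on U f g Hs \<and> x \<in> U \<and> Hs x = A)"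
  unfolding C2_hess_def C2on_def by blast

lemma C2on_subset: "C2on U f g Hs \<Longrightarrow> open V \<Longrightarrow> V \<subseteq> U \<Longrightarrow> C2on V f g Hs"
  unfolding C2on_def by (auto intro: continuous_on_subset)

lemma C2on_open: "C2on U f g Hs \<Longrightarrow> open U"
  and C2on_grad: "C2on U f g Hs \<Longrightarrow> y \<in> U \<Longrightarrow> (f has_derivative (\<lambda>v. g y \<bullet> v)) (at y)"
  and C2on_Hess: "C2on U f g Hs \<Longrightarrow> y \<in> U \<Longrightarrow> (g has_derivative (\<lambda>v. Hs y *v v)) (at y)"
  and C2on_Hess_cont: "C2on U f g Hs \<Longrightarrow> continuous_on U Hs"
  unfolding C2on_def by auto

lemma C2on_cont: "C2on U f g Hs \<Longrightarrow> continuous_on U f"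
  unfolding C2on_def
  by (meson continuous_at_imp_continuous_on has_derivative_continuous)

lemma C2on_Hess_tendsto: "C2on U f g Hs \<Longrightarrow> x \<in> U \<Longrightarrow> (Hs \<longlongrightarrow> Hs x) (nhds x)"
  by (metis C2on_open C2on_Hess_cont continuous_on_eq_continuous_at isCont_def tendsto_at_iff_tendsto_nhds)

lemma C2on_add:
  assumes "C2on U f g Hs" "C2on U f' g' Hs'"
  shows "C2on U (\<lambda>y. f y + f' y) (\<lambda>y. g y + g' y) (\<lambda>y. Hs y + Hs' y)"
  using assms unfolding C2on_def
  by (auto intro!: derivative_eq_intros continuous_intros
      simp: inner_add_left matrix_vector_mult_add_rdistrib fun_eq_iff)

lemma C2on_scale:
  assumes "C2on U f g Hs"
  shows "C2on U (\<lambda>y. c * f y) (\<lambda>y. c *\<^sub>R g y) (\<lambda>y. c *\<^sub>R Hs y)"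
  unfolding C2on_def
proof (intro conjI ballI)
  fix y assume y: "y \<in> U"
  show "((\<lambda>y. c * f y) has_derivative (\<lambda>v. (c *\<^sub>R g y) \<bullet> v)) (at y)"
    using has_derivative_mult_right[OF C2on_grad[OF assms y], of c] by simp
  show "((\<lambda>y. c *\<^sub>R g y) has_derivative (\<lambda>v. (c *\<^sub>R Hs y) *v v)) (at y)"
    using has_derivative_scaleR_right[OF C2on_Hess[OF assms y], of c]
    by (simp add: scaleR_matrix_vector_assoc)
qed (use assms in \<open>auto simp: C2on_def intro!: continuous_intros\<close>)

lemma C2on_const: "open U \<Longrightarrow> C2on U (\<lambda>y. c) (\<lambda>y. 0) (\<lambda>y. 0)"
  unfolding C2on_def
  by (auto intro!: has_derivative_eq_rhs[OF has_derivative_const])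

lemma C2on_add_const: "C2on U f g Hs \<Longrightarrow> C2on U (\<lambda>y. f y + c) g Hs"
  using C2on_add[OF _ C2on_const, of U f g Hs c] C2on_open by fastforce

lemma C2on_quad:
  fixes p :: "real^'n"
  assumes "open U"
  shows "C2on U (\<lambda>y. (norm (y - p))\<^sup>2) (\<lambda>y. 2 *\<^sub>R (y - p)) (\<lambda>y. 2 *\<^sub>R mat 1)"
  unfolding C2on_def power2_norm_eq_inner
proof (intro conjI ballI)
  fix y :: "real^'n"
  show "((\<lambda>y. (y - p) \<bullet> (y - p)) has_derivative (\<lambda>v. (2 *\<^sub>R (y - p)) \<bullet> v)) (at y)"
    by (auto intro!: derivative_eq_intros simp: inner_commute inner_diff fun_eq_iff algebra_simps)
  show "((\<lambda>y. 2 *\<^sub>R (y - p)) has_derivative (\<lambda>v. (2 *\<^sub>R mat 1) *v v)) (at y)"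
    by (auto intro!: derivative_eq_intros simp: scaleR_matrix_vector_assoc[symmetric])
qed (use assms in auto)

lemma C2on_add_quad:
  assumes "C2on U f g Hs"
  shows "C2on U (\<lambda>y. f y + c * (norm (y - p))\<^sup>2) (\<lambda>y. g y + (2 * c) *\<^sub>R (y - p))
          (\<lambda>y. Hs y + (2 * c) *\<^sub>R mat 1)"
  using C2on_add[OF assms C2on_scale[OF C2on_quad[OF C2on_open[OF assms]], of c p]]
  by (simp add: mult.commute)

lemma proj_mat_mult_vec: "proj_mat e *v v = (e \<bullet> v) *\<^sub>R e"
  by (simp add: proj_mat_def matrix_vector_mult_def vec_eq_iff inner_vec_def sum_distrib_left
      algebra_simps)

lemma C2on_translate:
  assumes "C2on U f g Hs"
  shows "C2on {y. y + z \<in> U} (\<lambda>y. f (y + z)) (\<lambda>y. g (y + z)) (\<lambda>y. Hs (y + z))"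
  unfolding C2on_def
proof (intro conjI ballI)
  have *: "{y. y + z \<in> U} = (\<lambda>y. y + z) -` U" by auto
  show "open {y. y + z \<in> U}"
    unfolding * by (intro open_vimage continuous_intros C2on_open[OF assms])
  show "continuous_on {y. y + z \<in> U} (\<lambda>y. Hs (y + z))"
    by (intro continuous_on_compose2[OF C2on_Hess_cont[OF assms]] continuous_intros) auto
  fix y assume "y \<in> {y. y + z \<in> U}"
  then have y: "y + z \<in> U" by simp
  have t: "((\<lambda>y. y + z) has_derivative (\<lambda>v. v)) (at y)"
    by (auto intro!: derivative_eq_intros)
  show "((\<lambda>y. f (y + z)) has_derivative (\<lambda>v. g (y + z) \<bullet> v)) (at y)"
    using has_derivative_compose[OF t C2on_grad[OF assms y]] .
  show "((\<lambda>y. g (y + z)) has_derivative (\<lambda>v. Hs (y + z) *v v)) (at y)"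
    using has_derivative_compose[OF t C2on_Hess[OF assms y]] .
qed

lemma line_derivs:
  fixes a b :: "real^'n"
  assumes C: "C2on U f g Hs" and y: "y + t *\<^sub>R a \<in> U"
  shows "((\<lambda>t. f (y + t *\<^sub>R a)) has_real_derivative g (y + t *\<^sub>R a) \<bullet> a) (at t)"
    and "((\<lambda>t. g (y + t *\<^sub>R a) \<bullet> b) has_real_derivative b \<bullet> (Hs (y + t *\<^sub>R a) *v a)) (at t)"
proof -
  have t: "((\<lambda>t. y + t *\<^sub>R a) has_derivative (\<lambda>s. s *\<^sub>R a)) (at t)"
    by (auto intro!: derivative_eq_intros)
  show "((\<lambda>t. f (y + t *\<^sub>R a)) has_real_derivative g (y + t *\<^sub>R a) \<bullet> a) (at t)"
    using has_derivative_compose[OF t C2on_grad[OF C y]]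
    by (simp add: has_field_derivative_def mult.commute[of _ "g _ \<bullet> a"] fun_eq_iff)
  have "((\<lambda>t. g (y + t *\<^sub>R a)) has_derivative (\<lambda>s. Hs (y + t *\<^sub>R a) *v (s *\<^sub>R a))) (at t)"
    using has_derivative_compose[OF t C2on_Hess[OF C y]] .
  then have "((\<lambda>t. g (y + t *\<^sub>R a) \<bullet> b) has_derivative (\<lambda>s. (Hs (y + t *\<^sub>R a) *v (s *\<^sub>R a)) \<bullet> b)) (at t)"
    by (auto intro!: derivative_eq_intros)
  then show "((\<lambda>t. g (y + t *\<^sub>R a) \<bullet> b) has_real_derivative b \<bullet> (Hs (y + t *\<^sub>R a) *v a)) (at t)"
    by (simp add: has_field_derivative_def matrix_vector_mult_scaleR inner_commute
        mult.commute[of _ "b \<bullet> _"])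
qed

text \<open>The mixed second difference is the increment along \<open>a\<close> of an increment
  along \<open>b\<close>. The mean value theorem, applied once in each direction, turns it into a
  value of the Hessian form.\<close>

lemma second_difference:
  fixes a b :: "real^'n"
  assumes C: "C2on U f g Hs" and U: "ball x r \<subseteq> U" and s: "0 < s" "s * (norm a + norm b) < r"
  shows "\<exists>\<xi>\<in>ball x r. f (x + s *\<^sub>R a + s *\<^sub>R b) - f (x + s *\<^sub>R a) - f (x + s *\<^sub>R b) + f x
           = s\<^sup>2 * (a \<bullet> (Hs \<xi> *v b)) \<and> dist \<xi> x \<le> s * (norm a + norm b)"
proof -
  have inb: "x + t *\<^sub>R a + t' *\<^sub>R b \<in> ball x r \<and> dist (x + t *\<^sub>R a + t' *\<^sub>R b) x \<le> s * (norm a + norm b)"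
    if "0 \<le> t" "t \<le> s" "0 \<le> t'" "t' \<le> s" for t t'
  proof -
    have "norm (t *\<^sub>R a + t' *\<^sub>R b) \<le> t * norm a + t' * norm b"
      using norm_triangle_ineq[of "t *\<^sub>R a" "t' *\<^sub>R b"] that by simp
    also have "\<dots> \<le> s * norm a + s * norm b"
      by (intro add_mono mult_right_mono that) auto
    finally have "norm ((x + t *\<^sub>R a + t' *\<^sub>R b) - x) \<le> s * (norm a + norm b)"
      by (simp add: algebra_simps)
    then have "dist (x + t *\<^sub>R a + t' *\<^sub>R b) x \<le> s * (norm a + norm b)"
      by (simp only: dist_norm)
    then show ?thesis using s(2) le_less_trans[of _ "s * (norm a + norm b)" r]
      unfolding mem_ball dist_commute[of x] by blast
  qed
  define q where "q t = f ((x + s *\<^sub>R b) + t *\<^sub>R a) - f (x + t *\<^sub>R a)" for t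
  have inU: "(x + s *\<^sub>R b) + t *\<^sub>R a \<in> U" "x + t *\<^sub>R a \<in> U" if "0 \<le> t" "t \<le> s" for t
    using inb[of t s] inb[of t 0] that s U by (auto simp: add_ac)
  have dq: "(q has_real_derivative (g ((x + s *\<^sub>R b) + t *\<^sub>R a) \<bullet> a - g (x + t *\<^sub>R a) \<bullet> a)) (at t)"
    if "0 \<le> t" "t \<le> s" for t
    unfolding q_def[abs_def]
    by (intro DERIV_diff line_derivs[OF C] inU that)
  obtain t where t: "0 < t" "t < s" and q: "q s - q 0 = (s - 0) * (g ((x + s *\<^sub>R b) + t *\<^sub>R a) \<bullet> a - g (x + t *\<^sub>R a) \<bullet> a)"
    using MVT2[OF s(1), of q, OF dq] by auto
  have "((\<lambda>t'. g ((x + t *\<^sub>R a) + t' *\<^sub>R b) \<bullet> a) has_real_derivative a \<bullet> (Hs ((x + t *\<^sub>R a) + t' *\<^sub>R b) *v b)) (at t')"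
    if "0 \<le> t'" "t' \<le> s" for t'
    using inb[of t t'] t that U by (intro line_derivs[OF C]) auto
  from MVT2[OF s(1), of "\<lambda>t'. g ((x + t *\<^sub>R a) + t' *\<^sub>R b) \<bullet> a", OF this]
  obtain t' where t': "0 < t'" "t' < s"
    and g: "g ((x + t *\<^sub>R a) + s *\<^sub>R b) \<bullet> a - g (x + t *\<^sub>R a) \<bullet> a
         = s * (a \<bullet> (Hs ((x + t *\<^sub>R a) + t' *\<^sub>R b) *v b))"
    by auto
  show ?thesis
  proof (intro bexI conjI)
    show "f (x + s *\<^sub>R a + s *\<^sub>R b) - f (x + s *\<^sub>R a) - f (x + s *\<^sub>R b) + f x
        = s\<^sup>2 * (a \<bullet> (Hs ((x + t *\<^sub>R a) + t' *\<^sub>R b) *v b))"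
      using q g unfolding q_def by (simp add: add_ac power2_eq_square)
  qed (use inb[of t t'] t t' in auto)
qed

text \<open>Schwarz's theorem: the second difference does not change when \<open>a\<close> and
  \<open>b\<close> are exchanged, so the forms at \<open>(a, b)\<close> and \<open>(b, a)\<close>
  take equal values at two points near \<open>x\<close>, and continuity does the rest. Symmetry is
  part of \<open>psd\<close> but not of \<open>C2_hess\<close>.\<close>

lemma Hess_symmetric:
  fixes f :: "real^'n \<Rightarrow> real"
  assumes C: "C2on U f g Hs" and x: "x \<in> U"
  shows "transpose (Hs x) = Hs x"
proof -
  have sym: "a \<bullet> (Hs x *v b) = b \<bullet> (Hs x *v a)" for a b :: "real^'n"
  proof (rule ccontr)
    define h where "h = (\<lambda>y. a \<bullet> (Hs y *v b) - b \<bullet> (Hs x *v a))"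
    assume "a \<bullet> (Hs x *v b) \<noteq> b \<bullet> (Hs x *v a)"
    then have e: "\<bar>a \<bullet> (Hs x *v b) - b \<bullet> (Hs x *v a)\<bar> / 2 > 0" (is "?e > 0") by simp
    have cont: "isCont (\<lambda>y. c \<bullet> (Hs y *v d)) x" for c d :: "real^'n"
    proof -
      have "continuous_on U (\<lambda>y. c \<bullet> (Hs y *v d))"
        unfolding matrix_vector_mult_def inner_vec_def
        by (intro continuous_intros continuous_on_vec_lambda C2on_Hess_cont[OF C])
      then show ?thesis using C2on_open[OF C] x by (simp add: continuous_on_eq_continuous_at)
    qed
    obtain d1 where d1: "d1 > 0" "\<And>y. dist y x < d1 \<Longrightarrow> \<bar>a \<bullet> (Hs y *v b) - a \<bullet> (Hs x *v b)\<bar> < ?e"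
      using cont[of a b] e unfolding continuous_at_eps_delta dist_real_def by meson
    obtain d2 where d2: "d2 > 0" "\<And>y. dist y x < d2 \<Longrightarrow> \<bar>b \<bullet> (Hs y *v a) - b \<bullet> (Hs x *v a)\<bar> < ?e"
      using cont[of b a] e unfolding continuous_at_eps_delta dist_real_def by meson
    obtain d3 where d3: "d3 > 0" "ball x d3 \<subseteq> U"
      using C2on_open[OF C] x openE by blast
    define d where "d = min d1 (min d2 d3)"
    define s where "s = d / (2 * (norm a + norm b + 1))"
    have d: "d > 0" using d1 d2 d3 by (simp add: d_def)
    have N: "norm a + norm b + 1 > 0" by (simp add: add_nonneg_pos)
    have s: "s > 0" unfolding s_def using d N by simp
    have sd: "s * (norm a + norm b) < d"
    proof -
      have "s * (norm a + norm b) \<le> s * (norm a + norm b + 1)" using s by simp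
      also have "\<dots> = d / 2"
        unfolding s_def using N by (simp only: times_divide_eq_left mult_divide_mult_cancel_right)
      finally show ?thesis using d by simp
    qed
    have U: "ball x d \<subseteq> U" using d3 by (auto simp: d_def)
    obtain \<xi> where xi: "\<xi> \<in> ball x d"
      "f (x + s *\<^sub>R a + s *\<^sub>R b) - f (x + s *\<^sub>R a) - f (x + s *\<^sub>R b) + f x = s\<^sup>2 * (a \<bullet> (Hs \<xi> *v b))"
      using second_difference[OF C U s sd] by blast
    obtain \<zeta> where zeta: "\<zeta> \<in> ball x d"
      "f (x + s *\<^sub>R b + s *\<^sub>R a) - f (x + s *\<^sub>R b) - f (x + s *\<^sub>R a) + f x = s\<^sup>2 * (b \<bullet> (Hs \<zeta> *v a))"
      using second_difference[OF C U s, of b a] sd by (auto simp: add.commute)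
    have "s\<^sup>2 * (a \<bullet> (Hs \<xi> *v b)) = s\<^sup>2 * (b \<bullet> (Hs \<zeta> *v a))"
      using xi(2) zeta(2) by (simp add: algebra_simps)
    then have "a \<bullet> (Hs \<xi> *v b) = b \<bullet> (Hs \<zeta> *v a)" using s by simp
    moreover have "\<bar>a \<bullet> (Hs \<xi> *v b) - a \<bullet> (Hs x *v b)\<bar> < ?e"
      using xi(1) by (intro d1) (auto simp: d_def dist_commute)
    moreover have "\<bar>b \<bullet> (Hs \<zeta> *v a) - b \<bullet> (Hs x *v a)\<bar> < ?e"
      using zeta(1) by (intro d2) (auto simp: d_def dist_commute)
    ultimately show False by (auto simp: abs_if split: if_splits)
  qed
  have "Hs x $ i $ j = Hs x $ j $ i" for i j
  proof -
    have *: "axis i 1 \<bullet> (Hs x *v axis j 1) = Hs x $ i $ j" for i j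
      by (simp add: inner_axis' matrix_vector_mul_component inner_axis)
    show ?thesis using sym[of "axis i 1" "axis j 1"] by (simp add: *)
  qed
  then show ?thesis by (simp add: transpose_def vec_eq_iff)
qed

text \<open>If the form were negative at \<open>v\<close>, the derivative along \<open>v\<close>,
  zero at the minimum, would be negative just after it, and \<open>f\<close> would drop below
  \<open>f x\<close>.\<close>

lemma second_derivative_test:
  fixes f :: "real^'n \<Rightarrow> real"
  assumes C: "C2on U f g Hs" and x: "x \<in> U" and min: "\<forall>\<^sub>F y in nhds x. f x \<le> f y"
  shows "0 \<le> v \<bullet> (Hs x *v v)"
proof (rule ccontr)
  assume neg: "\<not> ?thesis"
  obtain d where d: "d > 0" "ball x d \<subseteq> U" "\<And>y. y \<in> ball x d \<Longrightarrow> f x \<le> f y"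
  proof -
    obtain d1 where "d1 > 0" "\<And>y. dist y x < d1 \<Longrightarrow> f x \<le> f y"
      using min unfolding eventually_nhds_metric by blast
    moreover obtain d2 where "d2 > 0" "ball x d2 \<subseteq> U"
      using C2on_open[OF C] x openE by blast
    ultimately show ?thesis
      by (intro that[of "min d1 d2"]) (auto simp: dist_commute)
  qed
  have v: "v \<noteq> 0" using neg by auto
  define e where "e = d / norm v"
  have e: "e > 0" using d v by (simp add: e_def)
  have inb: "x + t *\<^sub>R v \<in> ball x d" if "\<bar>t\<bar> < e" for t
    using that v by (simp add: e_def dist_norm field_simps)
  have "((\<lambda>t. f (x + t *\<^sub>R v)) has_real_derivative g (x + 0 *\<^sub>R v) \<bullet> v) (at 0)"
    using x by (intro line_derivs[OF C]) auto
  then have g0: "g x \<bullet> v = 0"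
    using DERIV_local_min[of "\<lambda>t. f (x + t *\<^sub>R v)" "g x \<bullet> v" 0 e] e d(3) inb by auto
  have "((\<lambda>t. g (x + t *\<^sub>R v) \<bullet> v) has_real_derivative v \<bullet> (Hs (x + 0 *\<^sub>R v) *v v)) (at 0)"
    using x by (intro line_derivs[OF C]) auto
  then have "((\<lambda>t. g (x + t *\<^sub>R v) \<bullet> v) has_real_derivative v \<bullet> (Hs x *v v)) (at 0)" by simp
  from DERIV_neg_dec_right[OF this]
  obtain e' where e': "e' > 0" "\<And>t. 0 < t \<Longrightarrow> t < e' \<Longrightarrow> g (x + t *\<^sub>R v) \<bullet> v < 0"
    using neg g0 by (auto simp: not_le)
  define s where "s = min e e' / 2"
  have s: "s > 0" "s < e" "s < e'" using e e' by (auto simp: s_def min_def)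
  have "((\<lambda>t. f (x + t *\<^sub>R v)) has_real_derivative g (x + t *\<^sub>R v) \<bullet> v) (at t)" if "0 \<le> t" "t \<le> s" for t
    using that s inb[of t] d(2) by (intro line_derivs[OF C]) auto
  from MVT2[OF s(1), of "\<lambda>t. f (x + t *\<^sub>R v)", OF this]
  obtain t where "0 < t" "t < s" "f (x + s *\<^sub>R v) - f x = s * (g (x + t *\<^sub>R v) \<bullet> v)"
    by auto
  then have "f (x + s *\<^sub>R v) < f x"
    using e'(2)[of t] s mult_pos_neg[of s "g (x + t *\<^sub>R v) \<bullet> v"] by auto
  then show False using d(3)[OF inb[of s]] s by auto
qed

lemma C2on_min_psd:
  assumes "C2on U f g Hs" "x \<in> U" "\<forall>\<^sub>F y in nhds x. f x \<le> f y"
  shows "psd (Hs x)"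
  using Hess_symmetric[OF assms(1,2)] second_derivative_test[OF assms] by (auto simp: psd_def)

section \<open>Real-valued viscosity subsolutions\<close>

text \<open>Only the test-function clause, at one point. The functions below are continuous, so the
  semicontinuity clause of \<open>F_subharmonic\<close> is automatic, and a pointwise notion is
  convenient for gluing.\<close>

definition vsub_at :: "(real^'n^'n) set \<Rightarrow> (real^'n \<Rightarrow> real) \<Rightarrow> real^'n \<Rightarrow> bool" where
  "vsub_at F u x \<longleftrightarrow>
     (\<forall>\<psi> A. C2_hess \<psi> x A \<and> (\<forall>\<^sub>F y in nhds x. u y \<le> \<psi> y) \<and> u x = \<psi> x \<longrightarrow> A \<in> F)"

lemma vsub_atD:
  assumes "vsub_at F u x" "C2on U \<psi> g Hs" "x \<in> U" "\<forall>\<^sub>F y in nhds x. u y \<le> \<psi> y" "u x = \<psi> x"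
  shows "Hs x \<in> F"
  using assms unfolding vsub_at_def C2_hess_iff by blast

lemma vsub_atI:
  assumes "\<And>U \<psi> g Hs. C2on U \<psi> g Hs \<Longrightarrow> x \<in> U \<Longrightarrow> \<forall>\<^sub>F y in nhds x. u y \<le> \<psi> y \<Longrightarrow> u x = \<psi> x \<Longrightarrow> Hs x \<in> F"
  shows "vsub_at F u x"
  using assms unfolding vsub_at_def C2_hess_iff by blast

text \<open>A test function touching the larger function from above also touches the smaller one.
  Maxima and glued functions are handled by this.\<close>

lemma vsub_at_mono:
  assumes "vsub_at F v x" "v x = u x" "\<forall>\<^sub>F y in nhds x. v y \<le> u y"
  shows "vsub_at F u x"
  unfolding vsub_at_def
proof (intro allI impI)
  fix \<psi> A assume *: "C2_hess \<psi> x A \<and> (\<forall>\<^sub>F y in nhds x. u y \<le> \<psi> y) \<and> u x = \<psi> x"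
  then have "\<forall>\<^sub>F y in nhds x. v y \<le> \<psi> y"
    using assms(3) by (auto elim: eventually_elim2)
  then show "A \<in> F" using assms(1,2) * unfolding vsub_at_def by auto
qed

lemma vsub_at_cong:
  assumes "\<forall>\<^sub>F y in nhds x. u y = v y"
  shows "vsub_at F u x \<longleftrightarrow> vsub_at F v x"
proof -
  have "u x = v x" using eventually_nhds_x_imp_x[OF assms] .
  then show ?thesis
    using assms by (metis (mono_tags, lifting) eventually_mono order_refl vsub_at_mono)
qed

lemma F_subharmonic_iff_vsub:
  assumes "continuous_on X u"
  shows "F_subharmonic F X (\<lambda>x. ereal (u x)) \<longleftrightarrow> (\<forall>x\<in>X. vsub_at F u x)"
proof -
  have "\<forall>\<^sub>F y in at x within X. ereal (u y) < c" if "x \<in> X" "ereal (u x) < c" for x c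
  proof -
    have "((\<lambda>y. ereal (u y)) \<longlongrightarrow> ereal (u x)) (at x within X)"
      using assms that by (auto simp: continuous_on_def intro: tendsto_intros)
    then show ?thesis using that order_tendstoD(2) by blast
  qed
  then show ?thesis unfolding F_subharmonic_def vsub_at_def by auto
qed

lemma vsub_at_translate:
  assumes "vsub_at F u (x + z)"
  shows "vsub_at F (\<lambda>y. u (y + z)) x"
proof (rule vsub_atI)
  fix U \<psi> g Hs
  assume C: "C2on U \<psi> g Hs" "x \<in> U" "\<forall>\<^sub>F y in nhds x. u (y + z) \<le> \<psi> y" "u (x + z) = \<psi> x"
  have "C2on {y. y + - z \<in> U} (\<lambda>y. \<psi> (y + - z)) (\<lambda>y. g (y + - z)) (\<lambda>y. Hs (y + - z))"
    by (rule C2on_translate[OF C(1)])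
  moreover have "\<forall>\<^sub>F y in nhds (x + z). u y \<le> \<psi> (y + - z)"
  proof -
    have "filterlim (\<lambda>y. y + - z) (nhds (x + z + - z)) (nhds (x + z))"
      by (intro tendsto_add filterlim_ident tendsto_const)
    then have "filterlim (\<lambda>y. y + - z) (nhds x) (nhds (x + z))" by simp
    from eventually_compose_filterlim[OF C(3) this] show ?thesis by simp
  qed
  ultimately show "Hs x \<in> F"
    using vsub_atD[OF assms, of "{y. y + - z \<in> U}" "\<lambda>y. \<psi> (y + - z)"
        "\<lambda>y. g (y + - z)" "\<lambda>y. Hs (y + - z)"] C by simp
qed

lemma vsub_at_add_const:
  assumes "vsub_at F u x"
  shows "vsub_at F (\<lambda>y. u y + c) x"
proof (rule vsub_atI)
  fix U \<psi> g Hs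
  assume C: "C2on U \<psi> g Hs" "x \<in> U" "\<forall>\<^sub>F y in nhds x. u y + c \<le> \<psi> y" "u x + c = \<psi> x"
  have "\<forall>\<^sub>F y in nhds x. u y \<le> \<psi> y + - c"
    using C(3) by eventually_elim simp
  then show "Hs x \<in> F"
    using vsub_atD[OF assms C2on_add_const[OF C(1), of "-c"] C(2)] C by simp
qed

lemma vsub_at_scale:
  assumes "vsub_at F u x" "c > 0" "\<And>A. A \<in> F \<Longrightarrow> c *\<^sub>R A \<in> F"
  shows "vsub_at F (\<lambda>y. c * u y) x"
proof (rule vsub_atI)
  fix U \<psi> g Hs
  assume C: "C2on U \<psi> g Hs" "x \<in> U" "\<forall>\<^sub>F y in nhds x. c * u y \<le> \<psi> y" "c * u x = \<psi> x"
  have "\<forall>\<^sub>F y in nhds x. u y \<le> (1/c) * \<psi> y"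
    using C(3) by eventually_elim (use assms(2) in \<open>simp add: field_simps\<close>)
  then have "(1/c) *\<^sub>R Hs x \<in> F"
    using vsub_atD[OF assms(1) C2on_scale[OF C(1), of "1/c"] C(2)] C(4)[symmetric] assms(2) by simp
  then show "Hs x \<in> F" using assms(3)[of "(1/c) *\<^sub>R Hs x"] assms(2) by simp
qed

text \<open>At a contact point \<open>\<psi> - f\<close> has a local minimum, so the difference of
  the Hessians is positive semidefinite. The set \<open>G\<close> is general because half-spaces
  occur besides \<open>F\<close>.\<close>

lemma C2on_vsub_at:
  assumes C: "C2on U f g Hs" "x \<in> U" and G: "Hs x \<in> G" "\<And>A P. A \<in> G \<Longrightarrow> psd P \<Longrightarrow> A + P \<in> G"
  shows "vsub_at G f x"
proof (rule vsub_atI)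
  fix V \<psi> g' Hs'
  assume V: "C2on V \<psi> g' Hs'" "x \<in> V" "\<forall>\<^sub>F y in nhds x. f y \<le> \<psi> y" "f x = \<psi> x"
  have o: "open (U \<inter> V)" using C2on_open V(1) C(1) by blast
  have "C2on (U \<inter> V) (\<lambda>y. \<psi> y + (-1) * f y) (\<lambda>y. g' y + (-1) *\<^sub>R g y) (\<lambda>y. Hs' y + (-1) *\<^sub>R Hs y)"
    by (intro C2on_add C2on_scale C2on_subset[OF V(1) o] C2on_subset[OF C(1) o]) auto
  then have "psd (Hs' x + (-1) *\<^sub>R Hs x)"
    by (rule C2on_min_psd) (use C V in \<open>auto elim: eventually_mono\<close>)
  from G(2)[OF G(1) this] show "Hs' x \<in> G" by simp
qed

lemma vsub_at_max:
  assumes "vsub_at F u x" "vsub_at F v x"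
  shows "vsub_at F (\<lambda>y. max (u y) (v y)) x"
proof (cases "u x \<ge> v x")
  case True
  then show ?thesis by (intro vsub_at_mono[OF assms(1)]) auto
next
  case False
  then show ?thesis by (intro vsub_at_mono[OF assms(2)]) auto
qed

lemma touching_at_max:
  assumes u: "\<And>y. y \<in> S \<Longrightarrow> u y - \<psi> y \<le> u z - \<psi> z" and S: "open S" "z \<in> S"
    and C: "C2on U \<psi> g Hs" "z \<in> U" and v: "vsub_at G u z"
  shows "Hs z \<in> G"
proof -
  have "\<forall>\<^sub>F y in nhds z. y \<in> S" using S by (simp add: eventually_nhds_in_open)
  then have "\<forall>\<^sub>F y in nhds z. u y \<le> \<psi> y + (u z - \<psi> z)"
    by eventually_elim (use u in fastforce)
  then show ?thesis by (intro vsub_atD[OF v C2on_add_const[OF C(1)] C(2)]) auto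
qed

text \<open>If \<open>u\<close> exceeded \<open>w\<close>, subtracting a small quadratic from
  \<open>w\<close> would leave the maximum of the difference inside \<open>D\<close>; there the
  perturbed function touches \<open>u\<close> with a Hessian that \<open>strict\<close> excludes.
  The set \<open>G\<close> will be a half-space, \<open>F\<close>, or the dual of
  \<open>F\<close>.\<close>

lemma C2_comparison:
  fixes u w :: "real^'n \<Rightarrow> real"
  assumes D: "open D" "bounded D"
    and u: "continuous_on (closure D) u" "\<And>x. x \<in> D \<Longrightarrow> vsub_at G u x"
    and w: "continuous_on (closure D) w" "C2on D w g Hs"
    and strict: "\<And>x \<epsilon>. x \<in> D \<Longrightarrow> \<epsilon> > 0 \<Longrightarrow> Hs x - \<epsilon> *\<^sub>R mat 1 \<notin> G"
    and bd: "\<And>x. x \<in> frontier D \<Longrightarrow> u x \<le> w x"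
    and x: "x \<in> closure D"
  shows "u x \<le> w x"
proof (rule ccontr)
  assume "\<not> ?thesis"
  then have pos: "u x - w x > 0" by simp
  have K: "compact (closure D)" using D(2) by (simp add: compact_closure)
  obtain R where R: "R > 0" "\<And>y. y \<in> closure D \<Longrightarrow> norm y \<le> R"
    using compact_imp_bounded[OF K] by (auto simp: bounded_pos)
  \<comment> \<open>On the closure the quadratic is at most half of the excess at \<open>x\<close>,
    too little to move the maximum to the frontier.\<close>
  define \<epsilon> where "\<epsilon> = (u x - w x) / (2 * R\<^sup>2)"
  have e: "\<epsilon> > 0" "\<epsilon> * R\<^sup>2 < u x - w x" using pos R(1) by (auto simp: \<epsilon>_def)
  define \<psi> where "\<psi> = (\<lambda>y. w y + (-\<epsilon>) * (norm (y - 0))\<^sup>2)"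
  have cont: "continuous_on (closure D) (\<lambda>y. u y - \<psi> y)"
    unfolding \<psi>_def by (intro continuous_intros u w)
  then obtain z where z: "z \<in> closure D" "\<And>y. y \<in> closure D \<Longrightarrow> u y - \<psi> y \<le> u z - \<psi> z"
    using continuous_attains_sup[OF K _ cont] x by (metis emptyE)
  have "u z - \<psi> z \<ge> u x - w x"
  proof -
    have "u x - w x \<le> u x - \<psi> x" using e(1) by (simp add: \<psi>_def)
    then show ?thesis using z(2)[OF x] by simp
  qed
  moreover have "u z - \<psi> z \<le> u z - w z + \<epsilon> * R\<^sup>2"
  proof -
    have "(norm z)\<^sup>2 \<le> R\<^sup>2" using R(2)[OF z(1)] by (intro power_mono) auto
    then have "\<epsilon> * (norm z)\<^sup>2 \<le> \<epsilon> * R\<^sup>2" using e(1) by simp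
    then show ?thesis by (simp add: \<psi>_def)
  qed
  ultimately have "w z < u z" using e(2) by linarith
  then have "z \<notin> frontier D" using bd[of z] by (meson not_le)
  then have zD: "z \<in> D" using z(1) D(1) by (simp add: frontier_def interior_open)
  have C: "C2on D \<psi> (\<lambda>y. g y + (2 * - \<epsilon>) *\<^sub>R (y - 0)) (\<lambda>y. Hs y + (2 * - \<epsilon>) *\<^sub>R mat 1)"
    unfolding \<psi>_def by (rule C2on_add_quad[OF w(2)])
  have "u y - \<psi> y \<le> u z - \<psi> z" if "y \<in> D" for y
    using z(2)[of y] that closure_subset[of D] by blast
  then have "Hs z + (2 * - \<epsilon>) *\<^sub>R mat 1 \<in> G"
    by (rule touching_at_max[OF _ D(1) zD C zD u(2)[OF zD]])
  then show False using strict[OF zD, of "2 * \<epsilon>"] e(1) by simp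
qed

section \<open>The Dirichlet problem for polynomials on a ball\<close>

definition fscale :: "real \<Rightarrow> ('a \<Rightarrow> real) \<Rightarrow> 'a \<Rightarrow> real" where
  "fscale c f = (\<lambda>x. c * f x)"

interpretation fspace: vector_space fscale
  by standard (auto simp: fscale_def fun_eq_iff algebra_simps)

interpretation fspace_pair: vector_space_pair fscale fscale ..

text \<open>In finite dimension an injective linear endomorphism is surjective: it maps a basis to
  an independent set of the same size.\<close>

lemma inj_endo_span_surj:
  assumes S: "finite S" and T: "\<And>f. f \<in> fspace.span S \<Longrightarrow> T f \<in> fspace.span S"
    and add: "\<And>f g. f \<in> fspace.span S \<Longrightarrow> g \<in> fspace.span S \<Longrightarrow> T (f + g) = T f + T g"
    and scale: "\<And>c f. f \<in> fspace.span S \<Longrightarrow> T (fscale c f) = fscale c (T f)"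
    and inj: "\<And>f. f \<in> fspace.span S \<Longrightarrow> T f = 0 \<Longrightarrow> f = 0"
    and g: "g \<in> fspace.span S"
  shows "\<exists>f\<in>fspace.span S. T f = g"
proof -
  let ?V = "fspace.span S"
  obtain B where B: "B \<subseteq> ?V" "fspace.independent B" "?V \<subseteq> fspace.span B"
    using fspace.maximal_independent_subset by blast
  have sp: "fspace.span B = ?V"
    using B(1,3) fspace.span_minimal[OF B(1) fspace.subspace_span] by blast
  have finB: "finite B"
    using fspace.independent_span_bound[OF S B(2,1)] by simp
  \<comment> \<open>\<open>T\<close> is assumed linear on the span only; its linear extension from a
    basis is linear on the whole function space and agrees with \<open>T\<close> on the
    span.\<close>
  define T' where "T' = fspace_pair.construct B T"
  have lin: "Vector_Spaces.linear fscale fscale T'"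
    unfolding T'_def by (rule fspace_pair.linear_construct[OF B(2)])
  interpret T': Vector_Spaces.linear fscale fscale T' by (rule lin)
  have T0: "T 0 = 0"
    using scale[OF fspace.span_zero, of 0] fspace.scale_zero_left by metis
  have T'T: "f \<in> ?V \<and> T' f = T f" if "f \<in> fspace.span B" for f
    using that
  proof (induction rule: fspace.span_induct_alt)
    case base
    then show ?case using T0 fspace.span_zero[of S] T'.zero by (simp add: zero_fun_def)
  next
    case (step c b f)
    have b: "b \<in> ?V" "T' b = T b"
      using step B(1) by (auto simp: T'_def fspace_pair.construct_basis[OF B(2)])
    have cb: "fscale c b \<in> ?V" using b(1) by (rule fspace.span_scale)
    have "fscale c b + f \<in> ?V" "T' (fscale c b + f) = T (fscale c b + f)"
      using step b cb add[OF cb, of f] scale[OF b(1)] fspace.span_add[OF cb]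
      by (simp_all add: T'.add T'.scale)
    then show ?case by (simp add: plus_fun_def)
  qed
  have "inj_on T' (fspace.span B)"
    using T'.inj_on_iff_eq_0[OF fspace.subspace_span] T'T inj by fastforce
  then have ind: "fspace.independent (T' ` B)" and injB: "inj_on T' B"
    using fspace_pair.linear_independent_injective_image[OF lin B(2)]
      fspace.span_superset inj_on_subset by blast+
  have sub: "T' ` B \<subseteq> fspace.span B"
    using B(1) T'T T sp by auto
  have "g \<in> fspace.span (T' ` B)"
  proof (rule ccontr)
    assume g': "g \<notin> fspace.span (T' ` B)"
    then have "fspace.independent (insert g (T' ` B))"
      using ind by (rule fspace.independent_insertI)
    then have "card (insert g (T' ` B)) \<le> card B"
      using fspace.independent_span_bound[OF finB, of "insert g (T' ` B)"] sub g sp by auto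
    moreover have "g \<notin> T' ` B" using g' fspace.span_base by blast
    ultimately show False using finB injB by (simp add: card_image)
  qed
  then have "g \<in> T' ` fspace.span B" by (simp add: T'.span_image)
  then show ?thesis using T'T sp by auto
qed

section \<open>Polynomials of bounded degree\<close>

primrec monoms :: "nat \<Rightarrow> (real^'n \<Rightarrow> real) set" where
  "monoms 0 = {\<lambda>x. 1}"
| "monoms (Suc d) = monoms d \<union> (\<Union>i. (\<lambda>p x. x$i * p x) ` monoms d)"

declare monoms.simps(2) [simp del]

abbreviation Pol :: "nat \<Rightarrow> (real^'n \<Rightarrow> real) set" where
  "Pol d \<equiv> fspace.span (monoms d)"

lemma finite_monoms: "finite (monoms d :: (real^'n \<Rightarrow> real) set)"
  by (induction d) (auto simp: monoms.simps(2))

lemma monoms_mono: "d \<le> e \<Longrightarrow> monoms d \<subseteq> monoms e"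
  by (rule lift_Suc_mono_le[of monoms]) (auto simp: monoms.simps(2))

lemma Pol_mono: "d \<le> e \<Longrightarrow> Pol d \<subseteq> Pol e"
  by (intro fspace.span_mono monoms_mono)

lemma Pol_add: "f \<in> Pol d \<Longrightarrow> g \<in> Pol d \<Longrightarrow> (\<lambda>x. f x + g x) \<in> Pol d"
  using fspace.span_add[of f "monoms d" g] by (simp add: plus_fun_def)

lemma Pol_scale: "f \<in> Pol d \<Longrightarrow> (\<lambda>x. c * f x) \<in> Pol d"
  using fspace.span_scale[of f "monoms d" c] by (simp add: fscale_def)

lemma Pol_zero: "(\<lambda>x. 0) \<in> Pol d"
  using fspace.span_zero[of "monoms d"] by (simp add: zero_fun_def)

lemma Pol_sum: "finite I \<Longrightarrow> (\<And>i. i \<in> I \<Longrightarrow> f i \<in> Pol d) \<Longrightarrow> (\<lambda>x. \<Sum>i\<in>I. f i x) \<in> Pol d"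
  by (induction I rule: finite_induct) (auto intro: Pol_add Pol_zero)

lemma Pol_const: "(\<lambda>x. c) \<in> Pol d"
  using Pol_scale[of "\<lambda>x. 1" d c] monoms_mono[of 0 d] by (auto intro: fspace.span_base)

lemma Pol_induct [consumes 1, case_names zero step]:
  assumes "f \<in> Pol d" and "Q (\<lambda>x. 0)"
    and "\<And>c p f. p \<in> monoms d \<Longrightarrow> Q f \<Longrightarrow> Q (\<lambda>x. c * p x + f x)"
  shows "Q f"
  using assms(1)
  by (induction rule: fspace.span_induct_alt)
     (use assms(2,3) in \<open>auto simp: zero_fun_def plus_fun_def fscale_def\<close>)

lemma Pol_coord:
  assumes "f \<in> Pol d"
  shows "(\<lambda>x. x$i * f x) \<in> Pol (Suc d)"
  using assms
proof (induction rule: Pol_induct)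
  case zero
  then show ?case using Pol_zero[of "Suc d"] by simp
next
  case (step c p f)
  have "(\<lambda>x. x$i * p x) \<in> Pol (Suc d)"
    using step by (intro fspace.span_base) (auto simp: monoms.simps(2))
  from Pol_add[OF Pol_scale[OF this, of c] step(2)]
  show ?case by (simp add: algebra_simps)
qed

lemma Pol_mult:
  assumes f: "f \<in> Pol d" and g: "g \<in> Pol e"
  shows "(\<lambda>x. f x * g x) \<in> Pol (d + e)"
proof -
  have mon: "(\<lambda>x. f x * p x) \<in> Pol (d + e)" if "p \<in> monoms e" for p
    using that
  proof (induction e arbitrary: p)
    case 0
    then show ?case using f by simp
  next
    case (Suc e)
    show ?case
    proof (cases "p \<in> monoms e")
      case True
      then show ?thesis using Suc.IH[of p] Pol_mono[of "d + e" "d + Suc e"] by auto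
    next
      case False
      then obtain i q where q: "q \<in> monoms e" "p = (\<lambda>x. x$i * q x)" using Suc.prems by (auto simp: monoms.simps(2))
      show ?thesis using Pol_coord[OF Suc.IH[OF q(1)], of i] q(2) by (simp add: algebra_simps)
    qed
  qed
  show ?thesis using g
  proof (induction rule: Pol_induct)
    case zero
    then show ?case using Pol_zero by simp
  next
    case (step c p g)
    from Pol_add[OF Pol_scale[OF mon[OF step(1)], of c] step(2)]
    show ?case by (simp add: algebra_simps)
  qed
qed

lemma bounded_linear_coords:
  fixes f :: "real^'n \<Rightarrow> real"
  assumes "bounded_linear f"
  shows "f x = (\<Sum>i\<in>UNIV. x$i * f (axis i 1))"
proof -
  note lin = bounded_linear.linear[OF assms]
  have e: "(\<Sum>i\<in>UNIV. (x$i) *\<^sub>R axis i 1) = x"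
    using basis_expansion[of x] by (simp add: scalar_mult_eq_scaleR)
  have "f (\<Sum>i\<in>UNIV. (x$i) *\<^sub>R axis i 1) = (\<Sum>i\<in>UNIV. x$i * f (axis i 1))"
    by (simp only: linear_sum[OF lin] linear_scale[OF lin] real_scaleR_def)
  then show ?thesis unfolding e .
qed

text \<open>\<open>Pol d\<close> provides finite dimension and a degree count,
  \<open>real_polynomial_function\<close> provides differentiability and the Stone-Weierstrass
  theorem; this lemma and \<open>Pol_polynomial\<close> connect the two.\<close>

lemma polynomial_in_Pol:
  fixes f :: "real^'n \<Rightarrow> real"
  assumes "real_polynomial_function f"
  shows "\<exists>d. f \<in> Pol d"
  using assms
proof induction
  case (linear f)
  have "(\<lambda>x. f (axis i 1) * (x$i * 1)) \<in> Pol (Suc 0)" for i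
    by (intro Pol_scale Pol_coord Pol_const)
  then have "(\<lambda>x. \<Sum>i\<in>UNIV. f (axis i 1) * (x$i * 1)) \<in> Pol (Suc 0)"
    by (intro Pol_sum) auto
  moreover have "f = (\<lambda>x. \<Sum>i\<in>UNIV. f (axis i 1) * (x$i * 1))"
  proof
    fix x show "f x = (\<Sum>i\<in>UNIV. f (axis i 1) * (x$i * 1))"
      using bounded_linear_coords[OF linear, of x] by (simp only: mult.commute mult_1)
  qed
  ultimately show ?case by auto
next
  case (const c)
  then show ?case using Pol_const by blast
next
  case (add f g)
  then obtain d e where "f \<in> Pol d" "g \<in> Pol e" by blast
  then have "f \<in> Pol (max d e)" "g \<in> Pol (max d e)"
    using Pol_mono[of d "max d e"] Pol_mono[of e "max d e"] by auto
  then show ?case using Pol_add by blast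
next
  case (mult f g)
  then show ?case using Pol_mult by blast
qed

lemma Pol_polynomial:
  fixes f :: "real^'n \<Rightarrow> real"
  assumes "f \<in> Pol d"
  shows "real_polynomial_function f"
proof -
  have mon: "real_polynomial_function p" if "p \<in> monoms d" for p :: "real^'n \<Rightarrow> real"
    using that
  proof (induction d arbitrary: p)
    case (Suc d)
    have "real_polynomial_function (\<lambda>x::real^'n. x$i)" for i
      by (intro real_polynomial_function.intros(1) bounded_linear_vec_nth)
    then have co: "real_polynomial_function (\<lambda>x. x$i * q x)" if "q \<in> monoms d" for i and q :: "real^'n \<Rightarrow> real"
      using Suc.IH[OF that] by (rule real_polynomial_function.intros(4))
    from Suc.prems consider "p \<in> monoms d" | i and q :: "real^'n \<Rightarrow> real" where "q \<in> monoms d" "p = (\<lambda>x. x$i * q x)"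
      by (auto simp: monoms.simps(2))
    then show ?case using Suc.IH co by cases auto
  qed auto
  show ?thesis using assms
  proof (induction rule: Pol_induct)
    case (step c p f)
    show ?case
      by (intro real_polynomial_function.intros(3,4) real_polynomial_function.intros(2)[of c]
          mon[OF step(1)] step(2))
  qed (rule real_polynomial_function.intros(2))
qed

section \<open>Partial derivatives and second-order operators on polynomials\<close>

definition pd :: "'n \<Rightarrow> (real^'n \<Rightarrow> real) \<Rightarrow> real^'n \<Rightarrow> real" where
  "pd i f x = frechet_derivative f (at x) (axis i 1)"

lemma pd_eqI: "(f has_derivative f') (at x) \<Longrightarrow> pd i f x = f' (axis i 1)"
  unfolding pd_def using frechet_derivative_at by metis

lemma poly_has_derivative:
  fixes f :: "real^'n \<Rightarrow> real"
  assumes "real_polynomial_function f"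
  shows "(f has_derivative (\<lambda>v. (\<chi> i. pd i f x) \<bullet> v)) (at x)"
proof -
  have d: "(f has_derivative frechet_derivative f (at x)) (at x)"
    using differentiable_at_real_polynomial_function[OF assms] frechet_derivative_works by blast
  have "frechet_derivative f (at x) v = (\<chi> i. pd i f x) \<bullet> v" for v
    using bounded_linear_coords[OF has_derivative_bounded_linear[OF d], of v]
    by (simp add: inner_vec_def pd_def mult.commute)
  then have "frechet_derivative f (at x) = (\<lambda>v. (\<chi> i. pd i f x) \<bullet> v)" by auto
  then show ?thesis using d by simp
qed

lemma pd_lin:
  assumes "real_polynomial_function f" "real_polynomial_function g"
  shows "pd i (\<lambda>x. c * f x + g x) = (\<lambda>x. c * pd i f x + pd i g x)"
proof
  fix x
  have "((\<lambda>x. c * f x + g x) has_derivative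
     (\<lambda>v. c * ((\<chi> i. pd i f x) \<bullet> v) + (\<chi> i. pd i g x) \<bullet> v)) (at x)"
    by (auto intro!: derivative_eq_intros poly_has_derivative assms)
  from pd_eqI[OF this] show "pd i (\<lambda>x. c * f x + g x) x = c * pd i f x + pd i g x"
    by (simp add: inner_axis)
qed

lemma pd_const: "pd i (\<lambda>x. c) = (\<lambda>x. 0)"
  using pd_eqI[OF has_derivative_const] by (auto simp: fun_eq_iff)

lemma pd_coord:
  assumes "real_polynomial_function f"
  shows "pd i (\<lambda>x. x$j * f x) = (\<lambda>x. (if i = j then 1 else 0) * f x + x$j * pd i f x)"
proof
  fix x
  have "((\<lambda>x. x$j * f x) has_derivative
     (\<lambda>v. x$j * ((\<chi> i. pd i f x) \<bullet> v) + v$j * f x)) (at x)"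
    by (intro has_derivative_mult poly_has_derivative assms
        bounded_linear_imp_has_derivative bounded_linear_vec_nth)
  from pd_eqI[OF this] show "pd i (\<lambda>x. x$j * f x) x = (if i = j then 1 else 0) * f x + x$j * pd i f x"
    by (simp add: inner_axis) (simp add: axis_def)
qed

lemma pd_Pol:
  assumes "f \<in> Pol d"
  shows "pd i f \<in> Pol (d - 1)"
proof -
  have mon: "pd i p \<in> Pol (d - 1)" if "p \<in> monoms d" for p
    using that
  proof (induction d arbitrary: p)
    case 0
    then have "pd i p = (\<lambda>x. 0)" using pd_const[of i 1] by simp
    then show ?case using Pol_zero[of "0 - 1"] by simp
  next
    case (Suc d)
    show ?case
    proof (cases "p \<in> monoms d")
      case True
      then show ?thesis using Suc.IH[of p] Pol_mono[of "d - 1" "Suc d - 1"] by auto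
    next
      case False
      then obtain j q where q: "q \<in> monoms d" "p = (\<lambda>x. x$j * q x)" using Suc.prems by (auto simp: monoms.simps(2))
      have qP: "q \<in> Pol d" using q(1) by (rule fspace.span_base)
      \<comment> \<open>The subtraction \<open>d - 1\<close> is truncated, so at
        \<open>d = 0\<close> multiplication by the coordinate would land in degree 1; there
        \<open>q\<close> is constant and the product is zero.\<close>
      have "(\<lambda>x. x$j * pd i q x) \<in> Pol d"
      proof (cases d)
        case 0
        then have "pd i q = (\<lambda>x. 0)" using q(1) pd_const[of i 1] by simp
        then show ?thesis using Pol_zero[of d] by simp
      next
        case (Suc d')
        then show ?thesis using Pol_coord[OF Suc.IH[OF q(1)], of j] by simp
      qed
      from Pol_add[OF Pol_scale[OF qP] this] show ?thesis
        unfolding q(2) pd_coord[OF Pol_polynomial[OF qP]] by simp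
    qed
  qed
  have "f \<in> Pol d \<and> pd i f \<in> Pol (d - 1)" using assms
  proof (induction rule: Pol_induct)
    case zero
    then show ?case using pd_const[of i 0] by (auto intro: Pol_zero)
  next
    case (step c p f)
    have p: "p \<in> Pol d" using step(1) by (rule fspace.span_base)
    have "pd i (\<lambda>x. c * p x + f x) = (\<lambda>x. c * pd i p x + pd i f x)"
      using p step(2) by (intro pd_lin Pol_polynomial) auto
    then show ?case
      using step(2) p mon[OF step(1)] by (auto intro!: Pol_add Pol_scale)
  qed
  then show ?thesis ..
qed

lemma pd_poly: "real_polynomial_function f \<Longrightarrow> real_polynomial_function (pd i f)"
  using polynomial_in_Pol pd_Pol Pol_polynomial by blast

lemma has_derivative_vec_nthI:
  fixes g :: "'a::real_normed_vector \<Rightarrow> real^'n"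
  assumes "\<And>i. ((\<lambda>x. g x $ i) has_derivative (\<lambda>v. G v $ i)) (at x)"
  shows "(g has_derivative G) (at x)"
proof -
  have "((\<lambda>x. g x \<bullet> b) has_derivative (\<lambda>v. G v \<bullet> b)) (at x)" if b: "b \<in> Basis" for b
  proof -
    obtain i where "b = axis i 1" using b by (auto simp: Basis_vec_def)
    then show ?thesis using assms[of i] by (simp add: inner_axis)
  qed
  then show ?thesis using has_derivative_componentwise_within[of g G x UNIV] by blast
qed

lemma poly_C2on:
  fixes f :: "real^'n \<Rightarrow> real"
  assumes "real_polynomial_function f"
  shows "C2on UNIV f (\<lambda>x. \<chi> i. pd i f x) (\<lambda>x. \<chi> j i. pd i (pd j f) x)"
  unfolding C2on_def
proof (intro conjI ballI)
  fix x :: "real^'n"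
  show "(f has_derivative (\<lambda>v. (\<chi> i. pd i f x) \<bullet> v)) (at x)"
    by (rule poly_has_derivative[OF assms])
  show "((\<lambda>x. \<chi> i. pd i f x) has_derivative (\<lambda>v. (\<chi> j i. pd i (pd j f) x) *v v)) (at x)"
  proof (rule has_derivative_vec_nthI)
    fix j
    have "(\<lambda>v. ((\<chi> j i. pd i (pd j f) x) *v v) $ j) = (\<lambda>v. (\<chi> i. pd i (pd j f) x) \<bullet> v)"
      by (simp add: matrix_vector_mul_component)
    then show "((\<lambda>x. (\<chi> i. pd i f x) $ j) has_derivative (\<lambda>v. ((\<chi> j i. pd i (pd j f) x) *v v) $ j)) (at x)"
      using poly_has_derivative[OF pd_poly[OF assms], of j x] by simp
  qed
  have "continuous_on UNIV (pd i (pd j f))" for i j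
    using pd_poly[OF pd_poly[OF assms]] continuous_on_polymonial_function real_polynomial_function_eq
    by blast
  then show "continuous_on UNIV (\<lambda>x. \<chi> j i. pd i (pd j f) x)"
    by (intro continuous_on_vec_lambda)
qed simp

definition Lop :: "real^'n^'n \<Rightarrow> (real^'n \<Rightarrow> real) \<Rightarrow> real^'n \<Rightarrow> real" where
  "Lop B f x = B \<bullet> (\<chi> j i. pd i (pd j f) x)"

lemma Lop_eq: "Lop B f = (\<lambda>x. \<Sum>j\<in>UNIV. \<Sum>i\<in>UNIV. B$j$i * pd i (pd j f) x)"
  by (auto simp: Lop_def inner_vec_def)

lemma Lop_lin:
  assumes "real_polynomial_function f" "real_polynomial_function g"
  shows "Lop B (\<lambda>x. c * f x + g x) = (\<lambda>x. c * Lop B f x + Lop B g x)"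
  unfolding Lop_eq pd_lin[OF assms] pd_lin[OF pd_poly[OF assms(1)] pd_poly[OF assms(2)]]
  by (simp add: sum.distrib sum_distrib_left algebra_simps)

lemma Lop_Pol:
  assumes "f \<in> Pol (d + 2)"
  shows "Lop B f \<in> Pol d"
proof -
  have "pd i (pd j f) \<in> Pol d" for i j
    using pd_Pol[OF pd_Pol[OF assms, of j], of i] by simp
  then show ?thesis unfolding Lop_eq by (intro Pol_sum Pol_scale) auto
qed

text \<open>Restricted to the line through \<open>p\<close> and \<open>x\<close>, the polynomial has
  one variable and infinitely many zeros near \<open>p\<close>.\<close>

lemma poly_zero_on_ball:
  fixes f :: "real^'n \<Rightarrow> real"
  assumes f: "real_polynomial_function f" and r: "r > 0" and z: "\<And>x. x \<in> ball p r \<Longrightarrow> f x = 0"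
  shows "f x = 0"
proof -
  define q where "q = (\<lambda>t::real. f (p + t *\<^sub>R (x - p)))"
  have "polynomial_function (\<lambda>t::real. p + t *\<^sub>R (x - p))"
    by (intro polynomial_function_add polynomial_function_const
        polynomial_function_bounded_linear bounded_linear_scaleR_left)
  from real_polynomial_function_compose[OF this f]
  have "real_polynomial_function q" by (simp add: q_def o_def)
  then obtain a n where a: "q = (\<lambda>t. \<Sum>i\<le>n. a i * t^i)"
    using real_polynomial_function_imp_sum by blast
  define e where "e = r / (norm (x - p) + 1)"
  have e: "e > 0" unfolding e_def using r by (simp add: add_nonneg_pos)
  have "{0<..<e} \<subseteq> {t. (\<Sum>i\<le>n. a i * t^i) = 0}"
  proof
    fix t assume t: "t \<in> {0<..<e}"
    have "t * norm (x - p) \<le> t * (norm (x - p) + 1)" using t by simp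
    also have "\<dots> < e * (norm (x - p) + 1)"
      using t by (intro mult_strict_right_mono) (auto simp: add_nonneg_pos)
    also have "\<dots> = r"
      using nonzero_eq_divide_eq[of "norm (x - p) + 1" e r] norm_ge_zero[of "x - p"] e_def by linarith
    finally have "q t = 0" unfolding q_def using t by (intro z) (simp add: dist_norm)
    then show "t \<in> {t. (\<Sum>i\<le>n. a i * t^i) = 0}" by (simp add: a)
  qed
  then have "infinite {t. (\<Sum>i\<le>n. a i * t^i) = 0}"
    using infinite_Ioo[OF e] finite_subset by blast
  then have "\<forall>i\<le>n. a i = 0" by (simp add: polyfun_finite_roots)
  then have "q 1 = 0" by (simp add: a)
  then show ?thesis by (simp add: q_def)
qed

section \<open>Half-spaces and their Dirichlet problem\<close>

definition halfspace :: "real^'n^'n \<Rightarrow> (real^'n^'n) set" where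
  "halfspace B = {A. 0 \<le> B \<bullet> A}"

text \<open>The operator may degenerate in some directions; only the trace
  \<open>B \<bullet> mat 1\<close> has to be positive, which is the strictness that comparison
  uses.\<close>

definition elliptic :: "real^'n^'n \<Rightarrow> bool" where
  "elliptic B \<longleftrightarrow> 0 < B \<bullet> mat 1 \<and> (\<forall>P. psd P \<longrightarrow> 0 \<le> B \<bullet> P)"

lemma halfspace_C2on_vsub_at:
  assumes "elliptic B" "C2on U f g Hs" "x \<in> U" "0 \<le> B \<bullet> Hs x"
  shows "vsub_at (halfspace B) f x"
  by (rule C2on_vsub_at[OF assms(2,3)])
     (use assms in \<open>auto simp: halfspace_def elliptic_def inner_add_right\<close>)

lemma halfspace_comparison:
  fixes u w :: "real^'n \<Rightarrow> real"
  assumes B: "elliptic B" and r: "r > 0"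
    and u: "continuous_on (cball p r) u" "\<And>x. x \<in> ball p r \<Longrightarrow> vsub_at (halfspace B) u x"
    and w: "continuous_on (cball p r) w" "C2on (ball p r) w g Hs" "\<And>x. x \<in> ball p r \<Longrightarrow> B \<bullet> Hs x \<le> 0"
    and bd: "\<And>x. x \<in> sphere p r \<Longrightarrow> u x \<le> w x" and x: "x \<in> cball p r"
  shows "u x \<le> w x"
proof (rule C2_comparison[of "ball p r" u "halfspace B" w g Hs])
  show "Hs x - \<epsilon> *\<^sub>R mat 1 \<notin> halfspace B" if "x \<in> ball p r" "0 < \<epsilon>" for x \<epsilon>
  proof -
    have "0 < \<epsilon> * (B \<bullet> mat 1)" using B that(2) by (simp add: elliptic_def)
    then show ?thesis
      using w(3)[OF that(1)] unfolding halfspace_def mem_Collect_eq inner_diff_right inner_scaleR_right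
      by linarith
  qed
qed (use assms in auto)

text \<open>With \<open>q\<close> vanishing on the sphere, the ansatz \<open>w = f + q * g\<close>
  asks for \<open>g\<close> with \<open>Lop B (q * g) = - Lop B f\<close>. Multiplication by
  \<open>q\<close> raises the degree by two and \<open>Lop B\<close> lowers it by two, so
  \<open>T\<close> maps \<open>Pol d\<close> to itself, and injectivity yields surjectivity.\<close>

lemma polynomial_dirichlet:
  fixes f :: "real^'n \<Rightarrow> real"
  assumes B: "elliptic B" and r: "r > 0" and f: "real_polynomial_function f"
  obtains w g Hs where "C2on UNIV w g Hs" "\<And>x. B \<bullet> Hs x = 0" "\<And>x. x \<in> sphere p r \<Longrightarrow> w x = f x"
proof -
  \<comment> \<open>This is \<open>r\<^sup>2 - (dist x p)\<^sup>2\<close>, written in coordinates so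
    that it visibly has degree two.\<close>
  define q where "q = (\<lambda>x::real^'n. r\<^sup>2 + (-1) * (\<Sum>i\<in>UNIV. (x$i + (- (p$i))) * (x$i + (- (p$i)))))"
  have "(\<lambda>x::real^'n. x$i * 1 + (- (p$i))) \<in> Pol 1" for i
    unfolding One_nat_def by (intro Pol_add Pol_coord Pol_const)
  then have "(\<lambda>x::real^'n. (x$i + (- (p$i))) * (x$i + (- (p$i)))) \<in> Pol 2" for i
    using Pol_mult[of _ 1 _ 1] unfolding mult_1_right one_add_one by blast
  then have q2: "q \<in> Pol 2" unfolding q_def by (intro Pol_add Pol_scale Pol_sum Pol_const) auto
  have q: "q x = r\<^sup>2 - (dist x p)\<^sup>2" for x
    unfolding q_def by (simp add: dist_norm power2_norm_eq_inner inner_vec_def)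
  have qpos: "q x > 0" if "x \<in> ball p r" for x
    using that r by (simp add: q power_strict_mono dist_commute)
  have qz: "q x = 0" if "x \<in> sphere p r" for x
    using that by (simp add: q dist_commute)
  obtain d where d: "f \<in> Pol d" using polynomial_in_Pol[OF f] by blast
  define T where "T = (\<lambda>g. Lop B (\<lambda>x. q x * g x))"
  have qg: "(\<lambda>x. q x * g x) \<in> Pol (d + 2)" if "g \<in> Pol d" for g
    using Pol_mult[OF q2 that] by (simp add: add.commute)
  have poly: "real_polynomial_function (\<lambda>x. q x * g x)" if "g \<in> Pol d" for g
    using Pol_polynomial[OF qg[OF that]] .
  have lin: "T (\<lambda>x. c * g x + g' x) = (\<lambda>x. c * T g x + T g' x)" if "g \<in> Pol d" "g' \<in> Pol d" for c g g'
    using Lop_lin[OF poly[OF that(1)] poly[OF that(2)], of B c]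
    unfolding T_def by (simp add: algebra_simps)
  have T0: "T (\<lambda>x. 0) = (\<lambda>x. 0)"
    using lin[OF Pol_zero Pol_zero, of "-1"] by simp
  have "\<exists>g\<in>Pol d. T g = (\<lambda>x. (-1) * Lop B f x)"
  proof (rule inj_endo_span_surj[OF finite_monoms])
    show "(\<lambda>x. (-1) * Lop B f x) \<in> Pol d"
      using Lop_Pol[of f d B] d Pol_mono[of d "d + 2"] by (intro Pol_scale) auto
    show "T g \<in> Pol d" if "g \<in> Pol d" for g
      unfolding T_def by (rule Lop_Pol[OF qg[OF that]])
    show "T (g + g') = T g + T g'" if "g \<in> Pol d" "g' \<in> Pol d" for g g'
      using lin[OF that, of 1] by (simp add: plus_fun_def)
    show "T (fscale c g) = fscale c (T g)" if "g \<in> Pol d" for c g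
      using lin[OF that Pol_zero, of c] T0 by (simp add: fscale_def)
    \<comment> \<open>Here \<open>q * g\<close> solves the equation with zero boundary values, so
      comparison from both sides makes it vanish in the ball, where \<open>q\<close> is positive. A
      polynomial vanishing on a ball vanishes everywhere.\<close>
    show "g = 0" if g: "g \<in> Pol d" and T: "T g = 0" for g
    proof -
      have Lz: "Lop B (\<lambda>x. q x * g x) x = 0" for x
        using T by (simp add: T_def fun_eq_iff)
      let ?w = "\<lambda>x. q x * g x"
      note C = poly_C2on[OF poly[OF g]]
      note Cc = C2on_const[OF open_UNIV, of "0::real"]
      have cw: "continuous_on S ?w" for S
        using C2on_cont[OF C] continuous_on_subset by blast
      have "?w x \<le> 0" if "x \<in> cball p r" for x
      proof (rule halfspace_comparison[OF B r])
        show "C2on (ball p r) (\<lambda>x. 0::real) (\<lambda>x. 0) (\<lambda>x. 0)" by (rule C2on_const) simp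
        show "vsub_at (halfspace B) ?w x" for x
          by (rule halfspace_C2on_vsub_at[OF B C]) (use Lz in \<open>auto simp: Lop_def\<close>)
      qed (use cw qz that in auto)
      moreover have "0 \<le> ?w x" if "x \<in> cball p r" for x
      proof (rule halfspace_comparison[OF B r])
        show "C2on (ball p r) ?w (\<lambda>x. \<chi> i. pd i ?w x) (\<lambda>x. \<chi> j i. pd i (pd j ?w) x)"
          using C2on_subset[OF C] by simp
        show "vsub_at (halfspace B) (\<lambda>x. 0) x" for x
          by (rule halfspace_C2on_vsub_at[OF B Cc]) auto
      qed (use cw qz that Lz in \<open>auto simp: Lop_def\<close>)
      ultimately have gz: "g x = 0" if "x \<in> ball p r" for x
        using qpos[OF that] that
        by (metis antisym ball_subset_cball in_mono less_irrefl mult_eq_0_iff)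
      have "g x = 0" for x
        by (rule poly_zero_on_ball[OF Pol_polynomial[OF g] r gz])
      then show ?thesis by (simp add: fun_eq_iff)
    qed
  qed
  then obtain g where g: "g \<in> Pol d" "T g = (\<lambda>x. (-1) * Lop B f x)" by blast
  define w where "w = (\<lambda>x. 1 * f x + q x * g x)"
  have wp: "real_polynomial_function w"
    unfolding w_def using f poly[OF g(1)] by auto
  have L: "Lop B w x = 0" for x
    unfolding w_def Lop_lin[OF f poly[OF g(1)]] using g(2) by (simp add: T_def fun_eq_iff)
  show ?thesis
    by (rule that[OF poly_C2on[OF wp]]) (use L qz in \<open>auto simp: Lop_def w_def\<close>)
qed

section \<open>Sums and limits of subsolutions\<close>

locale convex_subeq =
  fixes F :: "(real^'n^'n) set"
  assumes closed_F: "closed F" and sym_F: "F \<subseteq> sym_mats"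
    and add_psd: "\<And>A P. A \<in> F \<Longrightarrow> psd P \<Longrightarrow> A + P \<in> F"
    and scaleR_mem: "\<And>A t. A \<in> F \<Longrightarrow> 0 < t \<Longrightarrow> t *\<^sub>R A \<in> F"
    and convex_F: "convex F" and zero_mem: "0 \<in> F" and neg_id: "- mat 1 \<notin> F"
begin

lemma psd_mem: "psd P \<Longrightarrow> P \<in> F"
  using add_psd[OF zero_mem] by simp

lemma psd_mat_1: "psd (mat 1 :: real^'n^'n)"
  by (simp add: psd_def)

text \<open>The separating level \<open>b\<close> is negative because \<open>0 \<in> F\<close>, and
  an element of \<open>F\<close> with \<open>B \<bullet> C < 0\<close> could be scaled down to that
  level. Hence the hyperplane may be moved to the origin.\<close>

lemma polar_separation:
  assumes "Z \<notin> F"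
  obtains B where "B \<bullet> Z < 0" "\<And>C. C \<in> F \<Longrightarrow> 0 \<le> B \<bullet> C"
proof -
  obtain B b where B: "B \<bullet> Z < b" "\<And>C. C \<in> F \<Longrightarrow> b < B \<bullet> C"
    using separating_hyperplane_closed_point[OF convex_F closed_F assms] by blast
  have b: "b < 0" using B(2)[OF zero_mem] by simp
  have "0 \<le> B \<bullet> C" if C: "C \<in> F" for C
  proof (rule ccontr)
    assume "\<not> 0 \<le> B \<bullet> C"
    then have n: "B \<bullet> C < 0" by simp
    then have "b / (B \<bullet> C) > 0" using b by (simp add: divide_neg_neg)
    from B(2)[OF scaleR_mem[OF C this]] show False using n by simp
  qed
  then show ?thesis using that[of B] B(1) b by simp
qed

text \<open>A functional separating \<open>A\<close> may have trace zero. Adding a small multiple of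
  one that separates \<open>- mat 1\<close> makes the trace positive.\<close>

lemma elliptic_separation:
  assumes "A \<notin> F"
  obtains B where "elliptic B" "F \<subseteq> halfspace B" "B \<bullet> A < 0"
proof -
  obtain B1 where B1: "B1 \<bullet> A < 0" "\<And>C. C \<in> F \<Longrightarrow> 0 \<le> B1 \<bullet> C"
    using polar_separation[OF assms] by blast
  obtain B0 where B0: "B0 \<bullet> - mat 1 < 0" "\<And>C. C \<in> F \<Longrightarrow> 0 \<le> B0 \<bullet> C"
    using polar_separation[OF neg_id] by blast
  \<comment> \<open>The added term contributes at most half of \<open>- (B1 \<bullet> A)\<close>, so
    \<open>A\<close> stays on the negative side.\<close>
  define e where "e = - (B1 \<bullet> A) / (2 * (\<bar>B0 \<bullet> A\<bar> + 1))"
  have e: "e > 0" unfolding e_def using B1(1) by (intro divide_pos_pos) auto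
  have "e * (B0 \<bullet> A) \<le> e * (\<bar>B0 \<bullet> A\<bar> + 1)"
    using e by (intro mult_left_mono) auto
  also have "\<dots> = - (B1 \<bullet> A) / 2"
    unfolding e_def using abs_ge_zero[of "B0 \<bullet> A"] by (simp add: divide_simps)
  finally have neg: "(B1 + e *\<^sub>R B0) \<bullet> A < 0"
    using B1(1) by (simp add: inner_add_left)
  have pos: "0 \<le> (B1 + e *\<^sub>R B0) \<bullet> C" if "C \<in> F" for C
    using B1(2)[OF that] B0(2)[OF that] e by (simp add: inner_add_left)
  have "0 < e * (B0 \<bullet> mat 1)" using B0(1) e by simp
  then have "0 < (B1 + e *\<^sub>R B0) \<bullet> mat 1"
    using B1(2)[OF psd_mem[OF psd_mat_1]] by (simp add: inner_add_left)
  then show ?thesis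
    using that[of "B1 + e *\<^sub>R B0"] neg pos psd_mem by (auto simp: elliptic_def halfspace_def)
qed

lemma vsub_at_halfspace:
  assumes "vsub_at F u x" "F \<subseteq> halfspace B"
  shows "vsub_at (halfspace B) u x"
  using assms unfolding vsub_at_def by blast

text \<open>By \<open>elliptic_separation\<close> these half-spaces cut out exactly
  \<open>F\<close>, so one linear operator at a time suffices.\<close>

lemma vsub_at_from_halfspaces:
  assumes "\<And>B. elliptic B \<Longrightarrow> F \<subseteq> halfspace B \<Longrightarrow> vsub_at (halfspace B) u x"
  shows "vsub_at F u x"
  unfolding vsub_at_def
proof (intro allI impI)
  fix \<psi> A assume *: "C2_hess \<psi> x A \<and> (\<forall>\<^sub>F y in nhds x. u y \<le> \<psi> y) \<and> u x = \<psi> x"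
  show "A \<in> F"
  proof (rule ccontr)
    assume "A \<notin> F"
    then obtain B where "elliptic B" "F \<subseteq> halfspace B" "B \<bullet> A < 0"
      using elliptic_separation by blast
    then show False using assms[of B] * unfolding vsub_at_def halfspace_def by fastforce
  qed
qed

end

text \<open>On the boundary of a small ball both summands are approximated from above by polynomials
  whose harmonic extensions majorize them inside; this makes the viscosity inequality additive.\<close>

lemma halfspace_add:
  fixes u v :: "real^'n \<Rightarrow> real"
  assumes B: "elliptic B" and X: "open X" "x \<in> X"
    and u: "continuous_on X u" "\<And>y. y \<in> X \<Longrightarrow> vsub_at (halfspace B) u y"
    and v: "continuous_on X v" "\<And>y. y \<in> X \<Longrightarrow> vsub_at (halfspace B) v y"
  shows "vsub_at (halfspace B) (\<lambda>y. u y + v y) x"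
proof (rule vsub_atI)
  fix U \<psi> g Hs
  assume C: "C2on U \<psi> g Hs" and xU: "x \<in> U"
    and le: "\<forall>\<^sub>F y in nhds x. u y + v y \<le> \<psi> y" and eq: "u x + v x = \<psi> x"
  show "Hs x \<in> halfspace B"
  proof (rule ccontr)
    assume "Hs x \<notin> halfspace B"
    then have neg: "B \<bullet> Hs x < 0" by (simp add: halfspace_def)
    have BI: "0 < B \<bullet> mat 1" using B by (simp add: elliptic_def)
    \<comment> \<open>Adding \<open>\<delta> * (norm (y - x))\<^sup>2\<close> to the test function
      uses up \<open>- (B \<bullet> Hs x) / 2\<close>, so the sum remains a supersolution wherever
      \<open>B \<bullet> Hs y < (B \<bullet> Hs x) / 2\<close>.\<close>
    define \<delta> where "\<delta> = - (B \<bullet> Hs x) / (4 * (B \<bullet> mat 1))"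
    have d: "\<delta> > 0" "2 * \<delta> * (B \<bullet> mat 1) = - (B \<bullet> Hs x) / 2"
      unfolding \<delta>_def using neg BI by (simp_all add: divide_neg_pos)
    have "\<forall>\<^sub>F y in nhds x. B \<bullet> Hs y < (B \<bullet> Hs x) / 2"
      by (rule order_tendstoD[OF tendsto_inner[OF tendsto_const C2on_Hess_tendsto[OF C xU]]])
         (use neg in simp)
    moreover have "\<forall>\<^sub>F y in nhds x. y \<in> U \<inter> X"
      using C2on_open[OF C] xU X by (intro eventually_nhds_in_open) auto
    ultimately have "\<forall>\<^sub>F y in nhds x. B \<bullet> Hs y < (B \<bullet> Hs x) / 2 \<and> y \<in> U \<inter> X \<and> u y + v y \<le> \<psi> y"
      using le by eventually_elim auto
    then obtain r0 where r0: "r0 > 0" "\<And>y. dist y x < r0 \<Longrightarrow> B \<bullet> Hs y < (B \<bullet> Hs x) / 2 \<and> y \<in> U \<inter> X \<and> u y + v y \<le> \<psi> y"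
      unfolding eventually_nhds_metric by blast
    define r where "r = r0 / 2"
    have r: "r > 0" "\<And>y. y \<in> cball x r \<Longrightarrow> B \<bullet> Hs y < (B \<bullet> Hs x) / 2 \<and> y \<in> U \<inter> X \<and> u y + v y \<le> \<psi> y"
      using r0 by (auto simp: r_def dist_commute)
    then have sub: "cball x r \<subseteq> U" "cball x r \<subseteq> X" by blast+
    \<comment> \<open>The quadratic equals \<open>4 * \<epsilon>\<close> on the sphere. After
      lowering by \<open>2 * \<epsilon>\<close> there remains \<open>2 * \<epsilon>\<close> for the
      errors of the two majorants, while at the centre \<open>\<psi>'\<close> is strictly below
      \<psi>.\<close>
    define \<epsilon> where "\<epsilon> = \<delta> * r\<^sup>2 / 4"
    have e: "\<epsilon> > 0" using d r by (simp add: \<epsilon>_def)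
    define \<psi>' where "\<psi>' = (\<lambda>y. (\<psi> y + \<delta> * (norm (y - x))\<^sup>2) + - (2 * \<epsilon>))"
    have maj: "\<exists>w g Hs. C2on UNIV w g Hs \<and> (\<forall>y. B \<bullet> Hs y = 0) \<and> (\<forall>y\<in>cball x r. u y \<le> w y)
        \<and> (\<forall>y\<in>sphere x r. w y \<le> u y + \<epsilon>)"
      if u: "continuous_on X u" "\<And>y. y \<in> X \<Longrightarrow> vsub_at (halfspace B) u y" for u
    proof -
      have cu: "continuous_on (cball x r) u" using u(1) sub(2) continuous_on_subset by blast
      \<comment> \<open>Approximating \<open>u + \<epsilon> / 2\<close> to within
        \<open>\<epsilon> / 2\<close> places the polynomial between \<open>u\<close> and
        \<open>u + \<epsilon>\<close>.\<close>
      have "continuous_on (sphere x r) (\<lambda>y. u y + \<epsilon> / 2)"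
        by (intro continuous_intros continuous_on_subset[OF cu]) auto
      then obtain f where f: "real_polynomial_function f" "\<And>y. y \<in> sphere x r \<Longrightarrow> \<bar>(u y + \<epsilon> / 2) - f y\<bar> < \<epsilon> / 2"
        using Stone_Weierstrass_real_polynomial_function[of "sphere x r" "\<lambda>y. u y + \<epsilon> / 2" "\<epsilon> / 2"] e
        by auto
      obtain w g Hs where w: "C2on UNIV w g Hs" "\<And>y. B \<bullet> Hs y = 0" "\<And>y. y \<in> sphere x r \<Longrightarrow> w y = f y"
        using polynomial_dirichlet[OF B r(1) f(1), of x] by blast
      have bd: "u y \<le> w y" "w y \<le> u y + \<epsilon>" if "y \<in> sphere x r" for y
        using f(2)[OF that] unfolding w(3)[OF that] by linarith+
      have "u y \<le> w y" if "y \<in> cball x r" for y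
      proof (rule halfspace_comparison[OF B r(1)])
        show "continuous_on (cball x r) w" using C2on_cont[OF w(1)] continuous_on_subset by blast
        show "C2on (ball x r) w g Hs" using C2on_subset[OF w(1)] by simp
        show "vsub_at (halfspace B) u y" if "y \<in> ball x r" for y
          using u(2) sub(2) that ball_subset_cball by blast
      qed (use cu w(2) bd that in auto)
      then show ?thesis using w bd by blast
    qed
    obtain w1 g1 Hs1 where w1: "C2on UNIV w1 g1 Hs1" "\<And>y. B \<bullet> Hs1 y = 0" "\<And>y. y \<in> cball x r \<Longrightarrow> u y \<le> w1 y"
        "\<And>y. y \<in> sphere x r \<Longrightarrow> w1 y \<le> u y + \<epsilon>"
      using maj[OF u] by blast
    obtain w2 g2 Hs2 where w2: "C2on UNIV w2 g2 Hs2" "\<And>y. B \<bullet> Hs2 y = 0" "\<And>y. y \<in> cball x r \<Longrightarrow> v y \<le> w2 y"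
        "\<And>y. y \<in> sphere x r \<Longrightarrow> w2 y \<le> v y + \<epsilon>"
      using maj[OF v] by blast
    note Cw = C2on_add[OF w1(1) w2(1)]
    have C': "C2on U \<psi>' (\<lambda>y. g y + (2 * \<delta>) *\<^sub>R (y - x)) (\<lambda>y. Hs y + (2 * \<delta>) *\<^sub>R mat 1)"
      unfolding \<psi>'_def by (intro C2on_add_const C2on_add_quad C)
    have "w1 x + w2 x \<le> \<psi>' x"
    proof (rule halfspace_comparison[OF B r(1)])
      show "continuous_on (cball x r) (\<lambda>y. w1 y + w2 y)"
        using C2on_cont[OF Cw] continuous_on_subset by blast
      show "vsub_at (halfspace B) (\<lambda>y. w1 y + w2 y) y" for y
        by (rule halfspace_C2on_vsub_at[OF B Cw]) (use w1(2) w2(2) in \<open>auto simp: inner_add_right\<close>)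
      show "continuous_on (cball x r) \<psi>'"
        using C2on_cont[OF C'] sub(1) continuous_on_subset by blast
      show "C2on (ball x r) \<psi>' (\<lambda>y. g y + (2 * \<delta>) *\<^sub>R (y - x)) (\<lambda>y. Hs y + (2 * \<delta>) *\<^sub>R mat 1)"
        using sub(1) ball_subset_cball by (intro C2on_subset[OF C']) auto
      show "B \<bullet> (Hs y + (2 * \<delta>) *\<^sub>R mat 1) \<le> 0" if "y \<in> ball x r" for y
        using r(2)[of y] that d(2) by (simp add: inner_add_right)
      show "w1 y + w2 y \<le> \<psi>' y" if y: "y \<in> sphere x r" for y
      proof -
        have "norm (y - x) = r" using y by (simp add: dist_norm norm_minus_commute)
        then have "\<psi>' y = \<psi> y + 2 * \<epsilon>" by (simp add: \<psi>'_def \<epsilon>_def)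
        moreover have "u y + v y \<le> \<psi> y" using r(2)[of y] y by simp
        ultimately show ?thesis using w1(4)[OF y] w2(4)[OF y] by linarith
      qed
    qed (use r in auto)
    moreover have "u x \<le> w1 x" "v x \<le> w2 x" using r w1(3) w2(3) by auto
    ultimately show False using eq e by (simp add: \<psi>'_def)
  qed
qed

lemma small_multiple_of_id:
  fixes e :: real
  assumes e: "e > 0"
  obtains \<delta> where "\<delta> > 0" "2 * \<delta> * norm (mat 1 :: real^'n^'n) \<le> e / 2"
proof -
  define K where "K = norm (mat 1 :: real^'n^'n) + 1"
  have K: "K > 0" by (simp add: K_def add_nonneg_pos)
  have "2 * (e / (4 * K)) * norm (mat 1 :: real^'n^'n) \<le> 2 * (e / (4 * K)) * K"
    using e K by (intro mult_left_mono) (auto simp: K_def)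
  also have "\<dots> = e / 2" using K by simp
  finally show ?thesis using that[of "e / (4 * K)"] e K by simp
qed

text \<open>A quadratic makes the contact at \<open>x\<close> strict, so an approximant touches the
  perturbed test function at a nearby point; \<open>F\<close> is closed. The approximation is
  one-sided away from \<open>x\<close>, which covers uniform limits as well as suprema, where one
  competitor is nearly optimal at \<open>x\<close> and none exceeds the supremum.\<close>

lemma vsub_at_limit:
  fixes u :: "real^'n \<Rightarrow> real"
  assumes F: "closed F" and X: "open X" "x \<in> X"
    and app: "\<And>\<epsilon>. \<epsilon> > 0 \<Longrightarrow> \<exists>u'. continuous_on X u' \<and> (\<forall>y\<in>X. vsub_at F u' y)
        \<and> u x - \<epsilon> \<le> u' x \<and> (\<forall>y\<in>X. u' y \<le> u y + \<epsilon>)"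
  shows "vsub_at F u x"
proof (rule vsub_atI)
  fix U \<psi> g Hs
  assume C: "C2on U \<psi> g Hs" and xU: "x \<in> U"
    and le: "\<forall>\<^sub>F y in nhds x. u y \<le> \<psi> y" and eq: "u x = \<psi> x"
  have "\<exists>A\<in>F. dist A (Hs x) < e" if e: "e > 0" for e
  proof -
    obtain \<delta> where d: "\<delta> > 0" and dn: "2 * \<delta> * norm (mat 1 :: real^'n^'n) \<le> e / 2"
      using small_multiple_of_id[OF e] by blast
    have "\<forall>\<^sub>F y in nhds x. dist (Hs y) (Hs x) < e / 2"
      by (rule tendstoD[OF C2on_Hess_tendsto[OF C xU]]) (use e in simp)
    moreover have "\<forall>\<^sub>F y in nhds x. y \<in> U \<inter> X"
      using C2on_open[OF C] xU X by (intro eventually_nhds_in_open) auto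
    ultimately have "\<forall>\<^sub>F y in nhds x. dist (Hs y) (Hs x) < e / 2 \<and> y \<in> U \<inter> X \<and> u y \<le> \<psi> y"
      using le by eventually_elim auto
    then obtain r0 where r0: "r0 > 0" "\<And>y. dist y x < r0 \<Longrightarrow> dist (Hs y) (Hs x) < e / 2 \<and> y \<in> U \<inter> X \<and> u y \<le> \<psi> y"
      unfolding eventually_nhds_metric by blast
    define r where "r = r0 / 2"
    have r: "r > 0" "\<And>y. y \<in> cball x r \<Longrightarrow> dist (Hs y) (Hs x) < e / 2 \<and> y \<in> U \<inter> X \<and> u y \<le> \<psi> y"
      using r0 by (auto simp: r_def dist_commute)
    then have sub: "cball x r \<subseteq> U" "cball x r \<subseteq> X" by blast+
    \<comment> \<open>On the sphere the quadratic is \<open>4 * \<epsilon>\<close>, more than the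
      two approximation errors of \<epsilon>, so the maximum lies inside the ball.\<close>
    define \<epsilon> where "\<epsilon> = \<delta> * r\<^sup>2 / 4"
    have ep: "\<epsilon> > 0" using d r by (simp add: \<epsilon>_def)
    obtain u' where u': "continuous_on X u'" "\<And>y. y \<in> X \<Longrightarrow> vsub_at F u' y" "u x - \<epsilon> \<le> u' x"
        "\<And>y. y \<in> X \<Longrightarrow> u' y \<le> u y + \<epsilon>"
      using app[OF ep] by blast
    define \<psi>' where "\<psi>' = (\<lambda>y. \<psi> y + \<delta> * (norm (y - x))\<^sup>2)"
    have C': "C2on U \<psi>' (\<lambda>y. g y + (2 * \<delta>) *\<^sub>R (y - x)) (\<lambda>y. Hs y + (2 * \<delta>) *\<^sub>R mat 1)"
      unfolding \<psi>'_def by (intro C2on_add_quad C)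
    have cont: "continuous_on (cball x r) (\<lambda>y. u' y - \<psi>' y)"
      using sub by (intro continuous_intros continuous_on_subset[OF u'(1)]
          continuous_on_subset[OF C2on_cont[OF C']])
    have "cball x r \<noteq> {}" using r(1) by simp
    then obtain z where z: "z \<in> cball x r" "\<And>y. y \<in> cball x r \<Longrightarrow> u' y - \<psi>' y \<le> u' z - \<psi>' z"
      using continuous_attains_sup[OF compact_cball _ cont] by meson
    have "z \<notin> sphere x r"
    proof
      assume s: "z \<in> sphere x r"
      then have "norm (z - x) = r" by (simp add: dist_norm norm_minus_commute)
      then have "\<psi>' z = \<psi> z + 4 * \<epsilon>" by (simp add: \<psi>'_def \<epsilon>_def)
      moreover have "u' z \<le> \<psi> z + \<epsilon>" using u'(4)[of z] r(2)[OF z(1)] by force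
      moreover have "u' x - \<psi>' x \<le> u' z - \<psi>' z" using r(1) by (intro z(2)) simp
      moreover have "\<psi>' x = u x" using eq by (simp add: \<psi>'_def)
      ultimately show False using u'(3) ep by linarith
    qed
    then have zb: "z \<in> ball x r" using z(1) by (auto simp: less_le)
    have zU: "z \<in> U" and zX: "z \<in> X" using z(1) sub by auto
    have "Hs z + (2 * \<delta>) *\<^sub>R mat 1 \<in> F"
      by (rule touching_at_max[OF _ open_ball zb C' zU u'(2)[OF zX]]) (use z(2) in auto)
    moreover have "dist (Hs z + (2 * \<delta>) *\<^sub>R mat 1) (Hs x) < e"
    proof -
      have "dist (Hs z + (2 * \<delta>) *\<^sub>R mat 1) (Hs x) \<le> dist (Hs z) (Hs x) + norm ((2 * \<delta>) *\<^sub>R (mat 1 :: real^'n^'n))"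
        unfolding dist_norm by (rule order_trans[OF _ norm_triangle_ineq]) (simp add: algebra_simps)
      also have "\<dots> < e / 2 + e / 2"
        using r(2)[OF z(1)] dn d by (intro add_less_le_mono) auto
      finally show ?thesis by simp
    qed
    ultimately show ?thesis by blast
  qed
  then show "Hs x \<in> F" using closed_approachable[OF F] by blast
qed

context convex_subeq begin

lemma vsub_add:
  assumes X: "open X" "x \<in> X"
    and u: "continuous_on X u" "\<And>y. y \<in> X \<Longrightarrow> vsub_at F u y"
    and v: "continuous_on X v" "\<And>y. y \<in> X \<Longrightarrow> vsub_at F v y"
  shows "vsub_at F (\<lambda>y. u y + v y) x"
  using assms by (intro vsub_at_from_halfspaces halfspace_add[OF _ X]) (auto intro: vsub_at_halfspace)

lemma vsub_const: "vsub_at F (\<lambda>y. c) x"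
  by (rule C2on_vsub_at[OF C2on_const[OF open_UNIV]]) (auto intro: zero_mem add_psd)

lemma vsub_scale: "vsub_at F u x \<Longrightarrow> 0 \<le> c \<Longrightarrow> vsub_at F (\<lambda>y. c * u y) x"
  using vsub_const[of 0 x] vsub_at_scale[of F u x c] scaleR_mem by (cases "c = 0") auto

lemma vsub_sum:
  assumes "finite I" and X: "open X" "x \<in> X"
    and "\<And>i. i \<in> I \<Longrightarrow> continuous_on X (f i) \<and> (\<forall>y\<in>X. vsub_at F (f i) y)"
  shows "vsub_at F (\<lambda>y. \<Sum>i\<in>I. f i y) x"
  using assms(1,3,4)
proof (induction I arbitrary: x rule: finite_induct)
  case empty
  then show ?case by (simp add: vsub_const)
next
  case (insert i I)
  have "vsub_at F (\<lambda>y. f i y + (\<Sum>i\<in>I. f i y)) x"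
    using insert by (intro vsub_add[OF X(1) insert.prems(1)] continuous_on_sum) auto
  then show ?case using insert.hyps by simp
qed

end

section \<open>Convolution with a bump function\<close>

lemma proj_mat_continuous: "continuous_on U g \<Longrightarrow> continuous_on U (\<lambda>y. proj_mat (g y))"
  unfolding proj_mat_def by (intro continuous_intros continuous_on_vec_lambda)

lemma C2on_grad_cont: "C2on U f g Hs \<Longrightarrow> continuous_on U g"
  unfolding C2on_def
  by (meson continuous_at_imp_continuous_on has_derivative_continuous)

text \<open>The rank-one term \<open>\<kappa>'' (f y) *\<^sub>R proj_mat (g y)\<close> is the one
  that later makes boundary convexity usable.\<close>

lemma C2on_compose:
  fixes g :: "real^'n \<Rightarrow> real^'n"
  assumes C: "C2on U f g Hs"
    and d1: "\<And>s. (\<kappa> has_real_derivative \<kappa>' s) (at s)"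
    and d2: "\<And>s. (\<kappa>' has_real_derivative \<kappa>'' s) (at s)"
    and c2: "continuous_on UNIV \<kappa>''"
  shows "C2on U (\<lambda>y. \<kappa> (f y)) (\<lambda>y. \<kappa>' (f y) *\<^sub>R g y)
           (\<lambda>y. \<kappa>' (f y) *\<^sub>R Hs y + \<kappa>'' (f y) *\<^sub>R proj_mat (g y))"
  unfolding C2on_def
proof (intro conjI ballI)
  fix y assume y: "y \<in> U"
  note f = C2on_grad[OF C y] and g = C2on_Hess[OF C y]
  show "((\<lambda>y. \<kappa> (f y)) has_derivative (\<lambda>v. (\<kappa>' (f y) *\<^sub>R g y) \<bullet> v)) (at y)"
    using has_derivative_compose[OF f d1[of "f y", unfolded has_field_derivative_def]] by simp
  have k': "((\<lambda>y. \<kappa>' (f y)) has_derivative (\<lambda>v. \<kappa>'' (f y) * (g y \<bullet> v))) (at y)"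
    using has_derivative_compose[OF f d2[of "f y", unfolded has_field_derivative_def]] .
  show "((\<lambda>y. \<kappa>' (f y) *\<^sub>R g y) has_derivative
          (\<lambda>v. (\<kappa>' (f y) *\<^sub>R Hs y + \<kappa>'' (f y) *\<^sub>R proj_mat (g y)) *v v)) (at y)"
    by (rule has_derivative_eq_rhs[OF has_derivative_scaleR[OF k' g]])
       (auto simp: fun_eq_iff matrix_vector_mult_add_rdistrib
        scaleR_matrix_vector_assoc[symmetric] proj_mat_mult_vec)
next
  have k'c: "continuous_on UNIV \<kappa>'"
    using d2 by (meson DERIV_isCont continuous_at_imp_continuous_on)
  show "continuous_on U (\<lambda>y. \<kappa>' (f y) *\<^sub>R Hs y + \<kappa>'' (f y) *\<^sub>R proj_mat (g y))"
    by (intro continuous_intros proj_mat_continuous C2on_grad_cont[OF C] C2on_Hess_cont[OF C]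
        continuous_on_compose2[OF k'c C2on_cont[OF C]] continuous_on_compose2[OF c2 C2on_cont[OF C]]) auto
qed (use C in \<open>auto simp: C2on_def\<close>)

lemma DERIV_pos_part_power:
  "((\<lambda>s::real. (max 0 s) ^ Suc (Suc n)) has_real_derivative real (Suc (Suc n)) * (max 0 s) ^ Suc n) (at s)"
proof -
  consider "s > 0" | "s < 0" | "s = 0" by linarith
  then show ?thesis
  proof cases
    case 1
    have "((\<lambda>s::real. s ^ Suc (Suc n)) has_real_derivative real (Suc (Suc n)) * s ^ Suc n) (at s)"
      using DERIV_pow[of "Suc (Suc n)" s] by simp
    moreover have "\<forall>\<^sub>F t in nhds s. t ^ Suc (Suc n) = (max 0 t) ^ Suc (Suc n)"
      using eventually_nhds_in_open[of "{0<..}" s] 1 by (auto elim!: eventually_mono)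
    ultimately show ?thesis using 1 by (auto simp: DERIV_cong_ev[OF refl _ refl])
  next
    case 2
    have "((\<lambda>s::real. 0) has_real_derivative 0) (at s)" by simp
    moreover have "\<forall>\<^sub>F t in nhds s. 0 = (max 0 t) ^ Suc (Suc n)"
      using eventually_nhds_in_open[of "{..<0}" s] 2 by (auto elim!: eventually_mono)
    ultimately show ?thesis using 2 DERIV_cong_ev[OF refl _ refl, of "\<lambda>s. 0" _ s 0] by simp
  next
    case 3
    have "((\<lambda>h::real. (max 0 h) ^ Suc (Suc n) / h) \<longlongrightarrow> 0) (at 0)"
    proof (rule Lim_null_comparison)
      show "((\<lambda>h::real. \<bar>h\<bar> ^ Suc n) \<longlongrightarrow> 0) (at 0)"
        by (rule tendsto_eq_intros refl | simp)+
      have "norm ((max 0 h) ^ Suc (Suc n) / h) \<le> \<bar>h\<bar> ^ Suc n" for h :: real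
      proof (cases "h > 0")
        case False
        then have "max 0 h = 0" by simp
        then show ?thesis by (simp del: power_Suc)
      qed (simp add: abs_mult)
      then show "\<forall>\<^sub>F h in at 0. norm ((max 0 h) ^ Suc (Suc n) / h) \<le> \<bar>h :: real\<bar> ^ Suc n" by simp
    qed
    then show ?thesis using 3 by (simp add: DERIV_def)
  qed
qed

text \<open>The third power makes the positive part twice continuously differentiable. The function
  is not normalised; the average is divided by its integral instead.\<close>

definition bump :: "real \<Rightarrow> real^'n \<Rightarrow> real" where
  "bump d y = (max 0 (d\<^sup>2 - (norm y)\<^sup>2)) ^ 3"

lemma bump_C2on: "\<exists>g Hs. C2on UNIV (bump d :: real^'n \<Rightarrow> real) g Hs"
proof -
  have C: "C2on UNIV (\<lambda>y::real^'n. (-1) * (norm (y - 0))\<^sup>2 + d\<^sup>2) (\<lambda>y. (-1) *\<^sub>R 2 *\<^sub>R (y - 0)) (\<lambda>y. (-1) *\<^sub>R 2 *\<^sub>R mat 1)"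
    by (intro C2on_add_const C2on_scale C2on_quad) simp
  have d1: "((\<lambda>s::real. (max 0 s) ^ 3) has_real_derivative 3 * (max 0 s)^2) (at s)" for s
    using DERIV_pos_part_power[of 1 s] by (simp add: eval_nat_numeral)
  have d2: "((\<lambda>s::real. 3 * (max 0 s) ^ 2) has_real_derivative 3 * (2 * (max 0 s))) (at s)" for s
    using DERIV_cmult[OF DERIV_pos_part_power[of 0 s], of 3] by (simp add: eval_nat_numeral)
  have "continuous_on UNIV (\<lambda>s::real. 3 * (2 * max 0 s))" by (intro continuous_intros)
  from C2on_compose[OF C d1 d2 this] show ?thesis
    unfolding bump_def[abs_def] by (auto simp: algebra_simps)
qed

lemma bump_nonneg: "0 \<le> bump d y"
  and bump_zero: "d > 0 \<Longrightarrow> d \<le> norm y \<Longrightarrow> bump d y = 0"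
  and bump_at_0: "d > 0 \<Longrightarrow> bump d 0 > 0"
  by (auto simp: bump_def power_mono max_def zero_power)

lemma convolution_has_derivative:
  fixes \<psi> :: "real^'n \<Rightarrow> real" and u :: "real^'n \<Rightarrow> real"
  assumes u: "continuous_on UNIV u"
    and d: "\<And>y. (\<psi> has_derivative (\<lambda>v. G y \<bullet> v)) (at y)" and G: "continuous_on UNIV G"
  shows "((\<lambda>x. integral (cbox a b) (\<lambda>z. u z * \<psi> (x - z))) has_derivative
          (\<lambda>v. integral (cbox a b) (\<lambda>z. u z *\<^sub>R G (x - z)) \<bullet> v)) (at x)"
proof -
  have p: "continuous_on UNIV \<psi>"
    using d by (meson continuous_at_imp_continuous_on has_derivative_continuous)
  have cG: "continuous_on S (\<lambda>z. u z *\<^sub>R G (x - z))" for x S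
    by (intro continuous_intros continuous_on_compose2[OF G] continuous_on_compose2[OF u]) auto
  have "((\<lambda>x. integral (cbox a b) (\<lambda>z. u z * \<psi> (x - z))) has_derivative
      blinfun_apply (integral (cbox a b) (\<lambda>z. u z *\<^sub>R blinfun_inner_left (G (x - z))))) (at x within UNIV)"
  proof (rule leibniz_rule)
    fix x z :: "real^'n"
    have t: "((\<lambda>x. x - z) has_derivative (\<lambda>v. v)) (at x)" by (auto intro!: derivative_eq_intros)
    have "((\<lambda>x. u z * \<psi> (x - z)) has_derivative (\<lambda>v. u z * (G (x - z) \<bullet> v))) (at x)"
      by (intro has_derivative_mult_right has_derivative_compose[OF t d])
    moreover have "blinfun_apply (u z *\<^sub>R blinfun_inner_left (G (x - z))) = (\<lambda>v. u z * (G (x - z) \<bullet> v))"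
      by (auto simp: fun_eq_iff scaleR_blinfun.rep_eq inner_commute)
    ultimately show "((\<lambda>x. u z * \<psi> (x - z)) has_derivative
        blinfun_apply (u z *\<^sub>R blinfun_inner_left (G (x - z)))) (at x within UNIV)" by simp
  next
    fix x :: "real^'n"
    show "(\<lambda>z. u z * \<psi> (x - z)) integrable_on cbox a b"
      by (intro integrable_continuous continuous_intros continuous_on_compose2[OF p]
          continuous_on_compose2[OF u]) auto
  next
    show "continuous_on (UNIV \<times> cbox a b) (\<lambda>(x, z). u z *\<^sub>R blinfun_inner_left (G (x - z)))"
      unfolding split_beta
      by (intro continuous_intros continuous_on_compose2[OF G] continuous_on_compose2[OF u]
          bounded_linear.continuous_on[OF bounded_linear_blinfun_inner_left]) auto
  qed auto
  moreover have "integral (cbox a b) (\<lambda>z. u z *\<^sub>R blinfun_inner_left (G (x - z)))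
      = blinfun_inner_left (integral (cbox a b) (\<lambda>z. u z *\<^sub>R G (x - z)))"
    using integral_linear[OF integrable_continuous[OF cG, of x a b] bounded_linear_blinfun_inner_left]
    by (simp add: o_def linear_scale[OF bounded_linear.linear[OF bounded_linear_blinfun_inner_left]])
  ultimately show ?thesis by (simp add: inner_commute)
qed

text \<open>All derivatives fall on the kernel, so \<open>u\<close> need only be continuous. The
  Hessian is assembled row by row from the first-order statement for the components of the
  gradient.\<close>

lemma convolution_C2on:
  fixes \<psi> :: "real^'n \<Rightarrow> real" and u :: "real^'n \<Rightarrow> real"
  assumes u: "continuous_on UNIV u" and C: "C2on UNIV \<psi> G Hs"
  shows "\<exists>g H. C2on UNIV (\<lambda>x. integral (cbox a b) (\<lambda>z. u z * \<psi> (x - z))) g H"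
proof -
  have G: "continuous_on UNIV G" by (rule C2on_grad_cont[OF C])
  define g where "g = (\<lambda>x. integral (cbox a b) (\<lambda>z. u z *\<^sub>R G (x - z)))"
  define H where "H = (\<lambda>x. \<chi> i. integral (cbox a b) (\<lambda>z. u z *\<^sub>R (Hs (x - z) $ i)))"
  have cH: "continuous_on UNIV (\<lambda>y. Hs y $ i)" for i
    by (intro continuous_intros C2on_Hess_cont[OF C])
  have gi: "g x $ i = integral (cbox a b) (\<lambda>z. u z * (G (x - z) $ i))" for x i
  proof -
    have "(\<lambda>z. u z *\<^sub>R G (x - z)) integrable_on cbox a b"
      by (intro integrable_continuous continuous_intros continuous_on_compose2[OF G]
          continuous_on_compose2[OF u]) auto
    from integral_linear[OF this bounded_linear_vec_nth[of i]] show ?thesis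
      by (simp add: g_def o_def)
  qed
  have dGi: "((\<lambda>y. G y $ i) has_derivative (\<lambda>v. (Hs y $ i) \<bullet> v)) (at y)" for y i
    using bounded_linear.has_derivative[OF bounded_linear_vec_nth[of i] C2on_Hess[OF C, of y]]
    by (simp add: matrix_vector_mul_component)
  have "C2on UNIV (\<lambda>x. integral (cbox a b) (\<lambda>z. u z * \<psi> (x - z))) g H"
    unfolding C2on_def
  proof (intro conjI ballI)
    fix x
    show "((\<lambda>x. integral (cbox a b) (\<lambda>z. u z * \<psi> (x - z))) has_derivative (\<lambda>v. g x \<bullet> v)) (at x)"
      unfolding g_def by (rule convolution_has_derivative[OF u C2on_grad[OF C] G]) simp
    show "(g has_derivative (\<lambda>v. H x *v v)) (at x)"
    proof (rule has_derivative_vec_nthI)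
      fix i
      show "((\<lambda>x. g x $ i) has_derivative (\<lambda>v. (H x *v v) $ i)) (at x)"
        using convolution_has_derivative[OF u dGi cH, of a b i x]
        by (simp add: gi matrix_vector_mul_component H_def)
    qed
  next
    have "continuous_on UNIV (\<lambda>x. integral (cbox a b) (\<lambda>z. u z *\<^sub>R (Hs (x - z) $ i)))" for i
    proof (rule integral_continuous_on_param)
      show "continuous_on (UNIV \<times> cbox a b) (\<lambda>(x, z). u z *\<^sub>R (Hs (x - z) $ i))"
        unfolding split_beta
        by (intro continuous_intros continuous_on_compose2[OF u]
            continuous_on_compose2[OF C2on_Hess_cont[OF C]]) auto
    qed
    then show "continuous_on UNIV H" unfolding H_def by (intro continuous_on_vec_lambda)
  qed simp
  then show ?thesis by blast
qed

text \<open>Uniform continuity on the compact product lets one tagged division serve all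
  \<open>x\<close> in \<open>K\<close>. The weights are nonnegative, so the sums remain in a convex
  cone of functions of \<open>x\<close>.\<close>

lemma uniform_Riemann_sum:
  fixes f :: "'a::metric_space \<Rightarrow> 'b::euclidean_space \<Rightarrow> real"
  assumes K: "compact K" and f: "continuous_on (K \<times> cbox a b) (\<lambda>(x, y). f x y)" and e: "e > 0"
  shows "\<exists>I t c. finite (I :: ('b \<times> 'b set) set) \<and> (\<forall>i\<in>I. t i \<in> cbox a b \<and> 0 \<le> c i)
           \<and> (\<forall>x\<in>K. \<bar>integral (cbox a b) (f x) - (\<Sum>i\<in>I. c i * f x (t i))\<bar> \<le> e)"
proof -
  \<comment> \<open>The summand 1 avoids division by zero for a box of measure zero.\<close>
  define e' where "e' = e / (measure lborel (cbox a b) + 1)"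
  have e': "e' > 0" "e' * measure lborel (cbox a b) \<le> e"
  proof -
    have c: "measure lborel (cbox a b) + 1 > 0" by (simp add: add_nonneg_pos)
    then show e': "e' > 0" unfolding e'_def using e by simp
    have "e' * measure lborel (cbox a b) \<le> e' * (measure lborel (cbox a b) + 1)" using e' by simp
    also have "\<dots> = e" unfolding e'_def using c by simp
    finally show "e' * measure lborel (cbox a b) \<le> e" .
  qed
  have "uniformly_continuous_on (K \<times> cbox a b) (\<lambda>(x, y). f x y)"
    by (intro compact_uniformly_continuous f compact_Times K compact_cbox)
  then obtain \<delta> where \<delta>: "\<delta> > 0" "\<And>p q. p \<in> K \<times> cbox a b \<Longrightarrow> q \<in> K \<times> cbox a b \<Longrightarrow> dist q p < \<delta>
      \<Longrightarrow> dist ((\<lambda>(x, y). f x y) q) ((\<lambda>(x, y). f x y) p) < e'"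
    using e'(1) unfolding uniformly_continuous_on_def by blast
  obtain p where p: "p tagged_division_of cbox a b" "(\<lambda>x. ball x \<delta>) fine p"
    using fine_division_exists[OF gauge_ball[OF \<delta>(1)]] by blast
  note pD = tagged_division_ofD[OF p(1)]
  show ?thesis
  proof (intro exI conjI ballI)
    show "finite p" by (rule pD)
    show "fst i \<in> cbox a b" "0 \<le> measure lborel (snd i)" if "i \<in> p" for i
      using pD(2,3)[of "fst i" "snd i"] that by auto
    fix x assume x: "x \<in> K"
    have cf: "continuous_on (cbox a b) (f x)"
      using continuous_on_compose2[OF f continuous_on_Pair[OF continuous_on_const continuous_on_id],
          of x "cbox a b"] x by (simp add: image_subset_iff)
    have loc: "\<bar>integral k (f x) - measure lborel k * f x t\<bar> \<le> e' * measure lborel k" if tk: "(t, k) \<in> p" for t k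
    proof -
      obtain c d where k: "k = cbox c d" using pD(4)[OF tk] by blast
      have ksub: "k \<subseteq> cbox a b" "t \<in> k" using pD(2,3)[OF tk] by auto
      have kball: "k \<subseteq> ball t \<delta>" using p(2) tk by (auto simp: fine_def)
      have "(f x has_integral integral k (f x)) (cbox c d)"
        unfolding k using cf ksub(1) k
        by (intro integrable_integral integrable_continuous) (auto intro: continuous_on_subset)
      then have "((\<lambda>y. f x y - f x t) has_integral (integral k (f x) - measure lborel k *\<^sub>R f x t)) (cbox c d)"
        unfolding k by (intro has_integral_diff has_integral_const)
      then have "norm (integral k (f x) - measure lborel k *\<^sub>R f x t) \<le> e' * measure lborel (cbox c d)"
      proof (rule has_integral_bound[rotated])
        show "norm (f x y - f x t) \<le> e'" if "y \<in> cbox c d" for y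
        proof -
          have "y \<in> cbox a b" "t \<in> cbox a b" "dist (x, y) (x, t) < \<delta>"
            using that ksub k kball by (auto simp: dist_Pair_Pair dist_commute)
          then show ?thesis using \<delta>(2)[of "(x, t)" "(x, y)"] x by (simp add: dist_real_def)
        qed
      qed (use e' in simp)
      then show ?thesis by (simp add: k)
    qed
    have "integral (cbox a b) (f x) = (\<Sum>(t, k)\<in>p. integral k (f x))"
      by (rule integral_combine_tagged_division_topdown[OF integrable_continuous[OF cf] p(1)])
    then have "\<bar>integral (cbox a b) (f x) - (\<Sum>i\<in>p. measure lborel (snd i) * f x (fst i))\<bar>
        = \<bar>\<Sum>i\<in>p. integral (snd i) (f x) - measure lborel (snd i) * f x (fst i)\<bar>"
      by (simp add: sum_subtractf split_beta)
    also have "\<dots> \<le> (\<Sum>i\<in>p. e' * measure lborel (snd i))"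
      by (rule order_trans[OF sum_abs sum_mono]) (use loc in auto)
    also have "\<dots> = e' * measure lborel (cbox a b)"
      using additive_content_tagged_division[OF p(1)] by (simp add: sum_distrib_left[symmetric] split_beta)
    also have "\<dots> \<le> e" by (rule e')
    finally show "\<bar>integral (cbox a b) (f x) - (\<Sum>i\<in>p. measure lborel (snd i) * f x (fst i))\<bar> \<le> e" .
  qed
qed

section \<open>Smooth approximation and comparison\<close>

lemma C2on_cong:
  assumes C: "C2on U f g Hs" and eq: "\<And>x. x \<in> U \<Longrightarrow> f x = f' x"
  shows "C2on U f' g Hs"
  unfolding C2on_def
proof (intro conjI ballI)
  fix y assume y: "y \<in> U"
  show "(f' has_derivative (\<lambda>v. g y \<bullet> v)) (at y)"
    using has_derivative_transform_within_open[OF C2on_grad[OF C y] C2on_open[OF C] y eq] .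
qed (use C in \<open>auto simp: C2on_def\<close>)

lemma frontier_open: "open D \<Longrightarrow> frontier D = closure D - D"
  by (simp add: frontier_def interior_open)

lemma inner_proj_mat: "E \<bullet> proj_mat x = x \<bullet> (E *v x)"
  by (simp add: proj_mat_def inner_vec_def matrix_vector_mult_def sum_distrib_left algebra_simps)

lemma norm_proj_mat: "norm (proj_mat x) = (norm x)\<^sup>2"
proof -
  have "(norm (proj_mat x))\<^sup>2 = ((norm x)\<^sup>2)\<^sup>2"
    unfolding power2_norm_eq_inner inner_proj_mat by (simp add: proj_mat_mult_vec power2_eq_square)
  then show ?thesis by (rule power2_eq_imp_eq) auto
qed

context convex_subeq begin

text \<open>The average \<open>W\<close> is a limit of Riemann sums, which are nonnegative
  combinations of translates of \<open>u\<close>, hence a subsolution. After a change of variables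
  the kernel carries the dependence on \<open>x\<close>, so it is also twice differentiable.\<close>

lemma smooth_approximation:
  assumes X: "open X" and u: "continuous_on X u" "\<And>y. y \<in> X \<Longrightarrow> vsub_at F u y"
    and K: "compact K" "K \<subseteq> X" and e: "e > 0"
  shows "\<exists>V w g Hs. C2on V w g Hs \<and> K \<subseteq> V \<and> (\<forall>y\<in>V. Hs y \<in> F \<and> \<bar>w y - u y\<bar> \<le> e)"
proof -
  obtain \<rho> where \<rho>: "\<rho> > 0" "(\<Union>x\<in>K. ball x \<rho>) \<subseteq> X"
    using compact_subset_open_imp_ball_epsilon_subset[OF K(1) X K(2)] by blast
  define r where "r = \<rho> / 4"
  have r: "r > 0" "3 * r < \<rho>" using \<rho>(1) by (auto simp: r_def)
  \<comment> \<open>Three nested neighbourhoods: the approximant lives on \<open>V\<close>,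
    translates by less than \<open>r\<close> stay in \<open>V2\<close>, and the compact
    \<open>K2\<close> provides uniform continuity inside \<open>X\<close>.\<close>
  define V where "V = (\<Union>x\<in>K. ball x r)"
  define V2 where "V2 = (\<Union>x\<in>K. ball x (2 * r))"
  define K2 where "K2 = {x + y | x y. x \<in> K \<and> y \<in> cball 0 (3 * r)}"
  have oV: "open V" "open V2" by (auto simp: V_def V2_def)
  have KV: "K \<subseteq> V" using r by (auto simp: V_def)
  have V2K2: "V2 \<subseteq> K2"
  proof
    fix y assume "y \<in> V2"
    then obtain x where "x \<in> K" "dist x y < 2 * r" by (auto simp: V2_def)
    then show "y \<in> K2" unfolding K2_def mem_Collect_eq using r
      by (intro exI[of _ x] exI[of _ "y - x"]) (auto simp: dist_norm norm_minus_commute)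
  qed
  have VV2: "V \<subseteq> V2" using r by (force simp: V_def V2_def)
  have K2X: "K2 \<subseteq> X"
  proof
    fix y assume "y \<in> K2"
    then obtain x z where "x \<in> K" "y = x + z" "norm z \<le> 3 * r" by (auto simp: K2_def)
    then have "y \<in> ball x \<rho>" using r by (auto simp: dist_norm)
    then show "y \<in> X" using \<rho>(2) \<open>x \<in> K\<close> by blast
  qed
  have cK2: "compact K2" unfolding K2_def by (intro compact_sums K compact_cball)
  \<comment> \<open>The extension makes all integrands continuous on the whole space; for points of
    \<open>V\<close> the bump only sees values on \<open>K2\<close>.\<close>
  obtain u' where u': "continuous_on UNIV u'" "\<And>x. x \<in> K2 \<Longrightarrow> u' x = u x"
  proof (rule Tietze_unbounded)
    show "continuous_on K2 u" using u(1) K2X continuous_on_subset by blast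
    show "closedin (top_of_set UNIV) K2" using cK2 compact_imp_closed by simp
  qed auto
  have "uniformly_continuous_on K2 u'"
    by (intro compact_uniformly_continuous cK2 continuous_on_subset[OF u'(1)]) auto
  then obtain \<delta> where \<delta>: "\<delta> > 0" "\<And>x y. x \<in> K2 \<Longrightarrow> y \<in> K2 \<Longrightarrow> dist y x < \<delta> \<Longrightarrow> dist (u' y) (u' x) < e"
    using e unfolding uniformly_continuous_on_def by blast
  define d where "d = min r \<delta>"
  have d: "d > 0" "d \<le> r" "d \<le> \<delta>" using r \<delta> by (auto simp: d_def)
  have shift: "x - y \<in> V2" if "x \<in> V" "norm y < d" for x y
  proof -
    obtain z where z: "z \<in> K" "dist z x < r" using \<open>x \<in> V\<close> by (auto simp: V_def)
    have "dist z (x - y) \<le> dist z x + dist x (x - y)" by (rule dist_triangle)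
    also have "\<dots> < r + r" using z that d by (intro add_strict_mono) (auto simp: dist_norm)
    finally show ?thesis using z by (auto simp: V2_def)
  qed
  define b :: "real^'n" where "b = d *\<^sub>R One"
  have ballb: "ball 0 d \<subseteq> cbox (- b) b"
  proof
    fix y :: "real^'n" assume "y \<in> ball 0 d"
    then have "norm y < d" by simp
    then have "\<bar>y \<bullet> i\<bar> < d" if "i \<in> Basis" for i using Basis_le_norm[OF that, of y] by linarith
    then have "- d < y \<bullet> i" "y \<bullet> i < d" if "i \<in> Basis" for i using that by (simp_all add: abs_less_iff minus_less_iff)
    then show "y \<in> cbox (- b) b" unfolding mem_box b_def by (auto simp: less_imp_le)
  qed
  have bc: "continuous_on S (bump d)" for S :: "(real^'n) set"
    using bump_C2on[of d] C2on_cont continuous_on_subset by blast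
  define f where "f = (\<lambda>x y. bump d y * u' (x - y))"
  have fc: "continuous_on S (f x)" for x S
    unfolding f_def by (intro continuous_intros bc continuous_on_compose2[OF u'(1)]) auto
  have fz: "f x y = 0" if "y \<notin> ball 0 d" for x y
    using that bump_zero[OF d(1), of y] by (simp add: f_def)
  define c where "c = integral (cbox (- b) b) (bump d)"
  have hc: "(bump d has_integral c) (cbox (- b) b)"
    unfolding c_def by (intro integrable_integral integrable_continuous bc)
  have c: "c > 0"
  proof -
    have "c \<ge> 0" using has_integral_nonneg[OF hc] bump_nonneg by blast
    moreover have "c \<noteq> 0"
    proof
      assume "c = 0"
      then have "bump d (0 :: real^'n) = 0"
        using hc has_integral_0_cbox_imp_0[of "- b" b "bump d" 0] bc bump_nonneg d(1)
        by (auto simp: b_def mem_box box_ne_empty)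
      moreover have "bump d (0 :: real^'n) > 0" by (rule bump_at_0[OF d(1)])
      ultimately show False by simp
    qed
    ultimately show ?thesis by simp
  qed
  define W where "W = (\<lambda>x. integral (cbox (- b) b) (f x))"
  have hW: "(f x has_integral W x) (cbox (- b) b)" for x
    unfolding W_def by (intro integrable_integral integrable_continuous fc)
  have vW: "vsub_at F W x" if xV: "x \<in> V" for x
  proof (rule vsub_at_limit[OF closed_F oV(1) xV])
    fix \<epsilon> :: real assume "\<epsilon> > 0"
    have "continuous_on (K2 \<times> cbox (- b) b) (\<lambda>(x, y). f x y)"
      unfolding f_def split_beta
      by (intro continuous_intros continuous_on_compose2[OF bc[of UNIV]] continuous_on_compose2[OF u'(1)]) auto
    from uniform_Riemann_sum[OF cK2 this \<open>\<epsilon> > 0\<close>]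
    obtain I :: "((real^'n) \<times> (real^'n) set) set" and t k where I: "finite I" "\<And>i. i \<in> I \<Longrightarrow> 0 \<le> k i"
      "\<And>x. x \<in> K2 \<Longrightarrow> \<bar>W x - (\<Sum>i\<in>I. k i * f x (t i))\<bar> \<le> \<epsilon>"
      unfolding W_def by blast
    \<comment> \<open>Terms with a tag outside the support of the bump vanish. The remaining shifts
      stay in \<open>V2\<close>, where \<open>u'\<close> agrees with \<open>u\<close>.\<close>
    define J where "J = {i \<in> I. norm (t i) < d}"
    define S where "S = (\<lambda>x. \<Sum>i\<in>J. (k i * bump d (t i)) * u' (x - t i))"
    have S: "S x = (\<Sum>i\<in>I. k i * f x (t i))" for x
    proof -
      have "(\<Sum>i\<in>J. k i * f x (t i)) = (\<Sum>i\<in>I. k i * f x (t i))"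
        using fz by (intro sum.mono_neutral_left I(1)) (auto simp: J_def)
      then show ?thesis by (simp add: S_def f_def mult.assoc)
    qed
    have cu: "continuous_on V (\<lambda>x. (k i * bump d (t i)) * u' (x - t i))" for i
      by (intro continuous_intros continuous_on_compose2[OF u'(1)]) auto
    have vu: "vsub_at F (\<lambda>x. (k i * bump d (t i)) * u' (x - t i)) y" if i: "i \<in> J" and y: "y \<in> V" for i y
    proof (rule vsub_scale)
      have y2: "y - t i \<in> V2" using shift[OF y] i by (auto simp: J_def)
      have "\<forall>\<^sub>F z in nhds (y - t i). u' z = u z"
        using eventually_nhds_in_open[OF oV(2) y2] by eventually_elim (use V2K2 u'(2) in auto)
      moreover have "vsub_at F u (y - t i)" using y2 V2K2 K2X u(2) by blast
      ultimately have "vsub_at F u' (y + - t i)" by (simp add: vsub_at_cong)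
      from vsub_at_translate[OF this] show "vsub_at F (\<lambda>x. u' (x - t i)) y" by simp
      show "0 \<le> k i * bump d (t i)" using i
        by (intro mult_nonneg_nonneg I(2) bump_nonneg) (simp add: J_def)
    qed
    have cS: "continuous_on V S"
      unfolding S_def by (intro continuous_on_sum cu)
    have "finite J" using I(1) by (simp add: J_def)
    have vS: "vsub_at F S y" if y: "y \<in> V" for y
      unfolding S_def by (rule vsub_sum[OF \<open>finite J\<close> oV(1) y]) (use cu vu in blast)
    have "\<bar>W y - S y\<bar> \<le> \<epsilon>" if "y \<in> V" for y
      unfolding S using I(3) VV2 V2K2 that by blast
    then have "W x - \<epsilon> \<le> S x" "\<forall>y\<in>V. S y \<le> W y + \<epsilon>"
      using xV by (auto simp: abs_le_iff algebra_simps)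
    then show "\<exists>u'. continuous_on V u' \<and> (\<forall>y\<in>V. vsub_at F u' y) \<and> W x - \<epsilon> \<le> u' x \<and> (\<forall>y\<in>V. u' y \<le> W y + \<epsilon>)"
      using cS vS by blast
  qed
  obtain A :: "real^'n" where A: "K2 \<subseteq> cbox (- A) A"
    using bounded_subset_cbox_symmetric[OF compact_imp_bounded[OF cK2]] by blast
  \<comment> \<open>The substitution \<open>z = x - y\<close> turns \<open>W\<close> into a
    convolution whose kernel can be differentiated; the box is large enough to contain
    \<open>K2\<close>.\<close>
  define Z where "Z = (\<lambda>x. integral (cbox (- A) A) (\<lambda>z. u' z * bump d (x - z)))"
  have WZ: "Z x = W x" if x: "x \<in> V" for x
  proof -
    have "((\<lambda>z. u' z * bump d (x - z)) has_integral Z x) (cbox (- A) A)"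
      unfolding Z_def
      by (intro integrable_integral integrable_continuous continuous_intros continuous_on_compose2[OF u'(1)]
          continuous_on_compose2[OF bc[of UNIV]]) auto
    from has_integral_affinity[OF this, of "-1" x]
    have h: "(f x has_integral Z x) ((\<lambda>y. x - y) ` cbox (- A) A)"
      by (simp add: f_def mult.commute)
    have "y \<in> (\<lambda>y. x - y) ` cbox (- A) A" if "y \<in> ball 0 d" for y
    proof (rule image_eqI)
      show "x - y \<in> cbox (- A) A" using shift[OF x, of y] that V2K2 A by auto
    qed simp
    then have "(\<lambda>y. if y \<in> (\<lambda>y. x - y) ` cbox (- A) A then f x y else 0) = f x"
      using fz by (auto simp: fun_eq_iff)
    then have "(f x has_integral Z x) UNIV"
      using has_integral_restrict_UNIV[of "(\<lambda>y. x - y) ` cbox (- A) A" "f x" "Z x"] h by simp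
    moreover have "(\<lambda>y. if y \<in> cbox (- b) b then f x y else 0) = f x"
      using fz[of _ x] ballb by (intro ext) (metis in_mono)
    then have "(f x has_integral W x) UNIV"
      using has_integral_restrict_UNIV[of "cbox (- b) b" "f x" "W x"] hW by simp
    ultimately show ?thesis by (rule has_integral_unique)
  qed
  obtain g0 H0 where "C2on UNIV (bump d :: real^'n \<Rightarrow> real) g0 H0" using bump_C2on by blast
  from convolution_C2on[OF u'(1) this, of "- A" A]
  obtain g Hs where "C2on UNIV Z g Hs" unfolding Z_def by blast
  from C2on_scale[OF C2on_subset[OF this oV(1) subset_UNIV], of "1 / c"]
  have C: "C2on V (\<lambda>x. (1 / c) * W x) (\<lambda>x. (1 / c) *\<^sub>R g x) (\<lambda>x. (1 / c) *\<^sub>R Hs x)"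
    by (rule C2on_cong) (use WZ in simp)
  have "(1 / c) *\<^sub>R Hs x \<in> F" if x: "x \<in> V" for x
  proof -
    have "vsub_at F (\<lambda>x. (1 / c) * W x) x" using vsub_scale[OF vW[OF x], of "1 / c"] c by simp
    \<comment> \<open>A twice differentiable subsolution is its own test function.\<close>
    from vsub_atD[OF this C x] show ?thesis by simp
  qed
  moreover have "\<bar>(1 / c) * W x - u x\<bar> \<le> e" if x: "x \<in> V" for x
  proof -
    have xK: "x \<in> K2" using x VV2 V2K2 by blast
    have near: "\<bar>u' (x - y) - u' x\<bar> \<le> e" if "norm y < d" for y
    proof -
      have "x - y \<in> K2" using shift[OF x that] V2K2 by blast
      moreover have "dist (x - y) x < \<delta>" using that d by (simp add: dist_norm)
      ultimately show ?thesis using \<delta>(2)[OF xK] by (simp add: dist_real_def less_imp_le)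
    qed
    have pt: "bump d y * (u' x - e) \<le> f x y \<and> f x y \<le> bump d y * (u' x + e)" for y
    proof (cases "norm y < d")
      case True
      then show ?thesis using near[OF True] bump_nonneg[of d y]
        by (auto simp: f_def abs_le_iff intro!: mult_left_mono)
    qed (use fz bump_zero[OF d(1), of y] in auto)
    have "c * (u' x - e) \<le> W x"
      by (rule has_integral_le[OF has_integral_mult_left[OF hc] hW]) (use pt in blast)
    moreover have "W x \<le> c * (u' x + e)"
      by (rule has_integral_le[OF hW has_integral_mult_left[OF hc]]) (use pt in blast)
    ultimately have "u' x - e \<le> (1 / c) * W x" "(1 / c) * W x \<le> u' x + e"
      using c by (simp_all add: field_simps)
    then show ?thesis using u'(2)[OF xK] by (simp add: abs_le_iff)
  qed
  ultimately show ?thesis using C KV by blast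
qed

text \<open>A symmetric perturbation \<open>E\<close> with Frobenius norm less than \<epsilon>
  satisfies \<open>\<bar>x \<bullet> (E *v x)\<bar> \<le> \<epsilon> * (norm x)\<^sup>2\<close>, so
  it cannot outweigh \<open>\<epsilon> *\<^sub>R mat 1\<close>.\<close>

lemma add_id_interior:
  assumes A: "A \<in> F" and e: "\<epsilon> > 0"
  shows "A + \<epsilon> *\<^sub>R mat 1 \<in> sym_interior F"
proof -
  have psd1: "psd (\<epsilon> *\<^sub>R mat 1 :: real^'n^'n)"
    using e by (simp add: psd_def transpose_scalar scaleR_matrix_vector_assoc[symmetric])
  have "B \<in> F" if B: "B \<in> sym_mats" "dist B (A + \<epsilon> *\<^sub>R mat 1) < \<epsilon>" for B
  proof -
    define E where "E = B - (A + \<epsilon> *\<^sub>R mat 1)"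
    have "0 \<le> x \<bullet> ((B - A) *v x)" for x
    proof -
      have "\<bar>x \<bullet> (E *v x)\<bar> \<le> norm E * (norm x)\<^sup>2"
        using Cauchy_Schwarz_ineq2[of E "proj_mat x"] by (simp add: inner_proj_mat norm_proj_mat)
      also have "\<dots> \<le> \<epsilon> * (norm x)\<^sup>2"
        using B(2) by (intro mult_right_mono) (auto simp: E_def dist_norm)
      finally have "- (\<epsilon> * (norm x)\<^sup>2) \<le> x \<bullet> (E *v x)" by linarith
      moreover have "B - A = E + \<epsilon> *\<^sub>R mat 1" by (simp add: E_def)
      then have "x \<bullet> ((B - A) *v x) = x \<bullet> (E *v x) + \<epsilon> * (norm x)\<^sup>2"
        by (simp add: matrix_vector_mult_add_rdistrib scaleR_matrix_vector_assoc[symmetric]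
            inner_add_right power2_norm_eq_inner)
      ultimately show ?thesis by linarith
    qed
    moreover have "transpose (B - A) = B - A"
      using B(1) A sym_F by (auto simp: sym_mats_def transpose_def vec_eq_iff)
    ultimately have "psd (B - A)" by (simp add: psd_def)
    from add_psd[OF A this] show ?thesis by simp
  qed
  then show ?thesis using add_psd[OF A psd1] e unfolding sym_interior_def by blast
qed

text \<open>The set where \<open>u - v\<close> is at least half of its supposed excess
  \<open>M\<close> is compact in \<open>D\<close>, since \<open>u \<le> v\<close> on the frontier.
  Near it \<open>u\<close> is replaced by a smooth \<open>w\<close> with Hessians in
  \<open>F\<close>; then \<open>- w\<close> plus a constant is a supersolution for the dual, to
  which \<open>C2_comparison\<close> applies.\<close>

lemma comparison:
  assumes D: "open D" "bounded D"
    and u: "continuous_on (closure D) u" "\<And>x. x \<in> D \<Longrightarrow> vsub_at F u x"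
    and v: "continuous_on (closure D) v" "\<And>x. x \<in> D \<Longrightarrow> vsub_at (dual_subeq F) (\<lambda>y. - v y) x"
    and bd: "\<And>x. x \<in> frontier D \<Longrightarrow> u x \<le> v x"
    and x: "x \<in> closure D"
  shows "u x \<le> v x"
proof (rule ccontr)
  assume contra: "\<not> ?thesis"
  define M where "M = u x - v x"
  have M: "M > 0" using contra by (simp add: M_def)
  have xD: "x \<in> D" using bd[of x] x M by (force simp: frontier_open[OF D(1)] M_def)
  define D' where "D' = {y \<in> D. M / 2 < u y - v y}"
  define K where "K = {y \<in> closure D. M / 2 \<le> u y - v y}"
  have cuv: "continuous_on (closure D) (\<lambda>y. u y - v y)" by (intro continuous_intros u v)
  have oD': "open D'"
  proof -
    have "D' = D \<inter> (\<lambda>y. u y - v y) -` {M / 2 <..}" by (auto simp: D'_def)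
    moreover have "continuous_on D (\<lambda>y. u y - v y)"
      using cuv closure_subset continuous_on_subset by blast
    ultimately show ?thesis using continuous_open_preimage[OF _ D(1) open_greaterThan] by simp
  qed
  have K: "compact K"
  proof -
    have "K = closure D \<inter> (\<lambda>y. u y - v y) -` {M / 2 ..}" by (auto simp: K_def)
    moreover have "closed (closure D \<inter> (\<lambda>y. u y - v y) -` {M / 2 ..})"
      by (intro continuous_closed_preimage cuv) auto
    moreover have "bounded K" using D(2) bounded_subset[of "closure D" K] by (auto simp: K_def)
    ultimately show ?thesis by (simp add: compact_eq_bounded_closed)
  qed
  have KD: "K \<subseteq> D" using bd M by (force simp: K_def frontier_open[OF D(1)])
  have "D' \<subseteq> K" using closure_subset[of D] by (auto simp: D'_def K_def)
  then have clK: "closure D' \<subseteq> K" using K compact_imp_closed closure_minimal by blast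
  have frD': "u y - v y \<le> M / 2" if "y \<in> frontier D'" for y
  proof -
    have "y \<in> closure D'" "y \<notin> D'" using that by (auto simp: frontier_open[OF oD'])
    then have "y \<in> D" using clK KD by blast
    then show ?thesis using \<open>y \<notin> D'\<close> by (simp add: D'_def)
  qed
  have "x \<in> D'" using xD M by (simp add: D'_def M_def)
  then have xD': "x \<in> closure D'" using closure_subset by blast
  have cu: "continuous_on D u" using u(1) closure_subset continuous_on_subset by blast
  obtain V w g Hs where w: "C2on V w g Hs" "K \<subseteq> V" "\<And>y. y \<in> V \<Longrightarrow> Hs y \<in> F"
      "\<And>y. y \<in> V \<Longrightarrow> \<bar>w y - u y\<bar> \<le> M / 8"
    using smooth_approximation[OF D(1) cu u(2) K KD, of "M / 8"] M by auto
  have C: "C2on D' (\<lambda>y. (-1) * w y + 5 * M / 8) (\<lambda>y. (-1) *\<^sub>R g y) (\<lambda>y. (-1) *\<^sub>R Hs y)"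
    using \<open>D' \<subseteq> K\<close> w(2) by (intro C2on_add_const C2on_scale C2on_subset[OF w(1) oD']) auto
  \<comment> \<open>On the frontier \<open>u - v\<close> contributes at most \<open>M / 2\<close>
    and the approximation \<open>M / 8\<close>, together \<open>5 * M / 8\<close>. Returning from
    \<open>w\<close> to \<open>u\<close> at \<open>x\<close> costs another \<open>M / 8\<close>,
    still less than \<open>M\<close>.\<close>
  have "- v x \<le> (-1) * w x + 5 * M / 8"
  proof (rule C2_comparison[OF oD' _ _ _ _ C])
    show "bounded D'" using D(2) by (rule bounded_subset) (auto simp: D'_def)
    show "continuous_on (closure D') (\<lambda>y. - v y)"
      using clK by (intro continuous_intros continuous_on_subset[OF v(1)]) (auto simp: K_def)
    show "vsub_at (dual_subeq F) (\<lambda>y. - v y) y" if "y \<in> D'" for y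
      using v(2) that by (auto simp: D'_def)
    show "continuous_on (closure D') (\<lambda>y. (-1) * w y + 5 * M / 8)"
      using clK w(2) by (intro continuous_intros continuous_on_subset[OF C2on_cont[OF w(1)]]) auto
    show "(-1) *\<^sub>R Hs y - \<epsilon> *\<^sub>R mat 1 \<notin> dual_subeq F" if "y \<in> D'" "\<epsilon> > 0" for y \<epsilon>
    proof -
      have "Hs y \<in> F" using that(1) \<open>D' \<subseteq> K\<close> w(2,3) by blast
      from add_id_interior[OF this that(2)] show ?thesis by (simp add: dual_subeq_def add.commute)
    qed
    show "- v y \<le> (-1) * w y + 5 * M / 8" if "y \<in> frontier D'" for y
    proof -
      have "y \<in> V" using that clK w(2) by (auto simp: frontier_open[OF oD'])
      from w(4)[OF this] frD'[OF that] show ?thesis by linarith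
    qed
  qed (use xD' in auto)
  moreover have "\<bar>w x - u x\<bar> \<le> M / 8" using xD' clK w(2,4) by blast
  ultimately have "M \<le> 6 * M / 8" using M_def by linarith
  then show False using M by simp
qed

text \<open>By the cone property no negative multiple of the identity is in \<open>F\<close>, so
  constants qualify as the smooth upper function.\<close>

lemma vsub_max_principle:
  assumes D: "open D" "bounded D"
    and u: "continuous_on (closure D) u" "\<And>x. x \<in> D \<Longrightarrow> vsub_at F u x"
    and bd: "\<And>x. x \<in> frontier D \<Longrightarrow> u x \<le> c"
    and x: "x \<in> closure D"
  shows "u x \<le> c"
proof (rule C2_comparison[OF D u _ C2on_const[OF D(1)] _ bd x])
  show "0 - \<epsilon> *\<^sub>R mat 1 \<notin> F" if "\<epsilon> > 0" for \<epsilon>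
    using scaleR_mem[of "0 - \<epsilon> *\<^sub>R mat 1" "1 / \<epsilon>"] neg_id that by auto
qed (use u in auto)

end

section \<open>Perron's method\<close>

context convex_subeq begin

text \<open>Competitors are continuous up to the frontier, so that \<open>comparison\<close> and
  \<open>vsub_add\<close> apply to them directly. What has to be proved in return is that their
  supremum is continuous.\<close>

definition perron_class :: "(real^'n) set \<Rightarrow> (real^'n \<Rightarrow> real) \<Rightarrow> (real^'n \<Rightarrow> real) set" where
  "perron_class D \<phi> = {u. continuous_on (closure D) u \<and> (\<forall>x\<in>D. vsub_at F u x)
     \<and> (\<forall>x\<in>frontier D. u x \<le> \<phi> x)}"

text \<open>Walsh's translation argument: a competitor, shifted by a small vector and lowered by a
  multiple of the boundary oscillation, is again a competitor after taking the maximum with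
  a lower barrier.\<close>

lemma perron_translate:
  assumes D: "open D" "bounded D" and e: "\<eta> > 0"
    and w: "w \<in> perron_class D \<phi>" "\<And>x. x \<in> frontier D \<Longrightarrow> \<phi> x - \<eta> \<le> w x"
    and v: "continuous_on (closure D) v" "\<And>x. x \<in> frontier D \<Longrightarrow> v x \<le> \<phi> x + \<eta>"
      "\<And>u x. u \<in> perron_class D \<phi> \<Longrightarrow> x \<in> closure D \<Longrightarrow> u x \<le> v x"
    and wz: "\<And>x. x \<in> closure D \<Longrightarrow> x + z \<in> closure D \<Longrightarrow> \<bar>w (x + z) - w x\<bar> < \<eta>"
    and vz: "\<And>x. x \<in> closure D \<Longrightarrow> x + z \<in> closure D \<Longrightarrow> \<bar>v (x + z) - v x\<bar> < \<eta>"
    and u: "u \<in> perron_class D \<phi>"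
  shows "(\<lambda>x. if x + z \<in> D then max (w x) (u (x + z) - 6 * \<eta>) else w x) \<in> perron_class D \<phi>"
    (is "?u \<in> _")
proof -
  have cont: "continuous_on (closure D) w" "continuous_on (closure D) u"
    and sub: "\<And>x. x \<in> D \<Longrightarrow> vsub_at F w x" "\<And>x. x \<in> D \<Longrightarrow> vsub_at F u x"
    and bd: "\<And>x. x \<in> frontier D \<Longrightarrow> w x \<le> \<phi> x"
    using w(1) u by (auto simp: perron_class_def)
  have fr: "frontier D \<subseteq> closure D" by (simp add: frontier_def)
  \<comment> \<open>Passing through the upper barrier \<open>v\<close>, whose gap to
    \<open>w\<close> on the frontier is at most \<open>2 * \<eta>\<close>, bounds
    \<open>u (x + z) - w x\<close> by \<open>3 * \<eta>\<close>, well within the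
    \<open>6 * \<eta>\<close> subtracted.\<close>
  have low1: "u (x + z) - 6 * \<eta> \<le> w x" if "x \<in> frontier D" "x + z \<in> closure D" for x
  proof -
    have x: "x \<in> closure D" using that fr by blast
    have "u (x + z) \<le> v (x + z)" using v(3)[OF u that(2)] .
    moreover have "v (x + z) < v x + \<eta>" using vz[OF x that(2)] by linarith
    ultimately show ?thesis using v(2)[OF that(1)] w(2)[OF that(1)] e by linarith
  qed
  have low2: "u (x + z) - 6 * \<eta> \<le> w x" if "x \<in> closure D" "x + z \<in> frontier D" for x
  proof -
    have x: "x + z \<in> closure D" using that fr by blast
    have "u (x + z) \<le> v (x + z)" using v(3)[OF u x] .
    moreover have "w (x + z) < w x + \<eta>" using wz[OF that(1) x] by linarith
    ultimately show ?thesis using v(2)[OF that(2)] w(2)[OF that(2)] e by linarith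
  qed
  \<comment> \<open>The two closed pieces overlap where \<open>x + z\<close> lies on the frontier;
    there \<open>low2\<close> makes both formulas agree.\<close>
  define S1 where "S1 = closure D \<inter> (\<lambda>x. x + z) -` closure D"
  define S2 where "S2 = closure D \<inter> (\<lambda>x. x + z) -` (- D)"
  have S: "closure D = S1 \<union> S2" using closure_subset[of D] by (auto simp: S1_def S2_def)
  have cl: "closed S1" "closed S2"
    unfolding S1_def S2_def using D(1)
    by (auto intro!: continuous_closed_preimage continuous_intros closed_Compl)
  have c1: "continuous_on S1 (\<lambda>x. max (w x) (u (x + z) - 6 * \<eta>))"
    by (intro continuous_intros continuous_on_subset[OF cont(1)] continuous_on_compose2[OF cont(2)])
       (auto simp: S1_def)
  have c2: "continuous_on S2 w"
    by (intro continuous_on_subset[OF cont(1)]) (auto simp: S2_def)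
  have "continuous_on (closure D) ?u"
    unfolding S
  proof (rule continuous_on_cases[OF cl c1 c2], intro allI impI)
    fix x assume "x \<in> S1 \<and> x + z \<notin> D \<or> x \<in> S2 \<and> x + z \<in> D"
    then have "x \<in> closure D" "x + z \<in> frontier D"
      by (auto simp: S1_def S2_def frontier_open[OF D(1)])
    from low2[OF this] show "max (w x) (u (x + z) - 6 * \<eta>) = w x" by simp
  qed
  moreover have "vsub_at F ?u x" if x: "x \<in> D" for x
  proof (cases "x + z \<in> D \<and> w x < u (x + z) - 6 * \<eta>")
    case True
    then have xz: "x + z \<in> D" by simp
    have 1: "vsub_at F (\<lambda>y. u (y + z) + - (6 * \<eta>)) x"
      by (intro vsub_at_add_const vsub_at_translate sub(2) xz)
    have 2: "\<forall>\<^sub>F y in nhds x. u (y + z) + - (6 * \<eta>) \<le> ?u y"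
    proof -
      have "open ((\<lambda>y. y + z) -` D)" by (intro open_vimage D continuous_intros)
      from eventually_nhds_in_open[OF this, of x] xz show ?thesis
        by (auto elim!: eventually_mono)
    qed
    show ?thesis by (rule vsub_at_mono[OF 1 _ 2]) (use True in auto)
  next
    case False
    then have "w x = ?u x" by auto
    then show ?thesis by (rule vsub_at_mono[OF sub(1)[OF x]]) auto
  qed
  moreover have "?u x \<le> \<phi> x" if x: "x \<in> frontier D" for x
    using low1[OF x] bd[OF x] closure_subset[of D] by auto
  ultimately show ?thesis by (simp add: perron_class_def)
qed

text \<open>The interior is taken relative to symmetric matrices, so openness is applied together
  with the symmetry of Hessians.\<close>

lemma interior_perturbation:
  assumes C: "C2on U f g Hs" "x \<in> U" and int: "Hs x \<in> sym_interior F"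
  obtains \<eta> where "\<eta> > 0" "\<forall>\<^sub>F y in nhds x. Hs y + (2 * - \<eta>) *\<^sub>R mat 1 \<in> F"
proof -
  obtain e where e: "e > 0" "\<And>B. B \<in> sym_mats \<Longrightarrow> dist B (Hs x) < e \<Longrightarrow> B \<in> F"
    using int by (auto simp: sym_interior_def)
  obtain \<eta> where \<eta>: "\<eta> > 0" "2 * \<eta> * norm (mat 1 :: real^'n^'n) \<le> e / 2"
    using small_multiple_of_id[OF e(1)] by blast
  have "\<forall>\<^sub>F y in nhds x. dist (Hs y) (Hs x) < e / 2"
    by (rule tendstoD[OF C2on_Hess_tendsto[OF C]]) (use e in simp)
  moreover have "\<forall>\<^sub>F y in nhds x. y \<in> U"
    using C2on_open[OF C(1)] C(2) by (rule eventually_nhds_in_open)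
  ultimately have "\<forall>\<^sub>F y in nhds x. Hs y + (2 * - \<eta>) *\<^sub>R mat 1 \<in> F"
  proof eventually_elim
    case (elim y)
    let ?A = "Hs y + (2 * - \<eta>) *\<^sub>R mat 1"
    show ?case
    proof (rule e(2))
      show "?A \<in> sym_mats"
        using Hess_symmetric[OF C2on_add_quad[OF C(1), of "- \<eta>" x] elim(2)] by (simp add: sym_mats_def)
      have "dist ?A (Hs x) \<le> dist (Hs y) (Hs x) + norm ((2 * \<eta>) *\<^sub>R (mat 1 :: real^'n^'n))"
        unfolding dist_norm using norm_triangle_ineq4[of "Hs y - Hs x" "(2 * \<eta>) *\<^sub>R (mat 1 :: real^'n^'n)"]
        by (simp add: algebra_simps)
      also have "\<dots> < e / 2 + e / 2"
        using elim(1) \<eta> by (intro add_less_le_mono) auto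
      finally show "dist ?A (Hs x) < e" by simp
    qed
  qed
  then show ?thesis using that \<eta>(1) by blast
qed

text \<open>If a dual test function \<psi> failed at \<open>x\<close>, then \<open>- \<psi>\<close>,
  bent down by a quadratic and raised by \<kappa>, would be a subsolution that lies below
  \<open>H\<close> on a small sphere but above it at \<open>x\<close>. Its maximum with
  \<open>H\<close> would be a better competitor.\<close>

lemma perron_dual:
  assumes D: "open D" and H: "H \<in> perron_class D \<phi>"
    and max: "\<And>u x. u \<in> perron_class D \<phi> \<Longrightarrow> x \<in> D \<Longrightarrow> u x \<le> H x"
    and x: "x \<in> D"
  shows "vsub_at (dual_subeq F) (\<lambda>y. - H y) x"
proof (rule vsub_atI)
  fix U \<psi> g Hs
  assume C: "C2on U \<psi> g Hs" and xU: "x \<in> U"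
    and le: "\<forall>\<^sub>F y in nhds x. - H y \<le> \<psi> y" and eq: "- H x = \<psi> x"
  have cH: "continuous_on (closure D) H" and sH: "\<And>y. y \<in> D \<Longrightarrow> vsub_at F H y"
    and bH: "\<And>y. y \<in> frontier D \<Longrightarrow> H y \<le> \<phi> y"
    using H by (auto simp: perron_class_def)
  have symH: "Hs x \<in> sym_mats"
    using Hess_symmetric[OF C xU] by (simp add: sym_mats_def)
  show "Hs x \<in> dual_subeq F"
  proof (rule ccontr)
    assume "Hs x \<notin> dual_subeq F"
    then have "- Hs x \<in> sym_interior F" using symH by (simp add: dual_subeq_def)
    then have int: "(-1) *\<^sub>R Hs x \<in> sym_interior F" by simp
    have C1: "C2on U (\<lambda>y. (-1) * \<psi> y) (\<lambda>y. (-1) *\<^sub>R g y) (\<lambda>y. (-1) *\<^sub>R Hs y)"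
      by (rule C2on_scale[OF C])
    obtain \<eta> where \<eta>: "\<eta> > 0" "\<forall>\<^sub>F y in nhds x. (-1) *\<^sub>R Hs y + (2 * - \<eta>) *\<^sub>R mat 1 \<in> F"
      using interior_perturbation[OF C1 xU int] by blast
    have "\<forall>\<^sub>F y in nhds x. y \<in> U \<inter> D"
      using C2on_open[OF C] xU D x by (intro eventually_nhds_in_open) auto
    then have "\<forall>\<^sub>F y in nhds x. (-1) *\<^sub>R Hs y + (2 * - \<eta>) *\<^sub>R mat 1 \<in> F \<and> y \<in> U \<inter> D \<and> - H y \<le> \<psi> y"
      using le \<eta>(2) by eventually_elim auto
    then obtain r0 where r0: "r0 > 0"
      "\<And>y. dist y x < r0 \<Longrightarrow> (-1) *\<^sub>R Hs y + (2 * - \<eta>) *\<^sub>R mat 1 \<in> F \<and> y \<in> U \<inter> D \<and> - H y \<le> \<psi> y"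
      unfolding eventually_nhds_metric by blast
    define r where "r = r0 / 2"
    have r: "r > 0" "\<And>y. y \<in> cball x r \<Longrightarrow> (-1) *\<^sub>R Hs y + (2 * - \<eta>) *\<^sub>R mat 1 \<in> F \<and> y \<in> U \<inter> D \<and> - H y \<le> \<psi> y"
      using r0 by (auto simp: r_def dist_commute)
    then have sub: "cball x r \<subseteq> U" "cball x r \<subseteq> D" by blast+
    \<comment> \<open>Half of the drop of the quadratic at radius \<open>r\<close>: the bent
      function is below \<open>H\<close> on the sphere by at least \<kappa> and above it at
      \<open>x\<close> by \<kappa>.\<close>
    define \<kappa> where "\<kappa> = \<eta> * r\<^sup>2 / 2"
    have k: "\<kappa> > 0" using \<eta>(1) r by (simp add: \<kappa>_def)
    define f where "f = (\<lambda>y. ((-1) * \<psi> y + (- \<eta>) * (norm (y - x))\<^sup>2) + \<kappa>)"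
    have Cf: "C2on U f (\<lambda>y. (-1) *\<^sub>R g y + (2 * - \<eta>) *\<^sub>R (y - x)) (\<lambda>y. (-1) *\<^sub>R Hs y + (2 * - \<eta>) *\<^sub>R mat 1)"
      unfolding f_def by (intro C2on_add_const C2on_add_quad C1)
    have vf: "vsub_at F f y" if y: "y \<in> ball x r" for y
    proof -
      have yc: "y \<in> cball x r" using y by simp
      then have yU: "y \<in> U" using sub by blast
      show ?thesis by (rule C2on_vsub_at[OF Cf yU]) (use r(2)[OF yc] add_psd in auto)
    qed
    have fH: "f y < H y" if y: "y \<in> sphere x r" for y
    proof -
      have "norm (y - x) = r" using y by (simp add: dist_norm norm_minus_commute)
      then have "f y = - \<psi> y - \<kappa>" by (simp add: f_def \<kappa>_def)
      moreover have "- H y \<le> \<psi> y" using r(2)[of y] y by simp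
      ultimately show ?thesis using k by linarith
    qed
    let ?u = "\<lambda>y. if y \<in> ball x r then max (H y) (f y) else H y"
    have S: "closure D = cball x r \<union> (closure D - ball x r)"
      using sub(2) closure_subset[of D] ball_subset_cball[of x r] by blast
    have "continuous_on (closure D) ?u"
    proof (subst S, rule continuous_on_cases)
      show "continuous_on (cball x r) (\<lambda>y. max (H y) (f y))"
        using sub closure_subset[of D]
        by (intro continuous_intros continuous_on_subset[OF cH] continuous_on_subset[OF C2on_cont[OF Cf]]) auto
      show "continuous_on (closure D - ball x r) H" by (rule continuous_on_subset[OF cH]) auto
      show "closed (closure D - ball x r)" by (intro closed_Diff) auto
      show "\<forall>y. y \<in> cball x r \<and> y \<notin> ball x r \<or> y \<in> closure D - ball x r \<and> y \<in> ball x r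
          \<longrightarrow> max (H y) (f y) = H y"
        using fH by (force simp: max_def)
    qed auto
    moreover have "vsub_at F ?u y" if y: "y \<in> D" for y
    proof (cases "y \<in> ball x r \<and> H y < f y")
      case True
      then have yb: "y \<in> ball x r" by simp
      have "\<forall>\<^sub>F t in nhds y. f t \<le> ?u t"
        using eventually_nhds_in_open[OF open_ball yb] by eventually_elim auto
      then show ?thesis using True by (intro vsub_at_mono[OF vf[OF yb]]) auto
    next
      case False
      then have "H y = ?u y" by auto
      then show ?thesis by (rule vsub_at_mono[OF sH[OF y]]) auto
    qed
    moreover have "?u y \<le> \<phi> y" if y: "y \<in> frontier D" for y
    proof -
      have "y \<notin> D" using y by (simp add: frontier_open[OF D])
      then have "y \<notin> ball x r" using sub(2) by force
      then show ?thesis using bH[OF y] by simp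
    qed
    ultimately have "?u \<in> perron_class D \<phi>" by (simp add: perron_class_def)
    from max[OF this x] have "f x \<le> H x" using r(1) by simp
    then show False using k eq by (simp add: f_def)
  qed
qed

text \<open>Barriers that attain the data only up to each \<eta> are enough: they force the boundary
  values in the limit, and their moduli of continuity pass to the supremum through translated
  competitors.\<close>

lemma perron:
  assumes D: "open D" "bounded D"
    and lo: "\<And>\<eta>. \<eta> > 0 \<Longrightarrow> \<exists>w\<in>perron_class D \<phi>. \<forall>x\<in>frontier D. \<phi> x - \<eta> \<le> w x"
    and hi: "\<And>\<eta>. \<eta> > 0 \<Longrightarrow> \<exists>v. continuous_on (closure D) v \<and> (\<forall>x\<in>frontier D. v x \<le> \<phi> x + \<eta>)
        \<and> (\<forall>u\<in>perron_class D \<phi>. \<forall>x\<in>closure D. u x \<le> v x)"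
  shows "\<exists>H\<in>perron_class D \<phi>. (\<forall>x\<in>frontier D. H x = \<phi> x)
    \<and> (\<forall>x\<in>D. vsub_at (dual_subeq F) (\<lambda>y. - H y) x)
    \<and> (\<forall>u\<in>perron_class D \<phi>. \<forall>x\<in>closure D. u x \<le> H x)"
proof -
  let ?P = "perron_class D \<phi>"
  define H where "H = (\<lambda>x. SUP u\<in>?P. u x)"
  have ne: "?P \<noteq> {}" using lo[of 1] by auto
  obtain v1 where v1: "\<And>u x. u \<in> ?P \<Longrightarrow> x \<in> closure D \<Longrightarrow> u x \<le> v1 x" using hi[of 1] by auto
  have bdd: "bdd_above ((\<lambda>u. u x) ` ?P)" if "x \<in> closure D" for x
    by (rule bdd_aboveI2) (rule v1[OF _ that])
  have up: "u x \<le> H x" if "u \<in> ?P" "x \<in> closure D" for u x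
    unfolding H_def by (rule cSUP_upper[OF that(1) bdd[OF that(2)]])
  have least: "H x \<le> c" if "x \<in> closure D" "\<And>u. u \<in> ?P \<Longrightarrow> u x \<le> c" for x c
    unfolding H_def by (rule cSUP_least[OF ne]) (rule that(2))
  have cK: "compact (closure D)" using D(2) by (simp add: compact_closure)
  have cH: "continuous_on (closure D) H"
    unfolding continuous_on_iff
  proof (intro ballI allI impI)
    fix x and e :: real assume x: "x \<in> closure D" and "0 < e"
    define \<eta> where "\<eta> = e / 7"
    have e: "\<eta> > 0" "6 * \<eta> < e" using \<open>0 < e\<close> by (auto simp: \<eta>_def)
    obtain w where w: "w \<in> ?P" "\<And>x. x \<in> frontier D \<Longrightarrow> \<phi> x - \<eta> \<le> w x" using lo[OF e(1)] by blast
    obtain v where v: "continuous_on (closure D) v" "\<And>x. x \<in> frontier D \<Longrightarrow> v x \<le> \<phi> x + \<eta>"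
      "\<And>u x. u \<in> ?P \<Longrightarrow> x \<in> closure D \<Longrightarrow> u x \<le> v x"
      using hi[OF e(1)] by blast
    have "uniformly_continuous_on (closure D) w"
      using w(1) by (intro compact_uniformly_continuous cK) (simp add: perron_class_def)
    then obtain d1 where d1: "d1 > 0" "\<And>x y. x \<in> closure D \<Longrightarrow> y \<in> closure D \<Longrightarrow> dist y x < d1 \<Longrightarrow> dist (w y) (w x) < \<eta>"
      using e(1) unfolding uniformly_continuous_on_def by meson
    have "uniformly_continuous_on (closure D) v"
      by (intro compact_uniformly_continuous cK v(1))
    then obtain d2 where d2: "d2 > 0" "\<And>x y. x \<in> closure D \<Longrightarrow> y \<in> closure D \<Longrightarrow> dist y x < d2 \<Longrightarrow> dist (v y) (v x) < \<eta>"
      using e(1) unfolding uniformly_continuous_on_def by meson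
    \<comment> \<open>Translation by \<open>y - x\<close> makes the value of a competitor at
      \<open>y\<close> available at \<open>x\<close>.\<close>
    have key: "H y \<le> H x + 6 * \<eta>" if xy: "x \<in> closure D" "y \<in> closure D" "dist y x < min d1 d2" for x y
    proof (rule least[OF xy(2)])
      fix u assume u: "u \<in> ?P"
      define z where "z = y - x"
      have nz: "norm z < d1" "norm z < d2" using xy(3) by (auto simp: z_def dist_norm)
      let ?u = "\<lambda>t. if t + z \<in> D then max (w t) (u (t + z) - 6 * \<eta>) else w t"
      have "?u \<in> ?P"
      proof (rule perron_translate[OF D e(1) w v(1,2)])
        show "\<bar>w (t + z) - w t\<bar> < \<eta>" if "t \<in> closure D" "t + z \<in> closure D" for t
          using d1(2)[OF that] nz by (simp add: dist_norm)
        show "\<bar>v (t + z) - v t\<bar> < \<eta>" if "t \<in> closure D" "t + z \<in> closure D" for t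
          using d2(2)[OF that] nz by (simp add: dist_norm)
        show "u \<in> ?P" by (rule u)
        show "u' t \<le> v t" if "u' \<in> ?P" "t \<in> closure D" for u' t
          using that by (rule v(3))
      qed
      from up[OF this xy(1)] have ux: "?u x \<le> H x" .
      have xz: "x + z = y" by (simp add: z_def)
      show "u y \<le> H x + 6 * \<eta>"
      proof (cases "y \<in> D")
        case True
        then show ?thesis using ux xz by simp
      next
        \<comment> \<open>At a frontier point the translated competitor reduces to \<open>w\<close>,
          so the barriers are used directly: \<open>u y \<le> v y\<close>, and \<open>v y\<close> is
          within \<open>2 * \<eta>\<close> of \<open>w y\<close>.\<close>
        case False
        then have y: "y \<in> frontier D" using xy(2) by (simp add: frontier_open[OF D(1)])
        have "w y < w x + \<eta>" using d1(2)[OF xy(1,2)] xy(3) by (simp add: dist_real_def abs_less_iff)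
        then show ?thesis
          using v(3)[OF u xy(2)] v(2)[OF y] w(2)[OF y] up[OF w(1) xy(1)] e(1) by linarith
      qed
    qed
    show "\<exists>d>0. \<forall>x'\<in>closure D. dist x' x < d \<longrightarrow> dist (H x') (H x) < e"
    proof (intro exI[of _ "min d1 d2"] conjI ballI impI)
      fix y assume y: "y \<in> closure D" "dist y x < min d1 d2"
      then show "dist (H y) (H x) < e"
        using key[OF x y] key[OF y(1) x] e(2) by (auto simp: dist_real_def abs_less_iff dist_commute)
    qed (use d1 d2 in simp)
  qed
  have Hbd: "H x = \<phi> x" if x: "x \<in> frontier D" for x
  proof (rule antisym)
    have xc: "x \<in> closure D" using x by (simp add: frontier_def)
    show "H x \<le> \<phi> x" by (rule least[OF xc]) (use x in \<open>simp add: perron_class_def\<close>)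
    show "\<phi> x \<le> H x"
    proof (rule field_le_epsilon)
      fix \<eta> :: real assume "\<eta> > 0"
      then obtain w where "w \<in> ?P" "\<phi> x - \<eta> \<le> w x" using lo x by blast
      then show "\<phi> x \<le> H x + \<eta>" using up[OF _ xc, of w] by linarith
    qed
  qed
  have "vsub_at F H x" if x: "x \<in> D" for x
  proof (rule vsub_at_limit[OF closed_F D(1) x])
    fix \<eta> :: real assume e: "\<eta> > 0"
    have xc: "x \<in> closure D" using x closure_subset by blast
    have "\<exists>u\<in>?P. H x - \<eta> < u x"
    proof (rule ccontr)
      assume "\<not> ?thesis"
      then have "H x \<le> H x - \<eta>" by (intro least[OF xc]) (auto simp: not_less)
      then show False using e by simp
    qed
    then obtain u where u: "u \<in> ?P" "H x - \<eta> < u x" by blast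
    have "u y \<le> H y + \<eta>" if "y \<in> D" for y
    proof -
      have "y \<in> closure D" using that closure_subset by blast
      from up[OF u(1) this] show ?thesis using e by linarith
    qed
    with u show "\<exists>u'. continuous_on D u' \<and> (\<forall>y\<in>D. vsub_at F u' y) \<and> H x - \<eta> \<le> u' x \<and> (\<forall>y\<in>D. u' y \<le> H y + \<eta>)"
      using closure_subset[of D]
      by (intro exI[of _ u]) (auto simp: perron_class_def intro: continuous_on_subset)
  qed
  then have HP: "H \<in> ?P" using cH Hbd by (simp add: perron_class_def)
  have "vsub_at (dual_subeq F) (\<lambda>y. - H y) x" if "x \<in> D" for x
    using up closure_subset by (intro perron_dual[OF D(1) HP _ that]) blast
  then show ?thesis using HP Hbd up by blast
qed

end

section \<open>Boundary barriers\<close>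

text \<open>Smoothness is recursive in directional derivatives. Uniqueness of derivatives identifies
  them with the entries of \<open>g\<close> and \<open>Hs\<close>, whence the continuity of
  \<open>Hs\<close>.\<close>

lemma local_defining_fn_C2on:
  fixes \<rho> :: "real^'n \<Rightarrow> real"
  assumes l: "local_defining_fn \<Omega> b U \<rho> g Hs"
  shows "C2on U \<rho> g Hs"
proof -
  have oU: "open U" and sm: "smooth_on U \<rho>"
    and d: "\<And>y. y \<in> U \<Longrightarrow> (\<rho> has_derivative (\<lambda>v. g y \<bullet> v)) (at y)"
      "\<And>y. y \<in> U \<Longrightarrow> (g has_derivative (\<lambda>v. Hs y *v v)) (at y)"
    using l by (auto simp: local_defining_fn_def)
  have "Ck_on (Suc (Suc 0)) U \<rho>" using sm unfolding smooth_on_def by blast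
  then obtain f' where f': "\<And>y. y \<in> U \<Longrightarrow> (\<rho> has_derivative f' y) (at y)"
    "\<And>v. Ck_on (Suc 0) U (\<lambda>y. f' y v)" by auto
  have f'g: "f' y v = g y \<bullet> v" if "y \<in> U" for y v
    using has_derivative_unique[OF f'(1)[OF that] d(1)[OF that]] by simp
  have comp: "continuous_on U (\<lambda>y. Hs y $ i $ j)" for i j
  proof -
    obtain f'' where f'': "\<And>y. y \<in> U \<Longrightarrow> ((\<lambda>y. f' y (axis i 1)) has_derivative f'' y) (at y)"
      "\<And>w. continuous_on U (\<lambda>y. f'' y w)"
      using f'(2)[of "axis i 1"] by auto
    have "f'' y (axis j 1) = Hs y $ i $ j" if y: "y \<in> U" for y
    proof -
      have "((\<lambda>y. g y $ i) has_derivative f'' y) (at y)"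
        by (rule has_derivative_transform_within_open[OF f''(1)[OF y] oU y])
           (simp add: f'g inner_axis)
      moreover have "((\<lambda>y. g y $ i) has_derivative (\<lambda>v. (Hs y *v v) $ i)) (at y)"
        by (rule bounded_linear.has_derivative[OF bounded_linear_vec_nth d(2)[OF y]])
      ultimately have "f'' y = (\<lambda>v. (Hs y *v v) $ i)" by (rule has_derivative_unique)
      then show ?thesis by (simp add: matrix_vector_mul_component inner_axis)
    qed
    then show ?thesis using f''(2)[of "axis j 1"] by (simp cong: continuous_on_cong)
  qed
  have "continuous_on U (\<lambda>y. \<chi> i j. Hs y $ i $ j)"
    by (intro continuous_on_vec_lambda comp)
  then have "continuous_on U Hs" by simp
  then show ?thesis using oU d by (auto simp: C2on_def)
qed

lemma local_defining_fn_closure: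
  assumes l: "local_defining_fn \<Omega> b U \<rho> g Hs" and y: "y \<in> closure \<Omega>" "y \<in> U"
  shows "\<rho> y \<le> 0"
proof (rule ccontr)
  assume "\<not> ?thesis"
  then have pos: "\<rho> y > 0" by simp
  have oU: "open U" and eq: "\<Omega> \<inter> U = {y \<in> U. \<rho> y < 0}" using l by (auto simp: local_defining_fn_def)
  have "open (U \<inter> \<rho> -` {0<..})"
    by (rule continuous_open_preimage[OF C2on_cont[OF local_defining_fn_C2on[OF l]] oU open_greaterThan])
  then have "\<Omega> \<inter> (U \<inter> \<rho> -` {0<..}) \<noteq> {}"
    using y pos closure_iff_nhds_not_empty by blast
  then obtain y' where y': "y' \<in> \<Omega> \<inter> U" "\<rho> y' > 0" by auto
  then have "\<rho> y' < 0" using eq by blast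
  then show False using y'(2) by simp
qed

lemma local_defining_fn_zero:
  assumes l: "local_defining_fn \<Omega> b U \<rho> g Hs" and \<Omega>: "open \<Omega>" and b: "b \<in> frontier \<Omega>"
  shows "\<rho> b = 0"
proof (rule antisym)
  have bU: "b \<in> U" and eq: "\<Omega> \<inter> U = {y \<in> U. \<rho> y < 0}" using l by (auto simp: local_defining_fn_def)
  have b': "b \<in> closure \<Omega>" "b \<notin> \<Omega>" using b by (auto simp: frontier_open[OF \<Omega>])
  show "\<rho> b \<le> 0" by (rule local_defining_fn_closure[OF l b'(1) bU])
  show "0 \<le> \<rho> b"
  proof (rule ccontr)
    assume "\<not> 0 \<le> \<rho> b"
    then have "b \<in> \<Omega> \<inter> U" unfolding eq using bU by simp
    then show False using b'(2) by blast
  qed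
qed

context convex_subeq begin

text \<open>Near \<open>b\<close> the barrier is \<open>\<rho> + k / 2 * \<rho>\<^sup>2\<close>
  minus a small quadratic. The Hessian of the first part at \<open>b\<close> is
  \<open>Hs b + k *\<^sub>R proj_mat (g b)\<close>, which strict convexity places in the interior,
  leaving room for the quadratic that makes \<open>b\<close> a strict maximum on the closure. A
  maximum with a negative constant extends it.\<close>

lemma boundary_barrier:
  assumes \<Omega>: "open \<Omega>" and bd: "smooth_boundary \<Omega>" "strictly_F_convex_boundary F \<Omega>"
    and b: "b \<in> frontier \<Omega>"
  obtains \<beta> where "continuous_on (closure \<Omega>) \<beta>" "\<And>x. x \<in> \<Omega> \<Longrightarrow> vsub_at F \<beta> x" "\<beta> b = 0"
    "\<And>x. x \<in> closure \<Omega> \<Longrightarrow> \<beta> x \<le> 0"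
    "\<And>d. d > 0 \<Longrightarrow> \<exists>c>0. \<forall>x\<in>closure \<Omega>. d \<le> dist x b \<longrightarrow> \<beta> x \<le> - c"
proof -
  obtain U \<rho> g Hs where l: "local_defining_fn \<Omega> b U \<rho> g Hs"
    using bd(1) b unfolding smooth_boundary_def by blast
  note C = local_defining_fn_C2on[OF l]
  have bU: "b \<in> U" and gb: "g b \<noteq> 0" using l by (auto simp: local_defining_fn_def)
  have \<rho>b: "\<rho> b = 0" by (rule local_defining_fn_zero[OF l \<Omega> b])
  obtain t0 where t0: "\<And>t. t \<ge> t0 \<Longrightarrow> Hs b + t *\<^sub>R proj_mat (g b /\<^sub>R norm (g b)) \<in> sym_interior F"
    using bd(2) b l unfolding strictly_F_convex_boundary_def by blast
  define t where "t = max t0 1"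
  \<comment> \<open>The projection onto the unit normal is rescaled to the matrix of the
    unnormalised gradient.\<close>
  define k where "k = t / (norm (g b))\<^sup>2"
  have k: "k > 0" using gb by (simp add: k_def t_def)
  have "t *\<^sub>R proj_mat (g b /\<^sub>R norm (g b)) = k *\<^sub>R proj_mat (g b)"
    by (simp add: proj_mat_def vec_eq_iff k_def power2_eq_square field_simps)
  then have int: "Hs b + k *\<^sub>R proj_mat (g b) \<in> sym_interior F"
    using t0[of t] by (simp add: t_def)
  have "C2on U (\<lambda>y. \<rho> y + k / 2 * (\<rho> y)\<^sup>2) (\<lambda>y. (1 + k * \<rho> y) *\<^sub>R g y)
      (\<lambda>y. (1 + k * \<rho> y) *\<^sub>R Hs y + k *\<^sub>R proj_mat (g y))"
  proof (rule C2on_compose[OF C])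
    show "((\<lambda>s. s + k / 2 * s\<^sup>2) has_real_derivative 1 + k * s) (at s)" for s
      by (auto intro!: derivative_eq_intros)
    show "((\<lambda>s. 1 + k * s) has_real_derivative k) (at s)" for s
      by (auto intro!: derivative_eq_intros)
  qed auto
  note C1 = this
  obtain \<eta> where \<eta>: "\<eta> > 0" "\<forall>\<^sub>F y in nhds b. ((1 + k * \<rho> y) *\<^sub>R Hs y + k *\<^sub>R proj_mat (g y)) + (2 * - \<eta>) *\<^sub>R mat 1 \<in> F"
    using interior_perturbation[OF C1 bU] int \<rho>b by auto
  define f where "f = (\<lambda>y. (\<rho> y + k / 2 * (\<rho> y)\<^sup>2) + - \<eta> * (norm (y - b))\<^sup>2)"
  have Cf: "C2on U f (\<lambda>y. (1 + k * \<rho> y) *\<^sub>R g y + (2 * - \<eta>) *\<^sub>R (y - b))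
      (\<lambda>y. ((1 + k * \<rho> y) *\<^sub>R Hs y + k *\<^sub>R proj_mat (g y)) + (2 * - \<eta>) *\<^sub>R mat 1)"
    unfolding f_def by (rule C2on_add_quad[OF C1])
  have "(\<rho> \<longlongrightarrow> \<rho> b) (nhds b)"
    using C2on_cont[OF C] C2on_open[OF C] bU
    by (metis continuous_on_eq_continuous_at isCont_def tendsto_at_iff_tendsto_nhds)
  \<comment> \<open>This bound keeps \<open>1 + k / 2 * \<rho> y\<close> nonnegative, so
    \<open>\<rho> + k / 2 * \<rho>\<^sup>2\<close> is nonpositive wherever \<rho> is.\<close>
  then have "\<forall>\<^sub>F y in nhds b. \<rho> y > - (2 / k)"
    by (rule order_tendstoD) (use k \<rho>b in simp)
  moreover have "\<forall>\<^sub>F y in nhds b. y \<in> U"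
    using C2on_open[OF C] bU by (rule eventually_nhds_in_open)
  ultimately have "\<forall>\<^sub>F y in nhds b. ((1 + k * \<rho> y) *\<^sub>R Hs y + k *\<^sub>R proj_mat (g y)) + (2 * - \<eta>) *\<^sub>R mat 1 \<in> F
      \<and> y \<in> U \<and> \<rho> y > - (2 / k)"
    using \<eta>(2) by eventually_elim auto
  then obtain r0 where r0: "r0 > 0" "\<And>y. dist y b < r0 \<Longrightarrow>
      ((1 + k * \<rho> y) *\<^sub>R Hs y + k *\<^sub>R proj_mat (g y)) + (2 * - \<eta>) *\<^sub>R mat 1 \<in> F \<and> y \<in> U \<and> \<rho> y > - (2 / k)"
    unfolding eventually_nhds_metric by blast
  define r where "r = r0 / 2"
  have r: "r > 0" "\<And>y. y \<in> cball b r \<Longrightarrow>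
      ((1 + k * \<rho> y) *\<^sub>R Hs y + k *\<^sub>R proj_mat (g y)) + (2 * - \<eta>) *\<^sub>R mat 1 \<in> F \<and> y \<in> U \<and> \<rho> y > - (2 / k)"
    using r0 by (auto simp: r_def dist_commute)
  have f_le: "f y \<le> - \<eta> * (dist y b)\<^sup>2" if y: "y \<in> closure \<Omega>" "y \<in> cball b r" for y
  proof -
    have "\<rho> y \<le> 0" by (rule local_defining_fn_closure[OF l y(1)]) (use r(2)[OF y(2)] in simp)
    moreover have "1 + k / 2 * \<rho> y \<ge> 0"
    proof -
      have "k / 2 * (- (2 / k)) \<le> k / 2 * \<rho> y"
        using r(2)[OF y(2)] k by (intro mult_left_mono) auto
      then show ?thesis using k by simp
    qed
    ultimately have "\<rho> y * (1 + k / 2 * \<rho> y) \<le> 0" by (rule mult_nonpos_nonneg)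
    then show ?thesis by (simp add: f_def dist_norm power2_eq_square algebra_simps)
  qed
  \<comment> \<open>On the sphere \<open>f \<le> - (2 * m)\<close>, so the maximum with
    \<open>- m\<close> is already constant there and the pieces fit.\<close>
  define m where "m = \<eta> * r\<^sup>2 / 2"
  have m: "m > 0" using \<eta>(1) r(1) by (simp add: m_def)
  define \<beta> where "\<beta> = (\<lambda>y. if y \<in> ball b r then max (f y) (- m) else - m)"
  define S1 where "S1 = closure \<Omega> \<inter> cball b r"
  define S2 where "S2 = closure \<Omega> - ball b r"
  have S: "closure \<Omega> = S1 \<union> S2" by (auto simp: S1_def S2_def)
  have "continuous_on (closure \<Omega>) \<beta>"
    unfolding S \<beta>_def
  proof (rule continuous_on_cases)
    show "closed S1" "closed S2" unfolding S1_def S2_def by auto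
    show "continuous_on S1 (\<lambda>y. max (f y) (- m))"
      using r(2) by (intro continuous_intros continuous_on_subset[OF C2on_cont[OF Cf]]) (auto simp: S1_def)
    show "\<forall>y. y \<in> S1 \<and> y \<notin> ball b r \<or> y \<in> S2 \<and> y \<in> ball b r \<longrightarrow> max (f y) (- m) = - m"
    proof (intro allI impI)
      fix y assume "y \<in> S1 \<and> y \<notin> ball b r \<or> y \<in> S2 \<and> y \<in> ball b r"
      then have "y \<in> closure \<Omega>" "y \<in> cball b r" "dist y b = r"
        by (auto simp: S1_def S2_def dist_commute)
      from f_le[OF this(1,2)] this(3) show "max (f y) (- m) = - m" using m by (simp add: m_def)
    qed
  qed auto
  moreover have "vsub_at F \<beta> x" for x
  proof (cases "x \<in> ball b r \<and> - m < f x")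
    case True
    then have xb: "x \<in> ball b r" "x \<in> cball b r" by auto
    have "vsub_at F f x"
      by (rule C2on_vsub_at[OF Cf]) (use r(2)[OF xb(2)] add_psd in auto)
    moreover have "\<forall>\<^sub>F y in nhds x. f y \<le> \<beta> y"
      using eventually_nhds_in_open[OF open_ball xb(1)] by eventually_elim (simp add: \<beta>_def)
    ultimately show ?thesis using True by (intro vsub_at_mono[of F f x \<beta>]) (auto simp: \<beta>_def)
  next
    case False
    then show ?thesis by (intro vsub_at_mono[OF vsub_const[of "- m"]]) (auto simp: \<beta>_def)
  qed
  moreover have "\<beta> b = 0" using r(1) m \<rho>b by (simp add: \<beta>_def f_def)
  moreover have le: "\<beta> x \<le> max (- \<eta> * (dist x b)\<^sup>2) (- m)" if "x \<in> closure \<Omega>" for x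
    using f_le[OF that] by (auto simp: \<beta>_def max_def)
  moreover have "\<beta> x \<le> 0" if "x \<in> closure \<Omega>" for x
  proof -
    have "- \<eta> * (dist x b)\<^sup>2 \<le> 0" using \<eta>(1) by simp
    then show ?thesis using le[OF that] m by linarith
  qed
  moreover have "\<exists>c>0. \<forall>x\<in>closure \<Omega>. d \<le> dist x b \<longrightarrow> \<beta> x \<le> - c" if d: "d > 0" for d
  proof (intro exI[of _ "min (\<eta> * d\<^sup>2) m"] conjI ballI impI)
    fix x assume x: "x \<in> closure \<Omega>" "d \<le> dist x b"
    have "\<eta> * d\<^sup>2 \<le> \<eta> * (dist x b)\<^sup>2"
      using d x(2) \<eta>(1) by (intro mult_left_mono power_mono) auto
    then show "\<beta> x \<le> - min (\<eta> * d\<^sup>2) m" using le[OF x(1)] by (auto simp: max_def min_def split: if_splits)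
  qed (use \<eta>(1) d m in auto)
  ultimately show ?thesis using that by blast
qed

lemma perron_class_upper_bound:
  assumes "finite C" "\<And>b. b \<in> C \<Longrightarrow> u b \<in> perron_class D \<phi>" "w0 \<in> perron_class D \<phi>"
  shows "\<exists>w\<in>perron_class D \<phi>. \<forall>b\<in>C. \<forall>x. u b x \<le> w x"
  using assms(1,2)
proof (induction C rule: finite_induct)
  case empty
  then show ?case using assms(3) by blast
next
  case (insert b C)
  then obtain w where w: "w \<in> perron_class D \<phi>" "\<forall>b\<in>C. \<forall>x. u b x \<le> w x" by auto
  have "u b \<in> perron_class D \<phi>" using insert by simp
  then have "(\<lambda>x. max (u b x) (w x)) \<in> perron_class D \<phi>"
    using w(1) by (auto simp: perron_class_def intro!: continuous_intros vsub_at_max)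
  then show ?case using w(2) by (intro bexI) (auto simp: le_max_iff_disj)
qed

text \<open>At each frontier point a steep multiple of the local barrier, shifted to the height
  \<open>\<phi> b - \<epsilon> / 2\<close>, stays below \<phi> and is close to it near
  \<open>b\<close>. Compactness of the frontier and a finite maximum finish.\<close>

lemma lower_barrier:
  assumes \<Omega>: "open \<Omega>" "bounded \<Omega>" and bd: "smooth_boundary \<Omega>" "strictly_F_convex_boundary F \<Omega>"
    and \<phi>: "continuous_on (frontier \<Omega>) \<phi>" and e: "\<epsilon> > 0"
  shows "\<exists>w\<in>perron_class \<Omega> \<phi>. \<forall>x\<in>frontier \<Omega>. \<phi> x - \<epsilon> \<le> w x"
proof -
  have cf: "compact (frontier \<Omega>)" using \<Omega>(2) by (rule compact_frontier_bounded)
  have fc: "frontier \<Omega> \<subseteq> closure \<Omega>" by (simp add: frontier_def)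
  have "bounded (\<phi> ` frontier \<Omega>)"
    by (rule compact_imp_bounded[OF compact_continuous_image[OF \<phi> cf]])
  then obtain M where M: "M > 0" "\<And>x. x \<in> frontier \<Omega> \<Longrightarrow> \<bar>\<phi> x\<bar> \<le> M"
    unfolding bounded_pos by auto
  have ex: "\<exists>u N. u \<in> perron_class \<Omega> \<phi> \<and> open N \<and> b \<in> N \<and> (\<forall>x\<in>frontier \<Omega> \<inter> N. \<phi> x - \<epsilon> \<le> u x)"
    if b: "b \<in> frontier \<Omega>" for b
  proof -
    obtain \<beta> where \<beta>: "continuous_on (closure \<Omega>) \<beta>" "\<And>x. x \<in> \<Omega> \<Longrightarrow> vsub_at F \<beta> x" "\<beta> b = 0"
      "\<And>x. x \<in> closure \<Omega> \<Longrightarrow> \<beta> x \<le> 0"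
      "\<And>d. d > 0 \<Longrightarrow> \<exists>c>0. \<forall>x\<in>closure \<Omega>. d \<le> dist x b \<longrightarrow> \<beta> x \<le> - c"
      using boundary_barrier[OF \<Omega>(1) bd b] by blast
    obtain d where d: "d > 0" "\<And>x. x \<in> frontier \<Omega> \<Longrightarrow> dist x b < d \<Longrightarrow> \<bar>\<phi> x - \<phi> b\<bar> < \<epsilon> / 2"
      using \<phi>[unfolded continuous_on_iff dist_real_def, rule_format, OF b, of "\<epsilon> / 2"] e by auto
    obtain c where c: "c > 0" "\<And>x. x \<in> closure \<Omega> \<Longrightarrow> d \<le> dist x b \<Longrightarrow> \<beta> x \<le> - c"
      using \<beta>(5)[OF d(1)] by blast
    \<comment> \<open>Away from \<open>b\<close> the barrier must absorb an oscillation of \<phi> of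
      at most \<open>2 * M\<close>.\<close>
    define K where "K = 2 * M / c"
    have K: "K > 0" "K * c = 2 * M" using c M by (auto simp: K_def)
    define u where "u = (\<lambda>x. K * \<beta> x + (\<phi> b - \<epsilon> / 2))"
    have cu: "continuous_on (closure \<Omega>) u" unfolding u_def by (intro continuous_intros \<beta>(1))
    have "u x \<le> \<phi> x" if x: "x \<in> frontier \<Omega>" for x
    proof (cases "dist x b < d")
      case True
      have "\<beta> x \<le> 0" using \<beta>(4) x fc by blast
      then have "K * \<beta> x \<le> 0" using K(1) by (simp add: mult_nonneg_nonpos)
      then show ?thesis using d(2)[OF x True] unfolding u_def by linarith
    next
      case False
      then have "\<beta> x \<le> - c" using c(2)[of x] x fc by auto
      then have "K * \<beta> x \<le> K * (- c)" using K(1) by (intro mult_left_mono) auto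
      then have "K * \<beta> x \<le> - (2 * M)" using K(2) by simp
      then show ?thesis using M(2)[OF x] M(2)[OF b] e unfolding u_def by linarith
    qed
    moreover have "vsub_at F u x" if "x \<in> \<Omega>" for x
      unfolding u_def using K(1) by (intro vsub_at_add_const vsub_scale \<beta>(2)[OF that]) auto
    ultimately have uP: "u \<in> perron_class \<Omega> \<phi>" using cu by (simp add: perron_class_def)
    have cd: "continuous_on (frontier \<Omega>) (\<lambda>x. u x - \<phi> x)"
      by (intro continuous_intros \<phi> continuous_on_subset[OF cu fc])
    have "u b - \<phi> b = - (\<epsilon> / 2)" by (simp add: u_def \<beta>(3))
    then obtain s where s: "s > 0" "\<And>x. x \<in> frontier \<Omega> \<Longrightarrow> dist x b < s \<Longrightarrow> \<bar>(u x - \<phi> x) - - (\<epsilon> / 2)\<bar> < \<epsilon> / 2"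
      using cd[unfolded continuous_on_iff dist_real_def, rule_format, OF b, of "\<epsilon> / 2"] e by auto
    have "\<phi> x - \<epsilon> \<le> u x" if "x \<in> frontier \<Omega> \<inter> ball b s" for x
    proof -
      have "x \<in> frontier \<Omega>" "dist x b < s" using that by (simp_all add: dist_commute)
      from s(2)[OF this] show ?thesis by linarith
    qed
    then show ?thesis using uP s(1) by (intro exI[of _ u] exI[of _ "ball b s"]) auto
  qed
  have "\<forall>b\<in>frontier \<Omega>. \<exists>p. fst p \<in> perron_class \<Omega> \<phi> \<and> open (snd p) \<and> b \<in> snd p
      \<and> (\<forall>x\<in>frontier \<Omega> \<inter> snd p. \<phi> x - \<epsilon> \<le> fst p x)"
    (is "\<forall>b\<in>_. \<exists>p. ?Q b p")
  proof
    fix b assume "b \<in> frontier \<Omega>"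
    from ex[OF this] obtain u N where "?Q b (u, N)" by auto
    then show "\<exists>p. ?Q b p" by blast
  qed
  from bchoice[OF this] obtain p where p: "\<And>b. b \<in> frontier \<Omega> \<Longrightarrow> ?Q b (p b)" by blast
  define u where "u = (\<lambda>b. fst (p b))"
  define N where "N = (\<lambda>b. snd (p b))"
  have uN: "\<And>b. b \<in> frontier \<Omega> \<Longrightarrow> u b \<in> perron_class \<Omega> \<phi>"
    "\<And>b. b \<in> frontier \<Omega> \<Longrightarrow> open (N b) \<and> b \<in> N b"
    "\<And>b x. b \<in> frontier \<Omega> \<Longrightarrow> x \<in> frontier \<Omega> \<Longrightarrow> x \<in> N b \<Longrightarrow> \<phi> x - \<epsilon> \<le> u b x"
    using p unfolding u_def N_def by blast+
  obtain C where C: "C \<subseteq> frontier \<Omega>" "finite C" "frontier \<Omega> \<subseteq> (\<Union>b\<in>C. N b)"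
    using compactE_image[OF cf, of "frontier \<Omega>" N] uN(2) by blast
  have w0: "(\<lambda>x. - M) \<in> perron_class \<Omega> \<phi>"
  proof -
    have "- M \<le> \<phi> x" if "x \<in> frontier \<Omega>" for x using M(2)[OF that] by linarith
    then show ?thesis using vsub_const by (auto simp: perron_class_def)
  qed
  have uC: "u b \<in> perron_class \<Omega> \<phi>" if "b \<in> C" for b using uN(1) C(1) that by blast
  have "\<exists>w\<in>perron_class \<Omega> \<phi>. \<forall>b\<in>C. \<forall>x. u b x \<le> w x"
    by (rule perron_class_upper_bound[OF C(2) uC w0])
  then obtain w where w: "w \<in> perron_class \<Omega> \<phi>" "\<And>b x. b \<in> C \<Longrightarrow> u b x \<le> w x" by blast
  have "\<phi> x - \<epsilon> \<le> w x" if x: "x \<in> frontier \<Omega>" for x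
  proof -
    obtain b where b: "b \<in> C" "x \<in> N b" using C(3) x by blast
    then have "\<phi> x - \<epsilon> \<le> u b x" using uN(3) C(1) x by blast
    then show ?thesis using w(2)[OF b(1), of x] by linarith
  qed
  then show ?thesis using w(1) by blast
qed

text \<open>The upper barrier is \<open>- w\<close>, where \<open>w\<close> is a lower barrier for
  the data -\<phi>: for a competitor \<open>u\<close> the sum \<open>u + w\<close> is a subsolution
  that is nonpositive on the frontier.\<close>

lemma dirichlet_problem:
  assumes \<Omega>: "open \<Omega>" "bounded \<Omega>" and bd: "smooth_boundary \<Omega>" "strictly_F_convex_boundary F \<Omega>"
    and \<phi>: "continuous_on (frontier \<Omega>) \<phi>"
  shows "\<exists>H. continuous_on (closure \<Omega>) H \<and> (\<forall>x\<in>\<Omega>. vsub_at F H x)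
    \<and> (\<forall>x\<in>\<Omega>. vsub_at (dual_subeq F) (\<lambda>y. - H y) x) \<and> (\<forall>x\<in>frontier \<Omega>. H x = \<phi> x)"
proof -
  have hi: "\<exists>v. continuous_on (closure \<Omega>) v \<and> (\<forall>x\<in>frontier \<Omega>. v x \<le> \<phi> x + \<epsilon>)
      \<and> (\<forall>u\<in>perron_class \<Omega> \<phi>. \<forall>x\<in>closure \<Omega>. u x \<le> v x)" if e: "\<epsilon> > 0" for \<epsilon>
  proof -
    obtain w where w: "w \<in> perron_class \<Omega> (\<lambda>x. - \<phi> x)" "\<And>x. x \<in> frontier \<Omega> \<Longrightarrow> - \<phi> x - \<epsilon> \<le> w x"
      using lower_barrier[OF \<Omega> bd continuous_on_minus[OF \<phi>] e] by blast
    have wc: "continuous_on (closure \<Omega>) w" "\<And>x. x \<in> \<Omega> \<Longrightarrow> vsub_at F w x" "\<And>x. x \<in> frontier \<Omega> \<Longrightarrow> w x \<le> - \<phi> x"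
      using w(1) by (auto simp: perron_class_def)
    have "u x \<le> - w x" if u: "u \<in> perron_class \<Omega> \<phi>" and x: "x \<in> closure \<Omega>" for u x
    proof -
      have uc: "continuous_on (closure \<Omega>) u" "\<And>x. x \<in> \<Omega> \<Longrightarrow> vsub_at F u x" "\<And>x. x \<in> frontier \<Omega> \<Longrightarrow> u x \<le> \<phi> x"
        using u by (auto simp: perron_class_def)
      have "u x + w x \<le> 0"
      proof (rule vsub_max_principle[OF \<Omega> _ _ _ x])
        show "continuous_on (closure \<Omega>) (\<lambda>x. u x + w x)" by (intro continuous_intros uc wc)
        show "vsub_at F (\<lambda>x. u x + w x) y" if "y \<in> \<Omega>" for y
          by (rule vsub_add[OF \<Omega>(1) that continuous_on_subset[OF uc(1) closure_subset] uc(2)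
                continuous_on_subset[OF wc(1) closure_subset] wc(2)])
        show "u y + w y \<le> 0" if "y \<in> frontier \<Omega>" for y
          using uc(3)[OF that] wc(3)[OF that] by linarith
      qed
      then show ?thesis by linarith
    qed
    moreover have "- w x \<le> \<phi> x + \<epsilon>" if "x \<in> frontier \<Omega>" for x using w(2)[OF that] by linarith
    ultimately show ?thesis using wc(1) by (intro exI[of _ "\<lambda>x. - w x"]) (auto intro: continuous_intros)
  qed
  from perron[OF \<Omega> lower_barrier[OF \<Omega> bd \<phi>] hi]
  show ?thesis by (auto simp: perron_class_def)
qed

end

section \<open>Prescribed densities at an interior point\<close>

lemma sym_interior_scaleR:
  assumes "cone_subequation F" "A \<in> sym_interior F" "t > 0"
  shows "t *\<^sub>R A \<in> sym_interior F"
proof -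
  have cone: "\<And>B s. s > 0 \<Longrightarrow> B \<in> F \<Longrightarrow> s *\<^sub>R B \<in> F"
    using assms(1) unfolding cone_subequation_def by blast
  obtain e where A: "A \<in> F" and e: "e > 0" "\<And>B. B \<in> sym_mats \<Longrightarrow> dist B A < e \<Longrightarrow> B \<in> F"
    using assms(2) by (auto simp: sym_interior_def)
  have "B \<in> F" if B: "B \<in> sym_mats" "dist B (t *\<^sub>R A) < t * e" for B
  proof -
    have "B - t *\<^sub>R A = t *\<^sub>R ((1/t) *\<^sub>R B - A)" using assms(3) by (simp add: algebra_simps)
    then have "t * dist ((1/t) *\<^sub>R B) A < t * e"
      using B(2) assms(3) by (simp add: dist_norm)
    then have "dist ((1/t) *\<^sub>R B) A < e" using assms(3) by simp
    moreover have "(1/t) *\<^sub>R B \<in> sym_mats"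
      using B(1) by (simp add: sym_mats_def transpose_def vec_eq_iff)
    ultimately have "(1/t) *\<^sub>R B \<in> F" using e(2) by blast
    from cone[OF assms(3) this] show ?thesis using assms(3) by simp
  qed
  then show ?thesis
    using cone[OF assms(3) A] e(1) assms(3) unfolding sym_interior_def
    by (auto intro!: exI[of _ "t * e"])
qed

lemma dual_subeq_scaleR:
  assumes "cone_subequation F" "A \<in> dual_subeq F" "t > 0"
  shows "t *\<^sub>R A \<in> dual_subeq F"
proof -
  have "t *\<^sub>R A \<in> sym_mats"
    using assms(2) by (simp add: dual_subeq_def sym_mats_def transpose_def vec_eq_iff)
  moreover have "- (t *\<^sub>R A) \<notin> sym_interior F"
    using sym_interior_scaleR[OF assms(1), of "- (t *\<^sub>R A)" "1 / t"] assms(2,3)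
    by (auto simp: dual_subeq_def)
  ultimately show ?thesis by (simp add: dual_subeq_def)
qed

text \<open>The constants \<open>m\<close> and \<open>M\<close> bound \<open>h - h x0\<close> on the
  frontier; \<open>m\<close> fixes the slope of upper barriers and \<open>M\<close> that of lower
  ones. The last two assumptions are (H3) and (H4) for functions on all of \<Omega>.\<close>

locale singular_dirichlet = convex_subeq F for F :: "(real^'n^'n) set" +
  fixes \<Omega> :: "(real^'n) set" and x0 :: "real^'n" and h :: "real^'n \<Rightarrow> real" and m M :: real
  assumes cone: "cone_subequation F"
    and dom: "open \<Omega>" "bounded \<Omega>" and x0: "x0 \<in> \<Omega>"
    and bdry: "smooth_boundary \<Omega>" "strictly_F_convex_boundary F \<Omega>"
    and h_cont: "continuous_on (closure \<Omega>) h"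
    and h_sub: "\<And>x. x \<in> \<Omega> \<Longrightarrow> vsub_at F h x"
    and h_dual: "\<And>x. x \<in> \<Omega> - {x0} \<Longrightarrow> vsub_at (dual_subeq F) (\<lambda>y. - h y) x"
    and h_min: "\<forall>\<^sub>F x in at x0. h x0 < h x"
    and m_pos: "0 < m" and h_bdry: "\<And>x. x \<in> frontier \<Omega> \<Longrightarrow> h x0 + m \<le> h x \<and> h x \<le> h x0 + M"
    and M_pos: "0 < M"
    and density: "\<And>H. continuous_on \<Omega> H \<Longrightarrow> (\<And>x. x \<in> \<Omega> \<Longrightarrow> vsub_at F H x)
        \<Longrightarrow> (\<And>x. x \<in> \<Omega> - {x0} \<Longrightarrow> vsub_at (dual_subeq F) (\<lambda>y. - H y) x)
        \<Longrightarrow> \<exists>L\<ge>0. ((\<lambda>x. (H x - H x0) / (h x - h x0)) \<longlongrightarrow> L) (at x0)"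
    and density_zero: "\<And>H. continuous_on \<Omega> H \<Longrightarrow> (\<And>x. x \<in> \<Omega> \<Longrightarrow> vsub_at F H x)
        \<Longrightarrow> (\<And>x. x \<in> \<Omega> \<Longrightarrow> vsub_at (dual_subeq F) (\<lambda>y. - H y) x)
        \<Longrightarrow> ((\<lambda>x. (H x - H x0) / (h x - h x0)) \<longlongrightarrow> 0) (at x0)"
begin

abbreviation "D \<equiv> \<Omega> - {x0}"

lemma D_open: "open D" and D_bounded: "bounded D"
  using dom by (auto intro: bounded_subset)

lemma closure_D: "closure D = closure \<Omega>"
proof
  have "x0 islimpt \<Omega>" using x0 dom(1) by (simp add: interior_limit_point interior_open)
  then have "x0 \<in> closure D" by (metis islimpt_in_closure)
  then have "\<Omega> \<subseteq> closure D" using closure_subset[of D] by blast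
  then show "closure \<Omega> \<subseteq> closure D" by (simp add: closure_minimal)
qed (simp add: closure_mono)

lemma frontier_D: "frontier D = insert x0 (frontier \<Omega>)"
  using x0 closure_subset[of \<Omega>]
  by (auto simp: frontier_open[OF D_open] frontier_open[OF dom(1)] closure_D)

lemma \<Omega>_closure: "\<Omega> \<subseteq> closure \<Omega>" and x0_closure: "x0 \<in> closure \<Omega>"
  using closure_subset[of \<Omega>] x0 by auto

text \<open>\<open>comparison\<close> holds on every bounded open set, so \<open>x0\<close> simply
  becomes a frontier point.\<close>

lemma punctured_comparison:
  assumes u: "continuous_on (closure \<Omega>) u" "\<And>x. x \<in> D \<Longrightarrow> vsub_at F u x"
    and v: "continuous_on (closure \<Omega>) v" "\<And>x. x \<in> D \<Longrightarrow> vsub_at (dual_subeq F) (\<lambda>y. - v y) x"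
    and bd: "\<And>x. x \<in> frontier \<Omega> \<Longrightarrow> u x \<le> v x" "u x0 \<le> v x0" and x: "x \<in> closure \<Omega>"
  shows "u x \<le> v x"
  by (rule comparison[OF D_open D_bounded]) (use assms in \<open>auto simp: closure_D frontier_D\<close>)

lemma vsub_add_h:
  assumes "X \<subseteq> \<Omega>" "open X" "continuous_on (closure \<Omega>) u" "\<And>y. y \<in> X \<Longrightarrow> vsub_at F u y" "0 \<le> s" "x \<in> X"
  shows "vsub_at F (\<lambda>y. u y + s * (h y - h x0)) x"
proof -
  have "X \<subseteq> closure \<Omega>" using assms(1) \<Omega>_closure by blast
  then have c: "continuous_on X u" "continuous_on X (\<lambda>y. s * h y)"
    using assms(3) h_cont by (auto intro!: continuous_intros intro: continuous_on_subset)
  have "vsub_at F (\<lambda>y. (u y + s * h y) + - (s * h x0)) x"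
    by (intro vsub_at_add_const vsub_add[OF assms(2,6)] c assms(4) vsub_scale assms(5))
       (use h_sub assms(1) in auto)
  then show ?thesis by (simp add: algebra_simps)
qed

lemma dual_h:
  assumes "x \<in> D" "s > 0"
  shows "vsub_at (dual_subeq F) (\<lambda>y. - (c + s * (h y - h x0))) x"
proof -
  have "vsub_at (dual_subeq F) (\<lambda>y. s * (- h y) + (s * h x0 - c)) x"
    by (intro vsub_at_add_const vsub_at_scale h_dual assms) (rule dual_subeq_scaleR[OF cone _ assms(2)])
  then show ?thesis by (simp add: algebra_simps)
qed

text \<open>Take \<open>b = H + (norm x)\<^sup>2\<close>, where \<open>H\<close> has boundary values
  \<open>- (norm x)\<^sup>2\<close>. If \<open>b x0\<close> were zero,
  \<open>- (norm x)\<^sup>2\<close> would touch \<open>H\<close> from above and put a negative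
  multiple of the identity into \<open>F\<close>. Multiples of \<open>b\<close> lower the value at
  \<open>x0\<close> without changing boundary data.\<close>

lemma negative_subsolution:
  obtains b where "continuous_on (closure \<Omega>) b" "\<And>x. x \<in> \<Omega> \<Longrightarrow> vsub_at F b x"
    "\<And>x. x \<in> frontier \<Omega> \<Longrightarrow> b x = 0" "b x0 < 0"
proof -
  have C: "C2on UNIV (\<lambda>y::real^'n. (norm (y - 0))\<^sup>2) (\<lambda>y. 2 *\<^sub>R (y - 0)) (\<lambda>y. 2 *\<^sub>R mat 1)"
    by (rule C2on_quad) simp
  have sq: "vsub_at F (\<lambda>y. (norm (y - 0))\<^sup>2) x" for x
    by (rule C2on_vsub_at[OF C UNIV_I _ add_psd]) (intro scaleR_mem psd_mem psd_mat_1, simp)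
  have "continuous_on (frontier \<Omega>) (\<lambda>y. - (norm (y - 0))\<^sup>2)" by (intro continuous_intros)
  from dirichlet_problem[OF dom bdry this]
  obtain H where H: "continuous_on (closure \<Omega>) H" "\<And>x. x \<in> \<Omega> \<Longrightarrow> vsub_at F H x"
    "\<And>x. x \<in> frontier \<Omega> \<Longrightarrow> H x = - (norm (x - 0))\<^sup>2" by blast
  define b where "b = (\<lambda>x. H x + (norm (x - 0))\<^sup>2)"
  have cb: "continuous_on (closure \<Omega>) b" unfolding b_def by (intro continuous_intros H)
  have vb: "vsub_at F b x" if "x \<in> \<Omega>" for x
    unfolding b_def
    by (rule vsub_add[OF dom(1) that continuous_on_subset[OF H(1) \<Omega>_closure] H(2) _ sq])
       (auto intro: continuous_intros)
  have b0: "b x = 0" if "x \<in> frontier \<Omega>" for x using H(3)[OF that] by (simp add: b_def)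
  have le: "b x \<le> 0" if "x \<in> closure \<Omega>" for x
    by (rule vsub_max_principle[OF dom cb vb _ that]) (use b0 in auto)
  have "b x0 \<noteq> 0"
  proof
    assume z: "b x0 = 0"
    have "\<forall>\<^sub>F y in nhds x0. y \<in> \<Omega>" using dom(1) x0 by (rule eventually_nhds_in_open)
    then have "\<forall>\<^sub>F y in nhds x0. H y \<le> (-1) * (norm (y - 0))\<^sup>2"
    proof eventually_elim
      case (elim y)
      then have "b y \<le> 0" using le \<Omega>_closure by blast
      then show ?case by (simp add: b_def)
    qed
    from vsub_atD[OF H(2)[OF x0] C2on_scale[OF C, of "-1"] UNIV_I this]
    have "(-1) *\<^sub>R 2 *\<^sub>R mat 1 \<in> F" using z by (simp add: b_def)
    from scaleR_mem[OF this, of "1/2"] show False using neg_id by simp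
  qed
  then have "b x0 < 0" using le[OF x0_closure] by linarith
  then show ?thesis using that cb vb b0 by blast
qed

end

section \<open>Solutions with a prescribed value at \<open>x0\<close> and their densities\<close>

locale boundary_data = singular_dirichlet F \<Omega> x0 h m M
  for F :: "(real^'n^'n) set" and \<Omega> x0 h m M +
  fixes \<phi> H0
  assumes \<phi>: "continuous_on (frontier \<Omega>) \<phi>"
    and H0_cont: "continuous_on (closure \<Omega>) H0"
    and H0_sub: "\<And>x. x \<in> \<Omega> \<Longrightarrow> vsub_at F H0 x"
    and H0_dual: "\<And>x. x \<in> \<Omega> \<Longrightarrow> vsub_at (dual_subeq F) (\<lambda>y. - H0 y) x"
    and H0_bdry: "\<And>x. x \<in> frontier \<Omega> \<Longrightarrow> H0 x = \<phi> x"
begin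

text \<open>Subharmonicity is required across \<open>x0\<close>, the dual condition only off it;
  this is the setting of (H3).\<close>

definition solves :: "real \<Rightarrow> (real^'n \<Rightarrow> real) \<Rightarrow> bool" where
  "solves c H \<longleftrightarrow> continuous_on (closure \<Omega>) H \<and> (\<forall>x\<in>\<Omega>. vsub_at F H x)
     \<and> (\<forall>x\<in>D. vsub_at (dual_subeq F) (\<lambda>y. - H y) x) \<and> (\<forall>x\<in>frontier \<Omega>. H x = \<phi> x) \<and> H x0 = c"

lemma H0_solves: "solves (H0 x0) H0"
  using H0_cont H0_sub H0_dual H0_bdry by (auto simp: solves_def)

lemma solves_maximal:
  assumes "solves c H" "continuous_on (closure \<Omega>) u" "\<And>x. x \<in> D \<Longrightarrow> vsub_at F u x"
    "\<And>x. x \<in> frontier \<Omega> \<Longrightarrow> u x \<le> \<phi> x" "u x0 \<le> c" "x \<in> closure \<Omega>"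
  shows "u x \<le> H x"
  by (rule punctured_comparison[OF assms(2,3)]) (use assms in \<open>auto simp: solves_def\<close>)

text \<open>\<open>H0\<close> is lowered to the value \<open>c\<close> at \<open>x0\<close>; the
  slope of the multiple of \<open>h - h x0\<close> is the largest for which the bound
  \<open>M\<close> keeps frontier values below \<phi>.\<close>

definition barrier :: "real \<Rightarrow> real^'n \<Rightarrow> real" where
  "barrier c = (\<lambda>x. H0 x + (H0 x0 - c) / M * (h x - h x0) + - (H0 x0 - c))"

lemma barrier:
  assumes c: "c \<le> H0 x0"
  shows "continuous_on (closure \<Omega>) (barrier c)" "\<And>x. x \<in> \<Omega> \<Longrightarrow> vsub_at F (barrier c) x"
    "\<And>x. x \<in> frontier \<Omega> \<Longrightarrow> barrier c x \<le> \<phi> x" "barrier c x0 = c"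
proof -
  define s where "s = (H0 x0 - c) / M"
  have s: "s \<ge> 0" "s * M = H0 x0 - c" using c M_pos by (auto simp: s_def)
  show "continuous_on (closure \<Omega>) (barrier c)"
    unfolding barrier_def by (intro continuous_intros H0_cont h_cont)
  show "vsub_at F (barrier c) x" if "x \<in> \<Omega>" for x
    unfolding barrier_def s_def[symmetric] using H0_sub s that dom(1)
    by (intro vsub_at_add_const vsub_add_h[of \<Omega>] H0_cont) auto
  show "barrier c x \<le> \<phi> x" if "x \<in> frontier \<Omega>" for x
  proof -
    have "s * (h x - h x0) \<le> s * M" using h_bdry[OF that] s(1) by (intro mult_left_mono) auto
    then show ?thesis using H0_bdry[OF that] s(2) by (simp add: barrier_def s_def[symmetric])
  qed
  show "barrier c x0 = c" by (simp add: barrier_def)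
qed

text \<open>Perron's method on \<open>D\<close>, with the value \<open>c\<close> as boundary datum
  at \<open>x0\<close>. A multiple of the negative subsolution gives a lower barrier attaining all
  data; above, \<open>H0\<close> controls the frontier of \<Omega> and a multiple of
  \<open>h - h x0\<close> controls \<open>x0\<close>.\<close>

lemma solution_exists:
  assumes c: "c \<le> H0 x0"
  shows "\<exists>H. solves c H"
proof -
  note w0 = barrier[OF c]
  obtain b where b: "continuous_on (closure \<Omega>) b" "\<And>x. x \<in> \<Omega> \<Longrightarrow> vsub_at F b x"
    "\<And>x. x \<in> frontier \<Omega> \<Longrightarrow> b x = 0" "b x0 < 0"
    using negative_subsolution by blast
  \<comment> \<open>Chosen so that \<open>w1 x0 = c\<close>.\<close>
  define K where "K = (H0 x0 - c) / (- b x0)"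
  have K: "K \<ge> 0" "K * b x0 = c - H0 x0" using c b(4) by (auto simp: K_def field_simps)
  define w1 where "w1 = (\<lambda>x. H0 x + K * b x)"
  have cw1: "continuous_on (closure \<Omega>) w1" unfolding w1_def by (intro continuous_intros H0_cont b)
  have vw1: "vsub_at F w1 x" if "x \<in> \<Omega>" for x
    unfolding w1_def
    by (rule vsub_add[OF dom(1) that continuous_on_subset[OF H0_cont \<Omega>_closure] H0_sub])
       (use K b in \<open>auto intro!: vsub_scale continuous_intros continuous_on_subset[OF b(1) \<Omega>_closure]\<close>)
  define w where "w = (\<lambda>x. max (barrier c x) (w1 x))"
  define \<phi>' where "\<phi>' = (\<lambda>x. if x = x0 then c else \<phi> x)"
  have nx0: "x \<noteq> x0" if "x \<in> frontier \<Omega>" for x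
    using that x0 by (auto simp: frontier_open[OF dom(1)])
  have vw: "vsub_at F w x" if "x \<in> \<Omega>" for x
    unfolding w_def using w0(2)[OF that] vw1[OF that] by (rule vsub_at_max)
  have w_eq: "w x = \<phi>' x" if "x \<in> frontier D" for x
    using that w0(3,4) nx0 K(2) H0_bdry b(3) by (auto simp: frontier_D w_def w1_def \<phi>'_def max_def)
  have wP: "w \<in> perron_class D \<phi>'"
    using w_eq vw w0(1) cw1 by (auto simp: perron_class_def closure_D w_def intro!: continuous_intros)
  have "bounded (\<phi> ` frontier \<Omega>)"
    by (rule compact_imp_bounded[OF compact_continuous_image[OF \<phi> compact_frontier_bounded[OF dom(2)]]])
  then obtain N where N: "N > 0" "\<And>x. x \<in> frontier \<Omega> \<Longrightarrow> \<bar>\<phi> x\<bar> \<le> N"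
    unfolding bounded_pos by auto
  \<comment> \<open>On the frontier of \<Omega> the increment is at least
    \<open>N + \<bar>c\<bar>\<close>, so \<open>c + s * (h x - h x0)\<close> is at least
    \<open>N\<close>, above all data.\<close>
  define s where "s = (N + \<bar>c\<bar>) / m"
  have s: "s > 0" "s * m = N + \<bar>c\<bar>" using N(1) m_pos by (auto simp: s_def)
  define v where "v = (\<lambda>x. min (H0 x) (c + s * (h x - h x0)))"
  have cv: "continuous_on (closure \<Omega>) v"
    unfolding v_def by (intro continuous_intros H0_cont h_cont)
  have uv: "u x \<le> v x" if u: "u \<in> perron_class D \<phi>'" and x: "x \<in> closure \<Omega>" for u x
  proof -
    have uc: "continuous_on (closure \<Omega>) u" "\<And>x. x \<in> D \<Longrightarrow> vsub_at F u x"
      "\<And>x. x \<in> frontier \<Omega> \<Longrightarrow> u x \<le> \<phi> x" "u x0 \<le> c"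
      using u nx0 by (auto simp: perron_class_def closure_D frontier_D \<phi>'_def)
    have "u x \<le> H0 x"
      by (rule solves_maximal[OF H0_solves uc(1,2,3) _ x]) (use uc(4) c in auto)
    moreover have "u x \<le> c + s * (h x - h x0)"
    proof (rule punctured_comparison[OF uc(1,2) _ dual_h[OF _ s(1)] _ _ x])
      show "continuous_on (closure \<Omega>) (\<lambda>x. c + s * (h x - h x0))" by (intro continuous_intros h_cont)
      show "u y \<le> c + s * (h y - h x0)" if y: "y \<in> frontier \<Omega>" for y
      proof -
        have "s * m \<le> s * (h y - h x0)" using h_bdry[OF y] s(1) by (intro mult_left_mono) auto
        then show ?thesis using uc(3)[OF y] N(2)[OF y] s(2) by linarith
      qed
    qed (use uc in auto)
    ultimately show ?thesis by (simp add: v_def)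
  qed
  have v_le: "v x \<le> \<phi>' x" if "x \<in> frontier D" for x
    using that nx0 H0_bdry by (auto simp: frontier_D v_def \<phi>'_def)
  have "\<exists>H\<in>perron_class D \<phi>'. (\<forall>x\<in>frontier D. H x = \<phi>' x)
    \<and> (\<forall>x\<in>D. vsub_at (dual_subeq F) (\<lambda>y. - H y) x)
    \<and> (\<forall>u\<in>perron_class D \<phi>'. \<forall>x\<in>closure D. u x \<le> H x)"
  proof (rule perron[OF D_open D_bounded])
    show "\<exists>w\<in>perron_class D \<phi>'. \<forall>x\<in>frontier D. \<phi>' x - \<epsilon> \<le> w x" if "\<epsilon> > 0" for \<epsilon>
      using wP w_eq that by (intro bexI[of _ w]) auto
    show "\<exists>v. continuous_on (closure D) v \<and> (\<forall>x\<in>frontier D. v x \<le> \<phi>' x + \<epsilon>)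
        \<and> (\<forall>u\<in>perron_class D \<phi>'. \<forall>x\<in>closure D. u x \<le> v x)" if "\<epsilon> > 0" for \<epsilon>
      using cv uv v_le that by (intro exI[of _ v]) (auto simp: closure_D intro: add_increasing2)
  qed
  then obtain H where H: "H \<in> perron_class D \<phi>'" "\<And>x. x \<in> frontier D \<Longrightarrow> H x = \<phi>' x"
    "\<And>x. x \<in> D \<Longrightarrow> vsub_at (dual_subeq F) (\<lambda>y. - H y) x"
    "\<And>u x. u \<in> perron_class D \<phi>' \<Longrightarrow> x \<in> closure D \<Longrightarrow> u x \<le> H x" by blast
  have Hx0: "H x0 = c" using H(2)[of x0] by (simp add: frontier_D \<phi>'_def)
  \<comment> \<open>Perron's method says nothing at \<open>x0\<close> itself; there
    \<open>w\<close>, a subsolution on all of \<Omega>, touches \<open>H\<close> from below.\<close>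
  have "vsub_at F H x" if x: "x \<in> \<Omega>" for x
  proof (cases "x = x0")
    case True
    show ?thesis
    proof (rule vsub_at_mono[OF vw[OF x]])
      show "w x = H x" using w_eq[of x0] Hx0 True by (simp add: frontier_D \<phi>'_def)
      show "\<forall>\<^sub>F y in nhds x. w y \<le> H y"
        using eventually_nhds_in_open[OF dom(1) x]
        by eventually_elim (use H(4)[OF wP] \<Omega>_closure in \<open>auto simp: closure_D\<close>)
    qed
  next
    case False
    then show ?thesis using H(1) x by (auto simp: perron_class_def)
  qed
  moreover have "H x = \<phi> x" if "x \<in> frontier \<Omega>" for x
    using H(2)[of x] that nx0[OF that] by (simp add: frontier_D \<phi>'_def)
  ultimately show ?thesis
    using H(1,3) Hx0 by (intro exI[of _ H]) (auto simp: solves_def perron_class_def closure_D)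
qed

definition sol :: "real \<Rightarrow> real^'n \<Rightarrow> real" where
  "sol c = (SOME H. solves c H)"

lemma sol: "c \<le> H0 x0 \<Longrightarrow> solves c (sol c)"
  unfolding sol_def using solution_exists by (rule someI_ex)

lemma sol_cont: "c \<le> H0 x0 \<Longrightarrow> continuous_on (closure \<Omega>) (sol c)"
  and sol_sub: "c \<le> H0 x0 \<Longrightarrow> x \<in> \<Omega> \<Longrightarrow> vsub_at F (sol c) x"
  and sol_dual: "c \<le> H0 x0 \<Longrightarrow> x \<in> D \<Longrightarrow> vsub_at (dual_subeq F) (\<lambda>y. - sol c y) x"
  and sol_bdry: "c \<le> H0 x0 \<Longrightarrow> x \<in> frontier \<Omega> \<Longrightarrow> sol c x = \<phi> x"
  and sol_center: "c \<le> H0 x0 \<Longrightarrow> sol c x0 = c"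
  using sol by (auto simp: solves_def)

definition dens :: "real \<Rightarrow> real" where
  "dens c = (THE L. ((\<lambda>x. (sol c x - c) / (h x - h x0)) \<longlongrightarrow> L) (at x0))"

lemma dens:
  assumes c: "c \<le> H0 x0"
  shows "((\<lambda>x. (sol c x - c) / (h x - h x0)) \<longlongrightarrow> dens c) (at x0)" "0 \<le> dens c"
proof -
  obtain L where L: "L \<ge> 0" "((\<lambda>x. (sol c x - sol c x0) / (h x - h x0)) \<longlongrightarrow> L) (at x0)"
    using density[OF continuous_on_subset[OF sol_cont[OF c] \<Omega>_closure] sol_sub[OF c] sol_dual[OF c]]
    by blast
  then have L': "((\<lambda>x. (sol c x - c) / (h x - h x0)) \<longlongrightarrow> L) (at x0)" using sol_center[OF c] by simp
  then have "dens c = L"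
    unfolding dens_def by (rule the_equality) (use L' tendsto_unique[OF trivial_limit_at] in blast)
  then show "((\<lambda>x. (sol c x - c) / (h x - h x0)) \<longlongrightarrow> dens c) (at x0)" "0 \<le> dens c"
    using L(1) L' by auto
qed

lemma near_x0: "\<forall>\<^sub>F x in at x0. x \<in> \<Omega> \<and> h x0 < h x"
  using eventually_at_in_open'[OF dom(1) x0] h_min by eventually_elim auto

text \<open>The convex combination of two solutions is a subsolution with the same boundary data,
  hence lies below the solution with the combined value; both have that value at \<open>x0\<close>,
  so the quotients compare. The half-line is open because convex functions on open sets are
  continuous.\<close>

lemma dens_concave: "convex_on {..<H0 x0} (\<lambda>c. - dens c)"
proof (rule convex_onI)
  fix t c d :: real
  assume t: "0 < t" "t < 1" and c: "c \<in> {..<H0 x0}" and d: "d \<in> {..<H0 x0}"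
  let ?e = "(1 - t) *\<^sub>R c + t *\<^sub>R d"
  have e: "?e \<in> {..<H0 x0}"
    by (rule convexD[OF _ c d]) (use t in \<open>auto simp: convex_real_interval\<close>)
  have c': "c \<le> H0 x0" and d': "d \<le> H0 x0" and e': "?e \<le> H0 x0" using c d e by auto
  let ?u = "\<lambda>x. (1 - t) * sol c x + t * sol d x"
  have cu: "continuous_on S (\<lambda>x. r * sol a x)" if "S \<subseteq> closure \<Omega>" "a \<le> H0 x0" for S r a
    by (intro continuous_intros continuous_on_subset[OF sol_cont that(1)] that)
  have le: "?u x \<le> sol ?e x" if x: "x \<in> closure \<Omega>" for x
  proof (rule solves_maximal[OF sol[OF e'] _ _ _ _ x])
    show "continuous_on (closure \<Omega>) ?u" by (intro continuous_intros sol_cont c' d')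
    show "vsub_at F ?u y" if "y \<in> D" for y
      using \<Omega>_closure that t c' d'
      by (intro vsub_add[OF dom(1)] cu vsub_scale sol_sub) auto
    show "?u y \<le> \<phi> y" if "y \<in> frontier \<Omega>" for y
      using sol_bdry[OF c' that] sol_bdry[OF d' that] by (simp add: algebra_simps)
    show "?u x0 \<le> ?e" using sol_center c' d' by simp
  qed
  have "(1 - t) * dens c + t * dens d \<le> dens ?e"
  proof (rule tendsto_le[OF trivial_limit_at])
    show "((\<lambda>x. (sol ?e x - ?e) / (h x - h x0)) \<longlongrightarrow> dens ?e) (at x0)" by (rule dens(1)[OF e'])
    show "((\<lambda>x. (1 - t) * ((sol c x - c) / (h x - h x0)) + t * ((sol d x - d) / (h x - h x0)))
        \<longlongrightarrow> (1 - t) * dens c + t * dens d) (at x0)"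
      by (intro tendsto_intros dens(1) c' d')
    show "\<forall>\<^sub>F x in at x0. (1 - t) * ((sol c x - c) / (h x - h x0)) + t * ((sol d x - d) / (h x - h x0))
        \<le> (sol ?e x - ?e) / (h x - h x0)"
      using near_x0
    proof eventually_elim
      case (elim x)
      have "(1 - t) * ((sol c x - c) / (h x - h x0)) + t * ((sol d x - d) / (h x - h x0))
          = (?u x - ?e) / (h x - h x0)"
        by (simp add: add_divide_distrib[symmetric] algebra_simps)
      also have "\<dots> \<le> (sol ?e x - ?e) / (h x - h x0)"
        using le[of x] elim \<Omega>_closure by (intro divide_right_mono) auto
      finally show ?case .
    qed
  qed
  then show "- dens ?e \<le> (1 - t) * - dens c + t * - dens d" by simp
qed (simp add: convex_real_interval)

lemma H0_density: "((\<lambda>x. (H0 x - H0 x0) / (h x - h x0)) \<longlongrightarrow> 0) (at x0)"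
  by (rule density_zero[OF continuous_on_subset[OF H0_cont \<Omega>_closure] H0_sub H0_dual])

text \<open>The barrier touches the solution from below at \<open>x0\<close>, and by (H4) its
  density is its coefficient of \<open>h - h x0\<close>.\<close>

lemma dens_lower:
  assumes c: "c \<le> H0 x0"
  shows "(H0 x0 - c) / M \<le> dens c"
proof (rule tendsto_le[OF trivial_limit_at dens(1)[OF c]])
  note w0 = barrier[OF c]
  have le: "barrier c x \<le> sol c x" if "x \<in> closure \<Omega>" for x
    by (rule solves_maximal[OF sol[OF c] w0(1) w0(2) w0(3) _ that]) (use w0(4) in auto)
  show "((\<lambda>x. (H0 x - H0 x0) / (h x - h x0) + (H0 x0 - c) / M) \<longlongrightarrow> (H0 x0 - c) / M) (at x0)"
    using tendsto_add[OF H0_density tendsto_const[of "(H0 x0 - c) / M"]] by simp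
  show "\<forall>\<^sub>F x in at x0. (H0 x - H0 x0) / (h x - h x0) + (H0 x0 - c) / M \<le> (sol c x - c) / (h x - h x0)"
    using near_x0
  proof eventually_elim
    case (elim x)
    have "(H0 x - H0 x0) / (h x - h x0) + (H0 x0 - c) / M = (barrier c x - c) / (h x - h x0)"
      using elim by (simp add: barrier_def field_simps)
    also have "\<dots> \<le> (sol c x - c) / (h x - h x0)"
      using le[of x] elim \<Omega>_closure by (intro divide_right_mono) auto
    finally show ?case .
  qed
qed

text \<open>The density has no jump at the removable value: in a small punctured ball, where the regular
  solution grows slower than \<open>\<epsilon> (h - h x0)\<close>, the solution is compared with
  \<open>c + 2 \<epsilon> (h - h x0)\<close>.\<close>

lemma dens_small:
  assumes e: "\<epsilon> > 0"
  shows "\<exists>c<H0 x0. dens c \<le> 2 * \<epsilon>"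
proof -
  have "\<forall>\<^sub>F x in at x0. (H0 x - H0 x0) / (h x - h x0) < \<epsilon>"
    by (rule order_tendstoD(2)[OF H0_density e])
  then have "\<forall>\<^sub>F x in at x0. (H0 x - H0 x0) / (h x - h x0) < \<epsilon> \<and> x \<in> \<Omega> \<and> h x0 < h x"
    using near_x0 by eventually_elim auto
  then obtain r0 where r0: "r0 > 0" "\<And>x. x \<noteq> x0 \<Longrightarrow> dist x x0 < r0 \<Longrightarrow>
      (H0 x - H0 x0) / (h x - h x0) < \<epsilon> \<and> x \<in> \<Omega> \<and> h x0 < h x"
    unfolding eventually_at by auto
  define r where "r = r0 / 2"
  have r: "r > 0" "\<And>x. x \<noteq> x0 \<Longrightarrow> x \<in> cball x0 r \<Longrightarrow>
      (H0 x - H0 x0) / (h x - h x0) < \<epsilon> \<and> x \<in> \<Omega> \<and> h x0 < h x"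
    using r0 by (auto simp: r_def dist_commute)
  have sub: "cball x0 r \<subseteq> \<Omega>"
  proof
    fix x assume "x \<in> cball x0 r"
    then show "x \<in> \<Omega>" using r(2)[of x] x0 by (cases "x = x0") auto
  qed
  have sp: "sphere x0 r \<noteq> {}" using r(1) by simp
  have cs: "continuous_on (sphere x0 r) h"
    using sub \<Omega>_closure sphere_cball by (intro continuous_on_subset[OF h_cont]) blast
  obtain z where z: "z \<in> sphere x0 r" "\<And>x. x \<in> sphere x0 r \<Longrightarrow> h z \<le> h x"
    using continuous_attains_inf[OF compact_sphere sp cs] by blast
  have zpos: "h x0 < h z" using r(2)[of z] z(1) r(1) by auto
  \<comment> \<open>The drop below \<open>H0 x0\<close> is \<epsilon> times the least value of
    \<open>h - h x0\<close> on the sphere. There \<open>sol c\<close> is at most \<open>H0\<close>,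
    hence at most \<open>H0 x0 + \<epsilon> * (h - h x0)\<close>, and a second \<epsilon> covers the
    drop.\<close>
  define c where "c = H0 x0 - \<epsilon> * (h z - h x0)"
  have c: "c < H0 x0" using e zpos by (simp add: c_def)
  then have c': "c \<le> H0 x0" by simp
  have le0: "sol c x \<le> H0 x" if "x \<in> closure \<Omega>" for x
    by (rule solves_maximal[OF H0_solves sol_cont[OF c'] _ _ _ that])
       (use sol_sub sol_bdry sol_center c' in auto)
  let ?B = "ball x0 r - {x0}"
  have clB: "closure ?B \<subseteq> cball x0 r" using closure_mono[of ?B "ball x0 r"] r(1) by auto
  have fB: "x = x0 \<or> x \<in> sphere x0 r" if "x \<in> frontier ?B" for x
  proof -
    have "x \<in> closure ?B - ?B"
      using that frontier_open[OF open_delete[OF open_ball[of x0 r], of x0]] by simp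
    then have "x \<in> cball x0 r" "x \<notin> ?B" using clB by blast+
    then show ?thesis by auto
  qed
  have le_cl: "sol c x \<le> c + (2 * \<epsilon>) * (h x - h x0)" if x: "x \<in> closure ?B" for x
  proof (rule comparison[of ?B "sol c" "\<lambda>x. c + (2 * \<epsilon>) * (h x - h x0)", OF _ _ _ _ _ _ _ x])
    have clB': "closure ?B \<subseteq> closure \<Omega>" using clB sub \<Omega>_closure by blast
    show "continuous_on (closure ?B) (sol c)" by (rule continuous_on_subset[OF sol_cont[OF c'] clB'])
    show "continuous_on (closure ?B) (\<lambda>x. c + (2 * \<epsilon>) * (h x - h x0))"
      by (intro continuous_intros continuous_on_subset[OF h_cont clB'])
    have BD: "y \<in> D" if "y \<in> ?B" for y using that sub ball_subset_cball by blast
    show "vsub_at F (sol c) y" if "y \<in> ?B" for y using sol_sub[OF c'] BD[OF that] by blast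
    show "vsub_at (dual_subeq F) (\<lambda>x. - (c + (2 * \<epsilon>) * (h x - h x0))) y" if "y \<in> ?B" for y
      using dual_h[OF BD[OF that], of "2 * \<epsilon>" c] e by simp
    show "sol c y \<le> c + (2 * \<epsilon>) * (h y - h x0)" if "y \<in> frontier ?B" for y
      using fB[OF that]
    proof
      assume y: "y \<in> sphere x0 r"
      then have y': "y \<noteq> x0" "y \<in> cball x0 r" using r(1) by auto
      have q: "(H0 y - H0 x0) / (h y - h x0) < \<epsilon>" "0 < h y - h x0" using r(2)[OF y'] by auto
      have "H0 y - H0 x0 \<le> \<epsilon> * (h y - h x0)"
        using q(1) unfolding pos_divide_less_eq[OF q(2)] by (rule less_imp_le)
      moreover have "\<epsilon> * (h z - h x0) \<le> \<epsilon> * (h y - h x0)"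
        using z(2)[OF y] e by (intro mult_left_mono) auto
      moreover have "sol c y \<le> H0 y" using le0 r(2)[OF y'] \<Omega>_closure by blast
      ultimately show ?thesis by (simp add: c_def)
    qed (simp add: sol_center[OF c'])
    show "open ?B" "bounded ?B" by (auto intro: bounded_subset[OF bounded_ball])
  qed
  have le: "sol c x \<le> c + (2 * \<epsilon>) * (h x - h x0)" if "x \<in> ?B" for x
    by (rule le_cl[OF subsetD[OF closure_subset that]])
  have "dens c \<le> 2 * \<epsilon>"
  proof (rule tendsto_le[OF trivial_limit_at tendsto_const dens(1)[OF c']])
    have "\<forall>\<^sub>F x in at x0. x \<in> ball x0 r \<and> x \<noteq> x0"
      using eventually_at_in_open[of "ball x0 r" x0] r(1) by (auto elim!: eventually_mono)
    then show "\<forall>\<^sub>F x in at x0. (sol c x - c) / (h x - h x0) \<le> 2 * \<epsilon>"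
      using near_x0
    proof eventually_elim
      case (elim x)
      then have "sol c x - c \<le> (2 * \<epsilon>) * (h x - h x0)" using le[of x] by simp
      then show ?case using elim by (simp add: pos_divide_le_eq)
    qed
  qed
  then show ?thesis using c by blast
qed

lemma density_attained:
  assumes \<Theta>: "0 \<le> \<Theta>"
  shows "\<exists>H. continuous_on (closure \<Omega>) H \<and> (\<forall>x\<in>D. vsub_at F H x)
    \<and> (\<forall>x\<in>D. vsub_at (dual_subeq F) (\<lambda>y. - H y) x) \<and> (\<forall>x\<in>frontier \<Omega>. H x = \<phi> x)
    \<and> ((\<lambda>x. (H x - H x0) / (h x - h x0)) \<longlongrightarrow> \<Theta>) (at x0)"
proof (cases "\<Theta> = 0")
  case True
  then show ?thesis
    by (intro exI[of _ H0]) (use H0_density H0_cont H0_sub H0_dual H0_bdry in auto)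
next
  case False
  then have pos: "\<Theta> / 2 > 0" using \<Theta> by simp
  obtain b where b: "b < H0 x0" "dens b \<le> \<Theta>" using dens_small[OF pos] by auto
  \<comment> \<open>Low enough for \<open>dens_lower\<close> to give a density of at least \<Theta>,
    and not above \<open>b\<close>; the intermediate value theorem then works on
    \<open>{a..b}\<close>.\<close>
  define a where "a = min b (H0 x0 - \<Theta> * M)"
  have a: "a \<le> b" "a \<le> H0 x0" using b(1) by (auto simp: a_def)
  have "\<Theta> * M \<le> H0 x0 - a" by (simp add: a_def)
  then have "\<Theta> \<le> (H0 x0 - a) / M" using M_pos by (simp add: pos_le_divide_eq)
  then have da: "\<Theta> \<le> dens a" using dens_lower[OF a(2)] by linarith
  have "continuous_on {..<H0 x0} (\<lambda>c. - dens c)"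
    by (rule convex_on_continuous[OF open_lessThan dens_concave])
  then have "continuous_on {..<H0 x0} dens" using continuous_on_minus by fastforce
  then have "continuous_on {a..b} dens" by (rule continuous_on_subset) (use b in auto)
  from IVT2'[OF b(2) da a(1) this] obtain c where c: "c \<le> b" "dens c = \<Theta>" by auto
  then have c': "c \<le> H0 x0" using b(1) by simp
  show ?thesis
    by (intro exI[of _ "sol c"])
       (use sol_cont sol_sub sol_dual sol_bdry sol_center dens(1)[OF c'] c' c(2) in auto)
qed

end

section \<open>Uniqueness for a given density\<close>

context singular_dirichlet begin

text \<open>If \<open>H x0\<close> exceeded \<open>H' x0\<close>, then \<open>H\<close> plus a small multiple of \<open>h - h x0\<close> would lie below
  \<open>H' + H x0 - H' x0\<close>, although equal densities force the opposite inequality near \<open>x0\<close>.\<close>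

lemma density_le:
  assumes H: "continuous_on (closure \<Omega>) H" "\<And>x. x \<in> D \<Longrightarrow> vsub_at F H x"
    and H': "continuous_on (closure \<Omega>) H'" "\<And>x. x \<in> D \<Longrightarrow> vsub_at (dual_subeq F) (\<lambda>y. - H' y) x"
    and bd: "\<And>x. x \<in> frontier \<Omega> \<Longrightarrow> H x = H' x"
    and lim: "((\<lambda>x. (H x - H x0) / (h x - h x0)) \<longlongrightarrow> \<Theta>) (at x0)"
      "((\<lambda>x. (H' x - H' x0) / (h x - h x0)) \<longlongrightarrow> \<Theta>) (at x0)"
    and x: "x \<in> closure \<Omega>"
  shows "H x \<le> H' x"
proof -
  have "H x0 \<le> H' x0"
  proof (rule ccontr)
    define N where "N = H x0 - H' x0"
    assume "\<not> H x0 \<le> H' x0"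
    then have N: "N > 0" by (simp add: N_def)
    \<comment> \<open>The largest slope for which \<open>\<epsilon> * (h - h x0)\<close> is certain
      to stay below the gap \<open>N\<close> on the frontier.\<close>
    define \<epsilon> where "\<epsilon> = N / M"
    have e: "\<epsilon> > 0" "\<epsilon> * M = N" using N M_pos by (auto simp: \<epsilon>_def)
    have le: "H y + \<epsilon> * (h y - h x0) \<le> H' y + N" if y: "y \<in> closure \<Omega>" for y
    proof (rule punctured_comparison[OF _ _ _ _ _ _ y])
      show "continuous_on (closure \<Omega>) (\<lambda>y. H y + \<epsilon> * (h y - h x0))"
        by (intro continuous_intros H h_cont)
      show "vsub_at F (\<lambda>y. H y + \<epsilon> * (h y - h x0)) z" if "z \<in> D" for z
        using e that by (intro vsub_add_h[of D] H D_open) auto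
      show "continuous_on (closure \<Omega>) (\<lambda>y. H' y + N)" by (intro continuous_intros H')
      show "vsub_at (dual_subeq F) (\<lambda>y. - (H' y + N)) z" if "z \<in> D" for z
        using vsub_at_add_const[OF H'(2)[OF that], of "- N"] by simp
      show "H z + \<epsilon> * (h z - h x0) \<le> H' z + N" if z: "z \<in> frontier \<Omega>" for z
      proof -
        have "\<epsilon> * (h z - h x0) \<le> \<epsilon> * M" using h_bdry[OF z] e(1) by (intro mult_left_mono) auto
        then show ?thesis using bd[OF z] e(2) by simp
      qed
    qed (simp add: N_def)
    \<comment> \<open>Equal densities make the difference of the quotients tend to zero, whereas
      \<open>le\<close> keeps it at or below \<open>- \<epsilon>\<close> near
      \<open>x0\<close>.\<close>
    have "((\<lambda>x. (H x - H x0) / (h x - h x0) - (H' x - H' x0) / (h x - h x0)) \<longlongrightarrow> \<Theta> - \<Theta>) (at x0)"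
      by (intro tendsto_diff lim)
    then have "\<forall>\<^sub>F x in at x0. - \<epsilon> < (H x - H x0) / (h x - h x0) - (H' x - H' x0) / (h x - h x0)"
      by (rule order_tendstoD) (use e in simp)
    moreover have "\<forall>\<^sub>F x in at x0. x \<in> \<Omega>" using dom(1) x0 by (rule eventually_at_in_open')
    ultimately have "\<forall>\<^sub>F x in at x0. False"
      using h_min
    proof eventually_elim
      case (elim y)
      have "- \<epsilon> < ((H y - H x0) - (H' y - H' x0)) / (h y - h x0)"
        using elim(1) by (simp add: diff_divide_distrib)
      then have "- \<epsilon> * (h y - h x0) < (H y - H x0) - (H' y - H' x0)"
        using elim(3) by (simp add: pos_less_divide_eq)
      moreover have "H y + \<epsilon> * (h y - h x0) \<le> H' y + N" using le elim(2) \<Omega>_closure by blast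
      ultimately show False by (simp add: N_def)
    qed
    then show False by simp
  qed
  then show ?thesis using punctured_comparison[OF H H' _ _ x] bd by simp
qed

end

section \<open>From the hypotheses on \<open>F\<close> and \<open>h\<close> to the theorem\<close>

lemma psd_id_minus_proj_mat:
  fixes e :: "real^'n"
  assumes "norm e = 1"
  shows "psd (mat 1 - proj_mat e)"
proof -
  have "0 \<le> x \<bullet> ((mat 1 - proj_mat e) *v x)" for x
  proof -
    have "(e \<bullet> x)\<^sup>2 \<le> (norm e * norm x)\<^sup>2"
      using Cauchy_Schwarz_ineq2[of e x] by (metis abs_le_square_iff abs_mult abs_norm_cancel)
    then have "(e \<bullet> x)\<^sup>2 \<le> x \<bullet> x"
      using assms by (simp add: power2_norm_eq_inner)
    then show ?thesis
      by (simp add: matrix_vector_mult_diff_rdistrib proj_mat_mult_vec inner_diff_right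
          power2_eq_square inner_commute)
  qed
  moreover have "transpose (mat 1 - proj_mat e) = mat 1 - proj_mat e"
    by (simp add: transpose_def mat_def proj_mat_def vec_eq_iff mult.commute)
  ultimately show ?thesis by (simp add: psd_def)
qed

lemma F_subharmonic_imp_vsub_at:
  "F_subharmonic F X (\<lambda>x. ereal (u x)) \<Longrightarrow> x \<in> X \<Longrightarrow> vsub_at F u x"
  unfolding F_subharmonic_def vsub_at_def ereal_less_eq(3) ereal.inject by blast

text \<open>Positive multiples of \<open>A\<close> converge to zero and \<open>F\<close> is closed.
  If \<open>- mat 1\<close> were in \<open>F\<close>, adding the positive semidefinite
  \<open>mat 1 - proj_mat e\<close> would put \<open>- proj_mat e\<close> into
  \<open>F\<close>.\<close>

lemma convex_subeqI:
  fixes F :: "(real^'n^'n) set"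
  assumes F: "cone_subequation F" "convex F" and A: "A \<in> F"
    and negP: "\<And>e. norm e = 1 \<Longrightarrow> - proj_mat e \<notin> F"
  shows "convex_subeq F"
proof
  show "closed F" "F \<subseteq> sym_mats" "convex F"
    and add: "\<And>A P. A \<in> F \<Longrightarrow> psd P \<Longrightarrow> A + P \<in> F"
    using F by (auto simp: cone_subequation_def)
  show scale: "t *\<^sub>R A \<in> F" if "A \<in> F" "0 < t" for A t
    using F(1) that unfolding cone_subequation_def by blast
  have "((\<lambda>n. (1 / real (Suc n)) *\<^sub>R A) \<longlonglongrightarrow> 0 *\<^sub>R A)"
    by (intro tendsto_intros LIMSEQ_Suc[OF lim_1_over_n])
  moreover have "(1 / real (Suc n)) *\<^sub>R A \<in> F" for n by (rule scale[OF A]) simp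
  ultimately show "0 \<in> F"
    using closed_sequentially[OF \<open>closed F\<close>] by fastforce
  show "- mat 1 \<notin> F"
  proof
    assume "- mat 1 \<in> F"
    moreover have e: "norm (axis undefined 1 :: real^'n) = 1" by simp
    ultimately have "- mat 1 + (mat 1 - proj_mat (axis undefined 1)) \<in> F"
      by (intro add psd_id_minus_proj_mat)
    then show False using negP[OF e] by simp
  qed
qed

theorem theorem7p4:
  fixes F :: "(real^'n^'n) set" and \<Omega> :: "(real^'n) set" and x0 :: "real^'n"
    and h :: "real^'n \<Rightarrow> real"
  assumes F: "cone_subequation F" "convex F"
    and negP: "\<forall>e. norm e = 1 \<longrightarrow> - proj_mat e \<notin> F"
    and dom: "open \<Omega>" "connected \<Omega>" "bounded \<Omega>"
    and bd: "smooth_boundary \<Omega>" "strictly_F_convex_boundary F \<Omega>"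
    and x0: "x0 \<in> \<Omega>"
    and hcont: "continuous_on (closure \<Omega>) h"
    and hharm: "F_harmonic F (\<Omega> - {x0}) h"
    and hsub: "\<exists>r>0. F_subharmonic F (ball x0 r) (\<lambda>x. ereal (h x))"
    and hmin: "\<forall>\<^sub>F x in at x0. h x > h x0"
    and hnotest: "\<not> (\<exists>\<phi> A. C2_hess \<phi> x0 A \<and> (\<forall>\<^sub>F y in nhds x0. h y \<le> \<phi> y) \<and> h x0 = \<phi> x0)"
    and hbd: "h x0 < Inf (h ` frontier \<Omega>)"
    and H3: "\<forall>H :: real^'n \<Rightarrow> real. \<forall>r s. r > 0 \<and> s > 0
               \<and> F_subharmonic F (ball x0 r) (\<lambda>x. ereal (H x))
               \<and> F_harmonic F (ball x0 s - {x0}) H \<longrightarrow>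
               (\<exists>L\<ge>0. ((\<lambda>x. (H x - H x0) / (h x - h x0)) \<longlongrightarrow> L) (at x0))"
    and H4: "\<forall>H :: real^'n \<Rightarrow> real. \<forall>r. r > 0 \<and> F_harmonic F (ball x0 r) H \<longrightarrow>
               ((\<lambda>x. (H x - H x0) / (h x - h x0)) \<longlongrightarrow> 0) (at x0)"
  shows "\<forall>\<Theta>::real. \<forall>\<phi>::real^'n \<Rightarrow> real. \<Theta> \<ge> 0 \<and> continuous_on (frontier \<Omega>) \<phi> \<longrightarrow>
           (\<exists>H. continuous_on (closure \<Omega>) H \<and> F_harmonic F (\<Omega> - {x0}) H
                \<and> (\<forall>x\<in>frontier \<Omega>. H x = \<phi> x)
                \<and> ((\<lambda>x. (H x - H x0) / (h x - h x0)) \<longlongrightarrow> \<Theta>) (at x0)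
                \<and> (\<forall>H'. continuous_on (closure \<Omega>) H' \<and> F_harmonic F (\<Omega> - {x0}) H'
                        \<and> (\<forall>x\<in>frontier \<Omega>. H' x = \<phi> x)
                        \<and> ((\<lambda>x. (H' x - H' x0) / (h x - h x0)) \<longlongrightarrow> \<Theta>) (at x0)
                        \<longrightarrow> (\<forall>x\<in>closure \<Omega>. H' x = H x)))"
proof (intro allI impI, goal_cases)
  case (1 \<Theta> \<phi>)
  then have \<Theta>: "\<Theta> \<ge> 0" and \<phi>: "continuous_on (frontier \<Omega>) \<phi>" by auto
  \<comment> \<open>A bounded nonempty set has a frontier point, and strict convexity there exhibits
    an element of \<open>F\<close>.\<close>
  have "\<Omega> \<noteq> UNIV" using dom(3) not_bounded_UNIV by blast
  then have "frontier \<Omega> \<noteq> {}" using x0 frontier_eq_empty[of \<Omega>] by blast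
  then obtain b where b: "b \<in> frontier \<Omega>" by blast
  obtain U \<rho> g Hs where "local_defining_fn \<Omega> b U \<rho> g Hs"
    using bd(1) b unfolding smooth_boundary_def by blast
  then obtain A where "A \<in> sym_interior F"
    using bd(2) b unfolding strictly_F_convex_boundary_def by blast
  then have "A \<in> F" by (simp add: sym_interior_def)
  interpret convex_subeq F
    by (rule convex_subeqI[OF F \<open>A \<in> F\<close>]) (use negP in blast)
  have cl: "\<Omega> \<subseteq> closure \<Omega>" by (rule closure_subset)
  have frcl: "frontier \<Omega> \<subseteq> closure \<Omega>" by (simp add: frontier_def)
  have cf: "compact (frontier \<Omega>)" using dom(3) by (rule compact_frontier_bounded)
  have ch: "continuous_on (frontier \<Omega>) h" by (rule continuous_on_subset[OF hcont frcl])
  have bdd: "bounded (h ` frontier \<Omega>)"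
    by (rule compact_imp_bounded[OF compact_continuous_image[OF ch cf]])
  define m where "m = Inf (h ` frontier \<Omega>) - h x0"
  define M where "M = Sup (h ` frontier \<Omega>) - h x0"
  have m: "0 < m" using hbd by (simp add: m_def)
  have hb: "h x0 + m \<le> h x \<and> h x \<le> h x0 + M" if "x \<in> frontier \<Omega>" for x
    using that bdd by (auto simp: m_def M_def intro!: cInf_lower cSup_upper bounded_imp_bdd_below bounded_imp_bdd_above)
  have M: "0 < M" using hb[OF b] m by linarith
  have harm_iff: "F_harmonic F X u \<longleftrightarrow> continuous_on X u \<and> (\<forall>x\<in>X. vsub_at F u x)
      \<and> (\<forall>x\<in>X. vsub_at (dual_subeq F) (\<lambda>y. - u y) x)" for X u
    unfolding F_harmonic_def
    using F_subharmonic_iff_vsub[of X u F] F_subharmonic_iff_vsub[of X "\<lambda>y. - u y" "dual_subeq F"]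
    by (auto intro: continuous_on_minus)
  obtain s where s: "s > 0" "ball x0 s \<subseteq> \<Omega>" using dom(1) x0 openE by blast
  obtain r where r: "r > 0" "F_subharmonic F (ball x0 r) (\<lambda>x. ereal (h x))" using hsub by blast
  have h_x0: "vsub_at F h x0"
    by (rule F_subharmonic_imp_vsub_at[OF r(2)]) (use r(1) in simp)
  interpret S: singular_dirichlet F \<Omega> x0 h m M
  proof
    show "vsub_at F h x" if "x \<in> \<Omega>" for x
      using h_x0 hharm that by (cases "x = x0") (auto simp: harm_iff)
    show "vsub_at (dual_subeq F) (\<lambda>y. - h y) x" if "x \<in> \<Omega> - {x0}" for x
      using hharm that by (auto simp: harm_iff)
    \<comment> \<open>(H3) is local, so it is applied to the restriction to a ball inside
      \<Omega>.\<close>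
    show "\<exists>L\<ge>0. ((\<lambda>x. (H x - H x0) / (h x - h x0)) \<longlongrightarrow> L) (at x0)"
      if "continuous_on \<Omega> H" "\<And>x. x \<in> \<Omega> \<Longrightarrow> vsub_at F H x"
        "\<And>x. x \<in> \<Omega> - {x0} \<Longrightarrow> vsub_at (dual_subeq F) (\<lambda>y. - H y) x" for H
    proof -
      have c: "continuous_on (ball x0 s) H" using that(1) s(2) by (rule continuous_on_subset)
      have "F_subharmonic F (ball x0 s) (\<lambda>x. ereal (H x))"
        using F_subharmonic_iff_vsub[OF c] that(2) s(2) by blast
      moreover have "F_harmonic F (ball x0 s - {x0}) H"
        unfolding harm_iff using continuous_on_subset[OF c] that(2,3) s(2) by blast
      ultimately show ?thesis using H3 s(1) by blast
    qed
    show "((\<lambda>x. (H x - H x0) / (h x - h x0)) \<longlongrightarrow> 0) (at x0)"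
      if "continuous_on \<Omega> H" "\<And>x. x \<in> \<Omega> \<Longrightarrow> vsub_at F H x"
        "\<And>x. x \<in> \<Omega> \<Longrightarrow> vsub_at (dual_subeq F) (\<lambda>y. - H y) x" for H
    proof -
      have "F_harmonic F (ball x0 s) H"
        unfolding harm_iff using continuous_on_subset[OF that(1) s(2)] that(2,3) s(2) by blast
      then show ?thesis using H4 s(1) by blast
    qed
  qed (use F dom x0 bd hcont hmin m hb M in auto)
  obtain H0 where H0: "continuous_on (closure \<Omega>) H0" "\<forall>x\<in>\<Omega>. vsub_at F H0 x"
    "\<forall>x\<in>\<Omega>. vsub_at (dual_subeq F) (\<lambda>y. - H0 y) x" "\<forall>x\<in>frontier \<Omega>. H0 x = \<phi> x"
    using dirichlet_problem[OF dom(1,3) bd \<phi>] by (elim exE conjE) (rule that)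
  interpret B: boundary_data F \<Omega> x0 h m M \<phi> H0
  proof
    show "continuous_on (frontier \<Omega>) \<phi>" by (rule \<phi>)
    show "continuous_on (closure \<Omega>) H0" by (rule H0(1))
    show "vsub_at F H0 x" if "x \<in> \<Omega>" for x by (rule bspec[OF H0(2) that])
    show "vsub_at (dual_subeq F) (\<lambda>y. - H0 y) x" if "x \<in> \<Omega>" for x by (rule bspec[OF H0(3) that])
    show "H0 x = \<phi> x" if "x \<in> frontier \<Omega>" for x by (rule bspec[OF H0(4) that])
  qed
  obtain H where H: "continuous_on (closure \<Omega>) H" "\<And>x. x \<in> \<Omega> - {x0} \<Longrightarrow> vsub_at F H x"
    "\<And>x. x \<in> \<Omega> - {x0} \<Longrightarrow> vsub_at (dual_subeq F) (\<lambda>y. - H y) x" "\<And>x. x \<in> frontier \<Omega> \<Longrightarrow> H x = \<phi> x"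
    "((\<lambda>x. (H x - H x0) / (h x - h x0)) \<longlongrightarrow> \<Theta>) (at x0)"
    using B.density_attained[OF \<Theta>] by (elim exE conjE) (rule that, auto)
  have sub: "\<Omega> - {x0} \<subseteq> closure \<Omega>" using cl by blast
  show ?case
  proof (intro exI[of _ H] conjI allI impI ballI)
    show "F_harmonic F (\<Omega> - {x0}) H"
      unfolding harm_iff using H continuous_on_subset[OF H(1) sub] by blast
    fix H' x
    assume x: "x \<in> closure \<Omega>" and "continuous_on (closure \<Omega>) H' \<and> F_harmonic F (\<Omega> - {x0}) H'
      \<and> (\<forall>x\<in>frontier \<Omega>. H' x = \<phi> x) \<and> ((\<lambda>x. (H' x - H' x0) / (h x - h x0)) \<longlongrightarrow> \<Theta>) (at x0)"
    then have c': "continuous_on (closure \<Omega>) H'"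
      and s': "\<And>x. x \<in> \<Omega> - {x0} \<Longrightarrow> vsub_at F H' x"
      and d': "\<And>x. x \<in> \<Omega> - {x0} \<Longrightarrow> vsub_at (dual_subeq F) (\<lambda>y. - H' y) x"
      and b': "\<And>x. x \<in> frontier \<Omega> \<Longrightarrow> H' x = \<phi> x"
      and l': "((\<lambda>x. (H' x - H' x0) / (h x - h x0)) \<longlongrightarrow> \<Theta>) (at x0)"
      by (simp_all add: harm_iff)
    show "H' x = H x"
    proof (rule antisym)
      show "H' x \<le> H x"
        by (rule S.density_le[OF c' s' H(1,3) _ l' H(5) x]) (simp_all add: b' H(4))
      show "H x \<le> H' x"
        by (rule S.density_le[OF H(1,2) c' d' _ H(5) l' x]) (simp_all add: b' H(4))
    qed
  qed (use H in auto)
qed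

end
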